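(* Let $d\in\mathbb{N}$, let $\mathcal{M}=\mathbb{R}^d$ or $\mathcal{M}=\mathbb{T}^d$, let $k\ge 2$ be an integer, and let $s<0$. Consider the nonlinear wave equation $$\partial_t^2u-\Delta u=\pm u^k,\qquad (t,x)\in\mathbb{R}\times\mathcal{M},$$ with either choice of sign. Fix $(u_0,u_1)\in H^s(\mathcal{M})\times H^{s-1}(\mathcal{M})$. Then, given any $\varepsilon>0$, there exist a solution $u_\varepsilon$ to this equation on $\mathcal{M}$ and a time $t_\varepsilon\in(0,\varepsilon)$ such that $$\|(u_\varepsilon(0),\partial_tu_\varepsilon(0))-(u_0,u_1)\|_{H^s(\mathcal{M})\times H^{s-1}(\mathcal{M})}<\varepsilon\qquad\text{and}\qquad \|u_\varepsilon(t_\varepsilon)\|_{H^s(\mathcal{M})}>\varepsilon^{-1}.$$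
   Context: $\mathbb{N}=\{1,2,\dots\}$, $\mathbb{T}=\mathbb{R}/2\pi\mathbb{Z}$; functions may be complex-valued. $\widehat{f}$ is the Fourier transform on $\mathcal{M}$ (any fixed standard normalization), a function on $\widehat{\mathcal{M}}$, where $\widehat{\mathcal{M}}=\mathbb{R}^d$ (Lebesgue measure) if $\mathcal{M}=\mathbb{R}^d$ and $\widehat{\mathcal{M}}=\mathbb{Z}^d$ (counting measure) if $\mathcal{M}=\mathbb{T}^d$. $\langle\xi\rangle=(1+|\xi|^2)^{1/2}$, and $\|f\|_{H^s(\mathcal{M})}=\|\langle\xi\rangle^s\widehat{f}\|_{L^2(\widehat{\mathcal{M}})}$. $\mathcal{F}L^{s,1}(\mathcal{M})$ has norm $\|\langle\xi\rangle^s\widehat{f}\|_{L^1(\widehat{\mathcal{M}})}$, and $\mathcal{F}L^1=\mathcal{F}L^{0,1}$. Notion of solution: $u\in C([0,T];\mathcal{F}L^1(\mathcal{M}))$ for some $T\ge t_\varepsilon$, with initial data $(u,\partial_tu)|_{t=0}=(v_0,v_1)\in\mathcal{F}L^{0,1}\times\mathcal{F}L^{-1,1}$, satisfying the Duhamel formulation $$u(t)=\cos(t|\nabla|)v_0+\frac{\sin(t|\nabla|)}{|\nabla|}v_1\pm\int_0^t\frac{\sin((t-t')|\nabla|)}{|\nabla|}\big[u(t')^k\big]\,dt',\qquad 0\le t\le T,$$ where $m(|\nabla|)$ is the Fourier multiplier with symbol $m(|\xi|)$ and $\frac{\sin(t|0|)}{|0|}:=t$. Writing a norm of a function presupposes that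 the function belongs to the corresponding space. *)

theory Defs
  imports "HOL-Analysis.Analysis"
begin

section \<open>The underlying space and its dual\<close>

text \<open>
  The constructors stand for \<open>\<M> = \<real>\<^sup>d\<close> and \<open>\<M> = \<T>\<^sup>d\<close>, with \<open>d = CARD('n)\<close>.  Functions on \<open>\<T>\<^sup>d\<close> are
  functions on \<open>real ^ 'n\<close> that are \<open>2\<pi>\<close>-periodic in every coordinate, integrated over one period
  cell.  The dual group \<open>\<int>\<^sup>d\<close> is the integer lattice inside \<open>real ^ 'n\<close>, with counting measure.
\<close>

datatype manifold = Euclidean | Torus

definition int_lattice :: "(real ^ 'n) set"
  where "int_lattice = {\<xi>. \<forall>i. \<xi> $ i \<in> \<int>}"

definition phys_measure :: "manifold \<Rightarrow> (real ^ 'n) measure"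
  where "phys_measure M = (case M of
      Euclidean \<Rightarrow> lborel
    | Torus \<Rightarrow> restrict_space lborel (cbox 0 (\<chi> i. 2 * pi)))"

definition dual_measure :: "manifold \<Rightarrow> (real ^ 'n) measure"
  where "dual_measure M = (case M of
      Euclidean \<Rightarrow> lborel
    | Torus \<Rightarrow> count_space int_lattice)"

definition function_on :: "manifold \<Rightarrow> (real ^ 'n \<Rightarrow> complex) \<Rightarrow> bool"
  where "function_on M f \<longleftrightarrow> (case M of
      Euclidean \<Rightarrow> True
    | Torus \<Rightarrow> (\<forall>x i. f (x + (2 * pi) *\<^sub>R axis i 1) = f x))"

section \<open>Test functions and distributions\<close>

fun iter_partial :: "'n list \<Rightarrow> (real ^ 'n \<Rightarrow> complex) \<Rightarrow> real ^ 'n \<Rightarrow> complex"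
  where
    "iter_partial [] f = f"
  | "iter_partial (i # is) f =
       (\<lambda>x. frechet_derivative (iter_partial is f) (at x) (axis i 1))"

definition smooth :: "(real ^ 'n \<Rightarrow> complex) \<Rightarrow> bool"
  where "smooth f \<longleftrightarrow> (\<forall>is x. iter_partial is f differentiable (at x))"

definition decay_weight :: "manifold \<Rightarrow> real ^ 'n \<Rightarrow> real"
  where "decay_weight M x = (case M of Euclidean \<Rightarrow> 1 + norm x | Torus \<Rightarrow> 1)"

text \<open>
  Schwartz functions on \<open>\<real>\<^sup>d\<close>, smooth functions on \<open>\<T>\<^sup>d\<close> (for which the boundedness clause holds
  automatically).
\<close>

definition test_function :: "manifold \<Rightarrow> (real ^ 'n \<Rightarrow> complex) \<Rightarrow> bool"
  where "test_function M \<phi> \<longleftrightarrow> function_on M \<phi> \<and> smooth \<phi> \<and>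
    (\<forall>N is. bdd_above (range (\<lambda>x. decay_weight M x ^ N * cmod (iter_partial is \<phi> x))))"

definition test_seminorm :: "manifold \<Rightarrow> nat \<Rightarrow> (real ^ 'n \<Rightarrow> complex) \<Rightarrow> real"
  where "test_seminorm M N \<phi> =
    (SUP (is, x) \<in> {is. length is \<le> N} \<times> UNIV.
       decay_weight M x ^ N * cmod (iter_partial is \<phi> x))"

text \<open>
  A distribution (tempered on \<open>\<real>\<^sup>d\<close>) is a continuous linear functional on test functions.  It is
  represented by a functional on all functions, whose values at other arguments are irrelevant.
\<close>

type_synonym 'n distr = "(real ^ 'n \<Rightarrow> complex) \<Rightarrow> complex"

definition distribution :: "manifold \<Rightarrow> 'n::finite distr \<Rightarrow> bool"
  where "distribution M T \<longleftrightarrow>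
    (\<forall>a b \<phi> \<psi>. test_function M \<phi> \<longrightarrow> test_function M \<psi> \<longrightarrow>
       T (\<lambda>x. a * \<phi> x + b * \<psi> x) = a * T \<phi> + b * T \<psi>) \<and>
    (\<exists>C N. \<forall>\<phi>. test_function M \<phi> \<longrightarrow> cmod (T \<phi>) \<le> C * test_seminorm M N \<phi>)"

definition regular_distr :: "manifold \<Rightarrow> (real ^ 'n \<Rightarrow> complex) \<Rightarrow> 'n::finite distr"
  where "regular_distr M f = (\<lambda>\<phi>. \<integral>x. f x * \<phi> x \<partial>phys_measure M)"

section \<open>The Fourier transform\<close>

text \<open>
  The unitary normalization is used: a factor \<open>(2\<pi>)\<^sup>-\<^sup>d\<^sup>/\<^sup>2\<close> in the transform and in its inverse, on
  both spaces.
\<close>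

definition fourier_const :: "'n::finite itself \<Rightarrow> real"
  where "fourier_const _ = (2 * pi) powr (- real CARD('n) / 2)"

definition fourier_integral :: "(real ^ 'n \<Rightarrow> complex) \<Rightarrow> real ^ 'n \<Rightarrow> complex"
  where "fourier_integral \<phi> \<xi> =
    of_real (fourier_const TYPE('n)) * (\<integral>x. cis (- (x \<bullet> \<xi>)) * \<phi> x \<partial>lborel)"

text \<open>
  \<open>has_fourier M T g\<close>: the Fourier transform of the distribution \<open>T\<close> is the function \<open>g\<close>.  On \<open>\<real>\<^sup>d\<close>
  this is the duality \<open>\<langle>g, \<phi>\<rangle> = \<langle>T, \<phi>\<^sup>\<and>\<rangle>\<close>, determining \<open>g\<close> almost everywhere; on \<open>\<T>\<^sup>d\<close>, \<open>g\<close> is the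
  family of Fourier coefficients of \<open>T\<close>.
\<close>

definition has_fourier :: "manifold \<Rightarrow> 'n::finite distr \<Rightarrow> (real ^ 'n \<Rightarrow> complex) \<Rightarrow> bool"
  where "has_fourier M T g \<longleftrightarrow> (case M of
      Euclidean \<Rightarrow> g \<in> borel_measurable lborel \<and>
        (\<forall>\<phi>. test_function Euclidean \<phi> \<longrightarrow>
           integrable lborel (\<lambda>\<xi>. g \<xi> * \<phi> \<xi>) \<and>
           T (fourier_integral \<phi>) = (\<integral>\<xi>. g \<xi> * \<phi> \<xi> \<partial>lborel))
    | Torus \<Rightarrow> (\<forall>\<xi>\<in>int_lattice.
           g \<xi> = of_real (fourier_const TYPE('n)) * T (\<lambda>x. cis (- (x \<bullet> \<xi>)))))"

definition fourier :: "manifold \<Rightarrow> 'n::finite distr \<Rightarrow> real ^ 'n \<Rightarrow> complex"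
  where "fourier M T = (SOME g. has_fourier M T g)"

definition inv_fourier :: "manifold \<Rightarrow> (real ^ 'n \<Rightarrow> complex) \<Rightarrow> real ^ 'n \<Rightarrow> complex"
  where "inv_fourier M g x =
    of_real (fourier_const TYPE('n)) * (\<integral>\<xi>. cis (x \<bullet> \<xi>) * g \<xi> \<partial>dual_measure M)"

text \<open>
  \<open>m(|\<nabla>|) T\<close>, as a function on \<open>\<M>\<close>; meaningful when \<open>m(|\<xi>|) T\<^sup>\<and>(\<xi>)\<close> is integrable.
\<close>

definition fourier_mult :: "manifold \<Rightarrow> (real \<Rightarrow> real) \<Rightarrow> 'n::finite distr \<Rightarrow> real ^ 'n \<Rightarrow> complex"
  where "fourier_mult M m T = inv_fourier M (\<lambda>\<xi>. of_real (m (norm \<xi>)) * fourier M T \<xi>)"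

section \<open>Function spaces\<close>

definition japanese :: "real ^ 'n \<Rightarrow> real"
  where "japanese \<xi> = sqrt (1 + (norm \<xi>)\<^sup>2)"

definition in_Hs :: "manifold \<Rightarrow> real \<Rightarrow> 'n::finite distr \<Rightarrow> bool"
  where "in_Hs M s T \<longleftrightarrow> distribution M T \<and> has_fourier M T (fourier M T) \<and>
    integrable (dual_measure M) (\<lambda>\<xi>. (japanese \<xi> powr s * cmod (fourier M T \<xi>))\<^sup>2)"

definition Hs_norm :: "manifold \<Rightarrow> real \<Rightarrow> 'n::finite distr \<Rightarrow> real"
  where "Hs_norm M s T =
    sqrt (\<integral>\<xi>. (japanese \<xi> powr s * cmod (fourier M T \<xi>))\<^sup>2 \<partial>dual_measure M)"

definition Hs_pair_norm :: "manifold \<Rightarrow> real \<Rightarrow> 'n::finite distr \<Rightarrow> 'n distr \<Rightarrow> real"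
  where "Hs_pair_norm M s T0 T1 = sqrt ((Hs_norm M s T0)\<^sup>2 + (Hs_norm M (s - 1) T1)\<^sup>2)"

definition in_FL :: "manifold \<Rightarrow> real \<Rightarrow> 'n::finite distr \<Rightarrow> bool"
  where "in_FL M s T \<longleftrightarrow> distribution M T \<and> has_fourier M T (fourier M T) \<and>
    integrable (dual_measure M) (\<lambda>\<xi>. japanese \<xi> powr s * cmod (fourier M T \<xi>))"

definition FL_norm :: "manifold \<Rightarrow> real \<Rightarrow> 'n::finite distr \<Rightarrow> real"
  where "FL_norm M s T = (\<integral>\<xi>. japanese \<xi> powr s * cmod (fourier M T \<xi>) \<partial>dual_measure M)"

text \<open>
  Every element of \<open>\<F>L\<^sup>1\<close> is a continuous function; we always take this representative, so that
  powers and equalities are pointwise.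
\<close>

definition FL1_function :: "manifold \<Rightarrow> (real ^ 'n::finite \<Rightarrow> complex) \<Rightarrow> bool"
  where "FL1_function M f \<longleftrightarrow> function_on M f \<and> continuous_on UNIV f \<and>
    (\<forall>\<phi>. test_function M \<phi> \<longrightarrow> integrable (phys_measure M) (\<lambda>x. f x * \<phi> x)) \<and>
    in_FL M 0 (regular_distr M f)"

section \<open>Solutions of the nonlinear wave equation\<close>

definition wave_symbol :: "real \<Rightarrow> real \<Rightarrow> real"
  where "wave_symbol t r = (if r = 0 then t else sin (t * r) / r)"

text \<open>
  \<open>u \<in> C([0,T]; \<F>L\<^sup>1)\<close> solves \<open>\<partial>\<^sub>t\<^sup>2 u - \<Delta>u = \<sigma> u\<^sup>k\<close> with initial velocity \<open>\<partial>\<^sub>t u(0) = v1\<close>, in Duhamel form;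
  the initial position is \<open>u 0\<close>.  Point evaluations are continuous on \<open>\<F>L\<^sup>1\<close>, and so the
  \<open>\<F>L\<^sup>1\<close>-valued Duhamel integral is evaluated pointwise in \<open>x\<close>, where its integrand is continuous
  in \<open>t'\<close>.
\<close>

definition nlw_solution ::
    "manifold \<Rightarrow> nat \<Rightarrow> real \<Rightarrow> real \<Rightarrow> (real \<Rightarrow> real ^ 'n::finite \<Rightarrow> complex) \<Rightarrow> 'n distr \<Rightarrow> bool"
  where "nlw_solution M k \<sigma> T u v1 \<longleftrightarrow>
    (\<forall>t\<in>{0..T}. FL1_function M (u t)) \<and>
    (\<forall>t\<in>{0..T}. ((\<lambda>t'. FL_norm M 0 (regular_distr M (\<lambda>x. u t' x - u t x))) \<longlongrightarrow> 0)
                   (at t within {0..T})) \<and>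
    in_FL M (-1) v1 \<and>
    (\<forall>t\<in>{0..T}. \<forall>x.
       u t x = fourier_mult M (\<lambda>r. cos (t * r)) (regular_distr M (u 0)) x
             + fourier_mult M (wave_symbol t) v1 x
             + of_real \<sigma> * (LINT t':{0..t}|lborel.
                 fourier_mult M (wave_symbol (t - t')) (regular_distr M (\<lambda>y. u t' y ^ k)) x))"

end

theory Submission
  imports Defs "HOL-Probability.Characteristic_Functions" "HOL-Probability.Sinc_Integral"
begin

text \<open>
  Truncate \<open>u0\<close>, \<open>u1\<close> on the Fourier side and add to the position two bumps of amplitude \<open>A\<close> around the
  frequencies \<open>N e\<close> and \<open>-(k-1) N e\<close>; since \<open>s < 0\<close>, their \<open>H\<^sup>s\<close> norm vanishes as \<open>N \<rightarrow> \<infinity>\<close>.  Exactly one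
  type of interaction in \<open>u\<^sup>k\<close> lands at low frequency: \<open>k-1\<close> copies of the first bump with one copy of the
  second.  Its time factor is \<open>cos\<^sup>k\<^sup>-\<^sup>1 (N t) cos ((k-1) N t)\<close>, a combination of cosines with nonnegative
  coefficients whose constant term is positive, so the Duhamel integral is of size \<open>T\<^sup>2 A\<^sup>k\<close> uniformly in
  \<open>N\<close>.  Picard iteration in \<open>\<F>L\<^sup>1\<close> converges as long as \<open>T\<^sup>2 A\<^sup>k\<^sup>-\<^sup>1\<close> is small.  Fixing this quantity and
  letting \<open>A \<rightarrow> \<infinity>\<close>, and only then \<open>N \<rightarrow> \<infinity>\<close>, gives the result.
\<close>

section \<open>Gaussian integrals and Fourier inversion\<close>

text \<open>For \<open>s < 0\<close> the \<open>H^s\<close> norm hardly sees mass at high frequency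
  but still controls mass at low frequency, so inflation is detected by integrating the transform of
  \<open>u\<close> over a fixed ball around the origin. A product of \<open>k\<close> bump factors
  is centred at an integer multiple of \<open>k N e\<close>, and only the stated selection gives the
  multiple zero; this holds for every \<open>k \<ge> 2\<close>.

  Since \<open>N\<close> is chosen last, all bounds must be uniform in it. Positivity provides this
  without averaging over fast oscillations: against the low-frequency propagator, which is close to
  \<open>t - t'\<close>, a cosine of any frequency integrates to something nonnegative. Once
  \<open>T^2 A^m = \<theta>\<close> with \<open>m = k - 1\<close> is fixed, the resonant term and
  the part of the remainder that does not become negligible both grow like \<open>A\<close>, but the
  remainder carries one more factor \<open>\<theta>\<close>; a small \<open>\<theta>\<close> decides
  the competition.

  A separate obstacle is that \<open>fourier\<close> is a choice, determined on
  \<open>\<real>^d\<close> only almost everywhere. Hence inversion and uniqueness are proved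
  beforehand, and the solution is built on the frequency side from functions defined at every
  frequency.\<close>

lemma (in pair_sigma_finite) integrable_product_mult:
  fixes f g :: "_ \<Rightarrow> complex"
  assumes f: "integrable M1 f" and g: "integrable M2 g"
  shows "integrable (M1 \<Otimes>\<^sub>M M2) (\<lambda>(x, y). f x * g y)"
proof (rule Fubini_integrable)
  have [measurable]: "f \<in> borel_measurable M1" "g \<in> borel_measurable M2"
    using f g by auto
  show "(\<lambda>(x, y). f x * g y) \<in> borel_measurable (M1 \<Otimes>\<^sub>M M2)"
    by measurable
  show "integrable M1 (\<lambda>x. \<integral>y. norm (case (x, y) of (x, y) \<Rightarrow> f x * g y) \<partial>M2)"
    using integrable_norm[OF f] by (simp add: norm_mult)
qed (use g in auto)

text \<open>Lebesgue measure on \<open>real^'n\<close> is built over \<open>Basis\<close>, while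
  coordinates are indexed by \<open>'n\<close>; the bijection \<open>i \<mapsto> axis i 1\<close>
  carries Fubini for finite products from one index set to the other.\<close>

lemma
  fixes f :: "'n::finite \<Rightarrow> real \<Rightarrow> complex"
  assumes f: "\<And>i. integrable lborel (f i)"
  shows integrable_prod_vec: "integrable lborel (\<lambda>x::real^'n. \<Prod>i\<in>UNIV. f i (x $ i))"
    and integral_prod_vec: "(\<integral>(x::real^'n). (\<Prod>i\<in>UNIV. f i (x $ i)) \<partial>lborel) = (\<Prod>i\<in>UNIV. \<integral>y. f i y \<partial>lborel)"
proof -
  interpret P: product_sigma_finite "\<lambda>_::real^'n. lborel :: real measure"
    by standard
  define T where "T = (\<lambda>g::real^'n \<Rightarrow> real. \<Sum>b\<in>Basis. g b *\<^sub>R b)"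
  define I :: "real^'n \<Rightarrow> 'n" where "I = the_inv (\<lambda>i. axis i 1)"
  have inj: "inj (\<lambda>i::'n. axis i (1::real))"
    by (auto intro!: injI simp: axis_eq_axis)
  have I: "I (axis i 1) = i" for i
    unfolding I_def by (rule the_inv_f_f[OF inj])
  have B: "Basis = range (\<lambda>i::'n. axis i (1::real))"
    by (auto simp: Basis_vec_def)
  have [measurable]: "T \<in> (\<Pi>\<^sub>M b\<in>Basis. lborel) \<rightarrow>\<^sub>M borel"
    unfolding T_def by measurable
  have fm: "f i \<in> borel_measurable borel" for i
    using borel_measurable_integrable[OF f[of i]] by simp
  have m: "(\<lambda>x::real^'n. \<Prod>i\<in>UNIV. f i (x $ i)) \<in> borel_measurable borel"
  proof (rule borel_measurable_prod)
    fix i :: 'n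
    have "(\<lambda>x::real^'n. x $ i) \<in> borel_measurable borel"
      by (intro borel_measurable_continuous_onI continuous_intros)
    from measurable_compose[OF this fm] show "(\<lambda>x::real^'n. f i (x $ i)) \<in> borel_measurable borel" .
  qed
  have T: "T g $ i = g (axis i 1)" for g i
  proof -
    have "T g $ i = (\<Sum>j\<in>UNIV. g (axis j 1) * (axis j 1 :: real^'n) $ i)"
      unfolding T_def B by (subst sum.reindex[OF inj]) simp
    also have "\<dots> = (\<Sum>j\<in>UNIV. if j = i then g (axis i 1) else 0)"
      by (intro sum.cong) (auto simp: axis_def)
    finally show ?thesis by simp
  qed
  have eq: "(\<Prod>i\<in>UNIV. f i (T g $ i)) = (\<Prod>b\<in>Basis. f (I b) (g b))" for g
    unfolding B by (subst prod.reindex[OF inj]) (simp add: T I)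
  have li: "\<And>b. integrable lborel (f (I b))" using f .
  show "integrable lborel (\<lambda>x::real^'n. \<Prod>i\<in>UNIV. f i (x $ i))"
    apply (subst lborel_eq)
    apply (subst integrable_distr_eq)
      apply (simp add: T_def[symmetric])
     apply (simp add: m)
    unfolding eq[unfolded T_def]
    by (rule P.product_integrable_prod) (auto intro: li)
  show "(\<integral>(x::real^'n). (\<Prod>i\<in>UNIV. f i (x $ i)) \<partial>lborel) = (\<Prod>i\<in>UNIV. \<integral>y. f i y \<partial>lborel)"
    apply (subst lborel_eq)
    apply (subst integral_distr)
      apply (simp add: T_def[symmetric])
     apply (simp add: m)
    unfolding eq[unfolded T_def]
    apply (subst P.product_integral_prod)
      apply (auto intro: li)
    unfolding B by (subst prod.reindex[OF inj]) (simp add: I)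
qed

lemma integral_lborel_affine_scaleR:
  fixes f :: "'a::euclidean_space \<Rightarrow> 'b::{banach, second_countable_topology}"
  assumes "c \<noteq> 0" and f: "integrable lborel f"
  shows "integrable lborel (\<lambda>x. f (t + c *\<^sub>R x))"
    and "(\<integral>x. f x \<partial>lborel) = (\<bar>c\<bar> ^ DIM('a)) *\<^sub>R (\<integral>x. f (t + c *\<^sub>R x) \<partial>lborel)"
proof -
  have fm: "f \<in> borel_measurable borel" using borel_measurable_integrable[OF f] by simp
  have m: "(\<lambda>x. f (t + c *\<^sub>R x)) \<in> borel_measurable borel"
    by (rule measurable_compose[OF _ fm]) simp
  have "integrable (density (distr lborel borel (\<lambda>x. t + c *\<^sub>R x)) (\<lambda>_. ennreal (\<bar>c\<bar>^DIM('a)))) f"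
    using f lborel_affine[OF assms(1), of t] by (simp add: ennreal_power)
  then have "integrable (distr lborel borel (\<lambda>x. t + c *\<^sub>R x)) (\<lambda>x. \<bar>c\<bar>^DIM('a) *\<^sub>R f x)"
    by (subst (asm) integrable_density) (auto simp: fm)
  then have "integrable (distr lborel borel (\<lambda>x. t + c *\<^sub>R x)) f"
    using integrable_scaleR_right[of "inverse (\<bar>c\<bar>^DIM('a))"] assms(1) by force
  then show "integrable lborel (\<lambda>x. f (t + c *\<^sub>R x))"
    by (subst (asm) integrable_distr_eq) (auto simp: fm)
  have "(\<integral>x. f x \<partial>lborel) = (\<integral>x. f x \<partial>(density (distr lborel borel (\<lambda>x. t + c *\<^sub>R x)) (\<lambda>_. ennreal (\<bar>c\<bar>^DIM('a)))))"
    using lborel_affine[OF assms(1), of t] by (simp add: ennreal_power)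
  also have "\<dots> = (\<integral>x. \<bar>c\<bar>^DIM('a) *\<^sub>R f x \<partial>(distr lborel borel (\<lambda>x. t + c *\<^sub>R x)))"
    by (subst integral_density) (auto simp: fm)
  also have "\<dots> = (\<integral>x. \<bar>c\<bar>^DIM('a) *\<^sub>R f (t + c *\<^sub>R x) \<partial>lborel)"
    by (subst integral_distr) (auto intro!: borel_measurable_scaleR fm)
  also have "\<dots> = (\<bar>c\<bar> ^ DIM('a)) *\<^sub>R (\<integral>x. f (t + c *\<^sub>R x) \<partial>lborel)"
    by simp
  finally show "(\<integral>x. f x \<partial>lborel) = (\<bar>c\<bar> ^ DIM('a)) *\<^sub>R (\<integral>x. f (t + c *\<^sub>R x) \<partial>lborel)" .
qed

lemma integral_lborel_affine:
  fixes f :: "'a::euclidean_space \<Rightarrow> complex"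
  assumes "c \<noteq> 0" and f: "integrable lborel f"
  shows "integrable lborel (\<lambda>x. f (t + c *\<^sub>R x))"
    and "(\<integral>x. f x \<partial>lborel) = of_real (\<bar>c\<bar> ^ DIM('a)) * (\<integral>x. f (t + c *\<^sub>R x) \<partial>lborel)"
  using integral_lborel_affine_scaleR[OF assms, of t] by (simp_all add: scaleR_conv_of_real)

section \<open>Gaussians and inversion by Gaussian regularization\<close>

definition gauss :: "real^'n::finite \<Rightarrow> real"
  where "gauss x = exp (- (norm x)\<^sup>2 / 2)"

text \<open>This is the characteristic function of the standard normal distribution, with the factor
  \<open>1 / sqrt (2 * pi)\<close> of its density cleared.\<close>

lemma gaussian_fourier_1d:
  "integrable lborel (\<lambda>x::real. complex_of_real (exp (- x\<^sup>2 / 2)) * cis (x * t))"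
  "(\<integral>x. complex_of_real (exp (- x\<^sup>2 / 2)) * cis (x * t) \<partial>lborel) = of_real (sqrt (2 * pi) * exp (- t\<^sup>2 / 2))"
proof -
  have nd: "normal_density 0 1 x = exp (- x\<^sup>2 / 2) / sqrt (2 * pi)" for x
    by (simp add: normal_density_def)
  have "integrable lborel (\<lambda>x. normal_density 0 1 x)"
    by (rule integrable_normal_density) simp
  then have "integrable lborel (\<lambda>x::real. exp (- x\<^sup>2 / 2))"
    using integrable_mult_right[of "sqrt (2 * pi)" lborel "normal_density 0 1"] by (simp add: nd)
  then have i0: "integrable lborel (\<lambda>x::real. complex_of_real (exp (- x\<^sup>2 / 2)))"
    by (rule integrable_of_real)
  show i: "integrable lborel (\<lambda>x::real. complex_of_real (exp (- x\<^sup>2 / 2)) * cis (x * t))"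
    by (rule Bochner_Integration.integrable_bound[OF i0])
       (auto simp: norm_mult intro!: borel_measurable_continuous_onI continuous_intros)
  have "complex_of_real (exp (- (t^2) / 2)) = char std_normal_distribution t"
    by (simp add: char_std_normal_distribution)
  also have "\<dots> = (\<integral>x. normal_density 0 1 x *\<^sub>R iexp (t * x) \<partial>lborel)"
    unfolding char_def
    by (subst integral_density) (auto simp: normal_density_nonneg)
  also have "\<dots> = (\<integral>x. (1 / sqrt (2 * pi)) *\<^sub>R (complex_of_real (exp (- x\<^sup>2 / 2)) * cis (x * t)) \<partial>lborel)"
    by (intro Bochner_Integration.integral_cong refl)
       (simp add: nd cis_conv_exp scaleR_conv_of_real mult_ac)
  also have "\<dots> = (1 / sqrt (2 * pi)) *\<^sub>R (\<integral>x. complex_of_real (exp (- x\<^sup>2 / 2)) * cis (x * t) \<partial>lborel)"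
    by simp
  finally have "(\<integral>x. complex_of_real (exp (- x\<^sup>2 / 2)) * cis (x * t) \<partial>lborel) = sqrt (2 * pi) *\<^sub>R complex_of_real (exp (- (t^2) / 2))"
    by (simp only: scaleR_scaleR) simp
  then show "(\<integral>x. complex_of_real (exp (- x\<^sup>2 / 2)) * cis (x * t) \<partial>lborel) = of_real (sqrt (2 * pi) * exp (- t\<^sup>2 / 2))"
    by (simp add: scaleR_conv_of_real)
qed

lemma norm_vec_sq: "(norm (x::real^'n::finite))\<^sup>2 = (\<Sum>i\<in>UNIV. (x $ i)\<^sup>2)"
  by (simp add: norm_vec_def L2_set_def sum_nonneg)

lemma cis_sum: "finite A \<Longrightarrow> cis (\<Sum>i\<in>A. f i) = (\<Prod>i\<in>A. cis (f i))"
  by (induction A rule: finite_induct) (auto simp: cis_mult[symmetric])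

lemma cis_inner: "cis (x \<bullet> y) = (\<Prod>i\<in>UNIV. cis (x $ i * y $ i))" for x y :: "real^'n::finite"
  by (simp add: inner_vec_def cis_sum)

lemma gaussian_fourier:
  fixes y :: "real^'n::finite"
  shows "integrable lborel (\<lambda>x::real^'n. cis (x \<bullet> y) * complex_of_real (gauss x))"
    and "(\<integral>(x::real^'n). cis (x \<bullet> y) * complex_of_real (gauss x) \<partial>lborel) = of_real (sqrt (2 * pi) ^ CARD('n) * gauss y)"
proof -
  have g: "complex_of_real (gauss x) = (\<Prod>i\<in>UNIV. complex_of_real (exp (- (x $ i)\<^sup>2 / 2)))" for x :: "real^'n"
    by (simp add: gauss_def norm_vec_sq exp_sum[symmetric] sum_negf sum_divide_distrib of_real_prod[symmetric] del: of_real_prod of_real_exp)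
  have eq: "cis (x \<bullet> y) * complex_of_real (gauss x) = (\<Prod>i\<in>UNIV. complex_of_real (exp (- (x $ i)\<^sup>2 / 2)) * cis (x $ i * y $ i))" for x
    unfolding g cis_inner prod.distrib[symmetric] by (simp add: mult.commute)
  show "integrable lborel (\<lambda>x::real^'n. cis (x \<bullet> y) * complex_of_real (gauss x))"
    unfolding eq by (rule integrable_prod_vec) (rule gaussian_fourier_1d)
  show "(\<integral>(x::real^'n). cis (x \<bullet> y) * complex_of_real (gauss x) \<partial>lborel) = of_real (sqrt (2 * pi) ^ CARD('n) * gauss y)"
    unfolding eq
    apply (subst integral_prod_vec[where f="\<lambda>i a. complex_of_real (exp (- a\<^sup>2 / 2)) * cis (a * y $ i)"], rule gaussian_fourier_1d)
    unfolding gaussian_fourier_1d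
    unfolding of_real_mult prod.distrib g by simp
qed

lemma integrable_gauss: "integrable lborel (gauss :: real^'n::finite \<Rightarrow> real)"
  and integral_gauss: "(\<integral>(x::real^'n). complex_of_real (gauss x) \<partial>lborel) = of_real (sqrt (2 * pi) ^ CARD('n))"
proof -
  have "integrable lborel (\<lambda>x::real^'n. complex_of_real (gauss x))"
    using gaussian_fourier(1)[of 0] by simp
  from integrable_norm[OF this] show "integrable lborel (gauss :: real^'n::finite \<Rightarrow> real)"
    by (simp add: gauss_def[abs_def])
  show "(\<integral>(x::real^'n). complex_of_real (gauss x) \<partial>lborel) = of_real (sqrt (2 * pi) ^ CARD('n))"
    using gaussian_fourier(2)[of "0::real^'n"] by (simp add: gauss_def)
qed

lemma cis_measurable [measurable]: "cis \<in> borel_measurable borel"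
  by (intro borel_measurable_continuous_onI continuous_intros)

lemma continuous_gauss: "continuous_on A gauss"
  unfolding gauss_def by (intro continuous_intros) auto

lemma gauss_measurable [measurable]: "gauss \<in> borel_measurable borel"
  by (intro borel_measurable_continuous_onI continuous_gauss)

lemma gauss_bounds: "0 < gauss x" "gauss x \<le> 1"
  and abs_gauss [simp]: "\<bar>gauss x\<bar> = gauss x"
  by (simp_all add: gauss_def)

text \<open>Gaussian summation. The damping factor makes the double integral absolutely convergent,
  and Fubini moves the kernel onto the Gaussian, whose transform is an approximate identity at
  \<open>\<xi>\<close>. As \<open>e n\<close> tends to zero, integrability of \<open>\<psi>\<close>
  dominates the damped inversion integral, while continuity and the bound \<open>B\<close> make the
  averages of \<open>\<phi>\<close> converge to \<open>\<phi> \<xi>\<close>.\<close>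

lemma fourier_inversion_integrable:
  fixes \<phi> :: "real^'n::finite \<Rightarrow> complex"
  assumes phi: "integrable lborel \<phi>" and cont: "continuous_on UNIV \<phi>" and bd: "\<And>x. norm (\<phi> x) \<le> B"
  defines "\<psi> \<equiv> (\<lambda>x. \<integral>y. cis (- (y \<bullet> x)) * \<phi> y \<partial>lborel)"
  assumes psi: "integrable lborel \<psi>"
  shows "(\<integral>x. cis (x \<bullet> \<xi>) * \<psi> x \<partial>lborel) = of_real ((2 * pi) ^ CARD('n)) * \<phi> \<xi>"
proof -
  define e :: "nat \<Rightarrow> real" where "e n = inverse (Suc n)" for n
  have e0: "e n \<noteq> 0" for n by (simp add: e_def)
  have e: "e \<longlonglongrightarrow> 0" unfolding e_def by (rule LIMSEQ_inverse_real_of_nat)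
  have [measurable]: "\<phi> \<in> borel_measurable borel" using cont by (rule borel_measurable_continuous_onI)
  have [measurable]: "\<psi> \<in> borel_measurable borel" using borel_measurable_integrable[OF psi] by simp
  define K where "K n = (\<integral>x. cis (x \<bullet> \<xi>) * \<psi> x * complex_of_real (gauss (e n *\<^sub>R x)) \<partial>lborel)" for n
  have lim1: "K \<longlonglongrightarrow> (\<integral>x. cis (x \<bullet> \<xi>) * \<psi> x \<partial>lborel)"
    unfolding K_def
  proof (rule integral_dominated_convergence[where w="\<lambda>x. norm (\<psi> x)"])
    show "AE x in lborel. (\<lambda>i. cis (x \<bullet> \<xi>) * \<psi> x * complex_of_real (gauss (e i *\<^sub>R x))) \<longlonglongrightarrow> cis (x \<bullet> \<xi>) * \<psi> x"
    proof (rule AE_I2)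
      fix x :: "real^'n"
      have "(\<lambda>i. gauss (e i *\<^sub>R x)) \<longlonglongrightarrow> gauss (0 *\<^sub>R x)"
        by (rule continuous_on_tendsto_compose[OF continuous_gauss[of UNIV]]) (auto intro!: tendsto_scaleR[OF e tendsto_const, of x, simplified])
      then have g1: "(\<lambda>i. complex_of_real (gauss (e i *\<^sub>R x))) \<longlonglongrightarrow> of_real 1"
        by (intro tendsto_of_real) (simp add: gauss_def)
      show "(\<lambda>i. cis (x \<bullet> \<xi>) * \<psi> x * complex_of_real (gauss (e i *\<^sub>R x))) \<longlonglongrightarrow> cis (x \<bullet> \<xi>) * \<psi> x"
        using tendsto_mult[OF tendsto_const[of "cis (x \<bullet> \<xi>) * \<psi> x"] g1] by (simp only: mult_1_right of_real_1)
    qed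
    show "AE x in lborel. norm (cis (x \<bullet> \<xi>) * \<psi> x * complex_of_real (gauss (e i *\<^sub>R x))) \<le> norm (\<psi> x)" for i
      using gauss_bounds by (auto simp: norm_mult intro!: AE_I2 mult_left_le)
  qed (use psi in \<open>auto\<close>)
  \<comment> \<open>After Fubini the phase and the Gaussian are integrated in \<open>x\<close>
    first, so that the inner integral is the known transform of a rescaled Gaussian.\<close>
  have K_eq: "K n = of_real (sqrt (2 * pi) ^ CARD('n)) * (\<integral>z. \<phi> (\<xi> + e n *\<^sub>R z) * complex_of_real (gauss z) \<partial>lborel)" for n
  proof -
    define d where "d = CARD('n)"
    have Gi: "integrable lborel (\<lambda>x::real^'n. complex_of_real (gauss (e n *\<^sub>R x)))"
      using integral_lborel_affine(1)[OF e0, of "\<lambda>x. complex_of_real (gauss x)" 0 n]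
        gaussian_fourier(1)[of "0::real^'n"] by simp
    have prod_int: "integrable (lborel \<Otimes>\<^sub>M lborel) (\<lambda>(x::real^'n, y). complex_of_real (gauss (e n *\<^sub>R x)) * \<phi> y)"
      by (rule lborel_pair.integrable_product_mult) (use Gi phi in auto) 
    have int2: "integrable (lborel \<Otimes>\<^sub>M lborel) (\<lambda>(x, y). cis (x \<bullet> \<xi>) * cis (- (y \<bullet> x)) * (complex_of_real (gauss (e n *\<^sub>R x)) * \<phi> y))"
      by (rule Bochner_Integration.integrable_bound[OF prod_int]) (auto simp: norm_mult)
    have "K n = (\<integral>x. (\<integral>y. cis (x \<bullet> \<xi>) * cis (- (y \<bullet> x)) * (complex_of_real (gauss (e n *\<^sub>R x)) * \<phi> y) \<partial>lborel) \<partial>lborel)"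
      unfolding K_def \<psi>_def
      by (intro Bochner_Integration.integral_cong refl)
         (simp add: Bochner_Integration.integral_mult_right_zero[symmetric] Bochner_Integration.integral_mult_left_zero[symmetric] mult_ac
           del: Bochner_Integration.integral_mult_right_zero Bochner_Integration.integral_mult_left_zero)
    also have "\<dots> = (\<integral>y. (\<integral>x. cis (x \<bullet> \<xi>) * cis (- (y \<bullet> x)) * (complex_of_real (gauss (e n *\<^sub>R x)) * \<phi> y) \<partial>lborel) \<partial>lborel)"
      using lborel_pair.Fubini_integral[OF int2] by simp
    also have "\<dots> = (\<integral>y. \<phi> y * (\<integral>x. cis (x \<bullet> (\<xi> - y)) * complex_of_real (gauss (e n *\<^sub>R x)) \<partial>lborel) \<partial>lborel)"
      by (intro Bochner_Integration.integral_cong refl)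
         (simp add: Bochner_Integration.integral_mult_right_zero[symmetric] mult_ac cis_mult inner_diff_right inner_commute
           del: Bochner_Integration.integral_mult_right_zero Bochner_Integration.integral_mult_left_zero)
    also have "\<dots> = (\<integral>y. \<phi> y * (of_real (\<bar>inverse (e n)\<bar> ^ d) * of_real (sqrt (2 * pi) ^ CARD('n) * gauss (inverse (e n) *\<^sub>R (\<xi> - y)))) \<partial>lborel)"
    proof (intro Bochner_Integration.integral_cong refl arg_cong2[where f="(*)"])
      fix y
      have i: "integrable lborel (\<lambda>x. cis (x \<bullet> (\<xi> - y)) * complex_of_real (gauss (e n *\<^sub>R x)))"
        by (rule Bochner_Integration.integrable_bound[OF Gi]) (auto simp: norm_mult)
      show "(\<integral>x. cis (x \<bullet> (\<xi> - y)) * complex_of_real (gauss (e n *\<^sub>R x)) \<partial>lborel) =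
          of_real (\<bar>inverse (e n)\<bar> ^ d) * of_real (sqrt (2 * pi) ^ CARD('n) * gauss (inverse (e n) *\<^sub>R (\<xi> - y)))"
        unfolding integral_lborel_affine(2)[OF _ i, of "inverse (e n)" 0, OF nonzero_imp_inverse_nonzero[OF e0]]
        unfolding gaussian_fourier(2)[symmetric]
        using e0 by (simp add: d_def inner_commute)
    qed
    also have "\<dots> = of_real (sqrt (2 * pi) ^ CARD('n)) * (of_real (\<bar>inverse (e n)\<bar> ^ d) * (\<integral>y. \<phi> y * complex_of_real (gauss (inverse (e n) *\<^sub>R (\<xi> - y))) \<partial>lborel))"
      by (simp add: Bochner_Integration.integral_mult_right_zero[symmetric] mult_ac
           del: Bochner_Integration.integral_mult_right_zero Bochner_Integration.integral_mult_left_zero)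
    \<comment> \<open>The substitution \<open>y = \<xi> + e z\<close> cancels the Jacobian left over
      from the rescaling, so the limit below is taken against a fixed Gaussian.\<close>
    also have "(\<integral>y. \<phi> y * complex_of_real (gauss (inverse (e n) *\<^sub>R (\<xi> - y))) \<partial>lborel)
       = of_real (\<bar>e n\<bar> ^ d) * (\<integral>z. \<phi> (\<xi> + e n *\<^sub>R z) * complex_of_real (gauss z) \<partial>lborel)"
    proof -
      have i: "integrable lborel (\<lambda>y. \<phi> y * complex_of_real (gauss (inverse (e n) *\<^sub>R (\<xi> - y))))"
        by (rule Bochner_Integration.integrable_bound[OF phi])
           (use gauss_bounds in \<open>auto simp: norm_mult abs_of_pos intro!: AE_I2 mult_left_le\<close>)
      show ?thesis
        unfolding integral_lborel_affine(2)[OF e0 i, of n \<xi>] using e0 by (simp add: d_def gauss_def)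
    qed
    finally show ?thesis using e0[of n]
      by (simp add: power_inverse of_real_power[symmetric] field_simps del: of_real_power)
  qed
  have bdd: "norm (\<phi> y * complex_of_real (gauss x)) \<le> B * gauss x" for x y
    using gauss_bounds[of x] bd by (auto simp: norm_mult abs_of_pos intro!: mult_mono)
  have lim2: "K \<longlonglongrightarrow> of_real (sqrt (2 * pi) ^ CARD('n)) * (\<integral>(z::real^'n). \<phi> \<xi> * complex_of_real (gauss z) \<partial>lborel)"
    unfolding K_eq
  proof (rule tendsto_mult_left)
    show "(\<lambda>n. \<integral>z. \<phi> (\<xi> + e n *\<^sub>R z) * complex_of_real (gauss z) \<partial>lborel) \<longlonglongrightarrow> (\<integral>(z::real^'n). \<phi> \<xi> * complex_of_real (gauss z) \<partial>lborel)"
    proof (rule integral_dominated_convergence[where w="\<lambda>x::real^'n. B * gauss x"], goal_cases)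
      case 4
      show ?case
      proof (rule AE_I2)
        fix x :: "real^'n"
        have "(\<lambda>i. \<phi> (\<xi> + e i *\<^sub>R x)) \<longlonglongrightarrow> \<phi> (\<xi> + 0 *\<^sub>R x)"
          by (rule continuous_on_tendsto_compose[OF cont]) (auto intro!: tendsto_eq_intros e)
        then show "(\<lambda>i. \<phi> (\<xi> + e i *\<^sub>R x) * complex_of_real (gauss x)) \<longlonglongrightarrow> \<phi> \<xi> * complex_of_real (gauss x)"
          by (auto intro!: tendsto_intros)
      qed
    qed (use integrable_gauss bdd in auto)
  qed
  have "(sqrt (2 * pi) ^ CARD('n)) * (sqrt (2 * pi) ^ CARD('n)) = (2 * pi) ^ CARD('n)"
  proof -
    have "sqrt (2 * pi) * sqrt (2 * pi) = 2 * pi"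
      by (rule real_sqrt_mult_self[THEN trans]) simp
    then show ?thesis by (simp only: power_mult_distrib[symmetric])
  qed
  then have S: "complex_of_real (sqrt (2 * pi) ^ CARD('n)) * of_real (sqrt (2 * pi) ^ CARD('n)) = of_real ((2 * pi) ^ CARD('n))"
    by (metis of_real_mult)
  have "of_real (sqrt (2 * pi) ^ CARD('n)) * (\<integral>(z::real^'n). \<phi> \<xi> * complex_of_real (gauss z) \<partial>lborel) = of_real ((2 * pi) ^ CARD('n)) * \<phi> \<xi>"
    unfolding Bochner_Integration.integral_mult_right_zero integral_gauss S[symmetric] by (simp only: mult_ac)
  with LIMSEQ_unique[OF lim1 lim2] show ?thesis by simp
qed

section \<open>Uniqueness of the Fourier transform\<close>

text \<open>Dynkin's theorem: open boxes are stable under intersection and generate the Borel sets,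
  so the integral of \<open>h\<close> vanishes over every Borel set.\<close>

lemma AE_zero_if_integrals_box_zero:
  fixes h :: "'a::euclidean_space \<Rightarrow> complex"
  assumes h: "integrable lborel h" and z: "\<And>a b. (LINT x:box a b|lborel. h x) = 0"
  shows "AE x in lborel. h x = 0"
proof -
  have si: "A \<in> sets borel \<Longrightarrow> set_integrable lborel A h" for A
    using h unfolding set_integrable_def by (intro integrable_mult_indicator) auto
  \<comment> \<open>The complement step of the induction needs the integral over the whole space,
    which is exhausted by growing boxes.\<close>
  have U: "(LINT x:UNIV|lborel. h x) = 0"
  proof -
    let ?A = "\<lambda>n::nat. box (- (real n *\<^sub>R One)) (real n *\<^sub>R One) :: 'a set"
    have "incseq ?A"
    proof (rule incseq_SucI)
      fix n show "?A n \<subseteq> ?A (Suc n)"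
        by (auto simp: mem_box inner_simps intro: less_trans[rotated] less_le_trans order_le_less_trans)
           (smt (verit))+
    qed
    then have "(\<lambda>n. LINT x:?A n|lborel. h x) \<longlonglongrightarrow> (LINT x:(\<Union>n. ?A n)|lborel. h x)"
      by (intro set_integral_cont_up si) auto
    then show ?thesis unfolding UN_box_eq_UNIV z by (simp add: LIMSEQ_const_iff)
  qed
  have all: "(LINT x:A|lborel. h x) = 0" if "A \<in> sets borel" for A
  proof -
    let ?G = "range (\<lambda>(a, b). box a b::'a set)"
    have "A \<in> sigma_sets UNIV ?G" using that by (simp add: borel_eq_box)
    have I: "Int_stable ?G" by (auto simp: Int_stable_def box_Int_box)
    have sg: "sigma_sets UNIV ?G = sets borel" by (simp add: borel_eq_box)
    have P: "?G \<subseteq> Pow UNIV" by simp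
    from I P \<open>A \<in> sigma_sets UNIV ?G\<close> show ?thesis
    proof (induction rule: sigma_sets_induct_disjoint)
      case (compl A)
      then have A: "A \<in> sets borel" by (simp add: sg)
      have "(LINT x:A \<union> (UNIV - A)|lborel. h x) = (LINT x:A|lborel. h x) + (LINT x:UNIV - A|lborel. h x)"
        by (rule set_integral_Un) (use A in \<open>auto intro!: si\<close>)
      then show ?case using U compl by simp
    next
      case (union A)
      then have A: "A i \<in> sets borel" for i by (auto simp: sg)
      have "(LINT x:(\<Union>i. A i)|lborel. h x) = (\<Sum>i. (LINT x:(A i)|lborel. h x))"
        by (rule lebesgue_integral_countable_add)
           (use A union(1) in \<open>auto intro!: si simp: disjoint_family_on_def\<close>)
      then show ?case using union by simp
    qed (auto simp: z, simp add: set_lebesgue_integral_def)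
  qed
  have "AE x in lborel. Re (h x) = 0"
  proof (rule density_unique_real)
    fix A assume "A \<in> sets (lborel :: 'a measure)"
    then have A: "A \<in> sets borel" by simp
    have "(LINT x:A|lborel. Re (h x)) = Re (LINT x:A|lborel. h x)"
      using si[OF A] unfolding set_lebesgue_integral_def set_integrable_def
      by (subst integral_Re[symmetric]) auto
    then show "(LINT x:A|lborel. Re (h x)) = (LINT x:A|lborel. 0)" by (simp add: all[OF A])
  qed (use h in auto)
  moreover have "AE x in lborel. Im (h x) = 0"
  proof (rule density_unique_real)
    fix A assume "A \<in> sets (lborel :: 'a measure)"
    then have A: "A \<in> sets borel" by simp
    have "(LINT x:A|lborel. Im (h x)) = Im (LINT x:A|lborel. h x)"
      using si[OF A] unfolding set_lebesgue_integral_def set_integrable_def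
      by (subst integral_Im[symmetric]) auto
    then show "(LINT x:A|lborel. Im (h x)) = (LINT x:A|lborel. 0)" by (simp add: all[OF A])
  qed (use h in auto)
  ultimately show ?thesis by eventually_elim (simp add: complex_eq_iff)
qed

text \<open>A sigmoid in place of a compactly supported cutoff: \<open>l' = l (1 - l)\<close>
  expresses its derivatives as polynomials in \<open>l\<close> itself, so a class closed under
  differentiation can be generated algebraically, and rescaling turns it into a step function in the
  limit.\<close>

definition logistic :: "real \<Rightarrow> real"
  where "logistic y = inverse (1 + exp (- y))"

lemma logistic_bounds: "0 \<le> logistic y" "logistic y \<le> 1"
  by (auto simp: logistic_def add_pos_pos field_simps intro: add_nonneg_nonneg)

lemma has_real_derivative_logistic:
  "(logistic has_real_derivative logistic y * (1 - logistic y)) (at y)"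
proof -
  have p: "1 + exp (- y) \<noteq> 0" using exp_gt_zero[of "-y"] by linarith
  show ?thesis unfolding logistic_def
    by (rule derivative_eq_intros refl p)+ (use p in \<open>auto simp: field_simps power2_eq_square\<close>)
qed

lemma logistic_tendsto:
  "filterlim f at_top F \<Longrightarrow> ((\<lambda>n. logistic (f n)) \<longlongrightarrow> 1) F"
  "filterlim f at_bot F \<Longrightarrow> ((\<lambda>n. logistic (f n)) \<longlongrightarrow> 0) F"
proof -
  assume f: "filterlim f at_top F"
  have "((\<lambda>n. exp (- f n)) \<longlongrightarrow> 0) F"
    by (rule filterlim_compose[OF exp_at_bot]) (use f in \<open>simp add: filterlim_uminus_at_bot\<close>)
  then have "((\<lambda>n. inverse (1 + exp (- f n))) \<longlongrightarrow> inverse (1 + 0)) F"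
    by (intro tendsto_intros) auto
  then show "((\<lambda>n. logistic (f n)) \<longlongrightarrow> 1) F" by (simp add: logistic_def)
next
  assume f: "filterlim f at_bot F"
  have "filterlim (\<lambda>n. exp (- f n)) at_top F"
    by (rule filterlim_compose[OF exp_at_top]) (use f in \<open>simp add: filterlim_uminus_at_top\<close>)
  then have "filterlim (\<lambda>n. 1 + exp (- f n)) at_top F"
    by (intro filterlim_tendsto_add_at_top[OF tendsto_const])
  then show "((\<lambda>n. logistic (f n)) \<longlongrightarrow> 0) F"
    unfolding logistic_def by (intro tendsto_inverse_0_at_top)
qed

text \<open>Multiplied by a Gaussian, these functions are Schwartz functions; their products can
  approximate the indicator of a box.\<close>

inductive logistic_poly :: "(real^'n::finite \<Rightarrow> complex) \<Rightarrow> bool" where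
  const: "logistic_poly (\<lambda>x. c)"
| coord: "logistic_poly (\<lambda>x. of_real (x $ i))"
| logistic: "logistic_poly (\<lambda>x. of_real (logistic (a * x $ i + b)))"
| add: "logistic_poly f \<Longrightarrow> logistic_poly g \<Longrightarrow> logistic_poly (\<lambda>x. f x + g x)"
| mult: "logistic_poly f \<Longrightarrow> logistic_poly g \<Longrightarrow> logistic_poly (\<lambda>x. f x * g x)"

lemma logistic_poly_prod:
  "finite A \<Longrightarrow> (\<And>i. i \<in> A \<Longrightarrow> logistic_poly (f i)) \<Longrightarrow> logistic_poly (\<lambda>x. \<Prod>i\<in>A. f i x)"
  by (induction A rule: finite_induct) (auto intro: logistic_poly.intros)

text \<open>The generators have derivatives inside the class because of the logistic equation; sums
  and products follow by linearity and the product rule. The derivative is described by its value at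
  \<open>axis j 1\<close>, the form in which \<open>iter_partial\<close> uses it.\<close>

lemma logistic_poly_derivative:
  fixes f :: "real^'n::finite \<Rightarrow> complex"
  assumes "logistic_poly f"
  shows "\<exists>g. logistic_poly g \<and> (\<forall>x. \<exists>f'. (f has_derivative f') (at x) \<and> f' (axis j 1) = g x)"
  using assms
proof induction
  case (const c)
  show ?case by (rule exI[of _ "\<lambda>x. 0"]) (auto intro!: logistic_poly.const exI[of _ "\<lambda>x. 0"])
next
  case (coord i)
  have "((\<lambda>x::real^'n. complex_of_real (x $ i)) has_derivative (\<lambda>h. of_real (h $ i))) (at x)" for x
    by (intro derivative_intros bounded_linear_imp_has_derivative bounded_linear_vec_nth)
  then show ?case
    by (intro exI[of _ "\<lambda>x. of_real ((axis j 1 :: real^'n) $ i)"]) (auto intro: logistic_poly.const)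
next
  case (logistic a i b)
  let ?l = "\<lambda>x::real^'n. logistic (a * x $ i + b)"
  have d: "((\<lambda>x::real^'n. complex_of_real (?l x)) has_derivative (\<lambda>h. of_real (?l x * (1 - ?l x) * (a * h $ i)))) (at x)" for x
  proof -
    have "((\<lambda>x::real^'n. a * x $ i + b) has_derivative (\<lambda>h. a * h $ i + 0)) (at x)"
      by (intro derivative_intros bounded_linear_imp_has_derivative bounded_linear_vec_nth)
    from has_derivative_compose[OF this has_real_derivative_logistic[THEN has_field_derivative_imp_has_derivative]]
    have "(?l has_derivative (\<lambda>h. ?l x * (1 - ?l x) * (a * h $ i))) (at x)" by simp
    then show ?thesis by (rule has_derivative_of_real)
  qed
  show ?case
  proof (rule exI, intro conjI allI exI)
    \<comment> \<open>\<open>1 - l\<close> is written as \<open>1 + (-1) * l\<close> because the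
      class is generated by sums and products only.\<close>
    show "logistic_poly (\<lambda>x. of_real (?l x) * (1 + (-1) * of_real (?l x)) * of_real (a * (axis j 1 :: real^'n) $ i))"
      by (intro logistic_poly.intros)
    fix x
    show "((\<lambda>x::real^'n. complex_of_real (?l x)) has_derivative (\<lambda>h. of_real (?l x * (1 - ?l x) * (a * h $ i)))) (at x)" by (rule d)
  qed simp
next
  case (add f g)
  then obtain f1 g1 where *: "logistic_poly f1" "logistic_poly g1"
    "\<And>x. \<exists>f'. (f has_derivative f') (at x) \<and> f' (axis j 1) = f1 x"
    "\<And>x. \<exists>g'. (g has_derivative g') (at x) \<and> g' (axis j 1) = g1 x" by blast
  show ?case
  proof (rule exI[of _ "\<lambda>x. f1 x + g1 x"], intro conjI allI)
    fix x :: "real^'n"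
    from *(3,4)[of x] obtain f' g' where "(f has_derivative f') (at x)" "f' (axis j 1) = f1 x"
       "(g has_derivative g') (at x)" "g' (axis j 1) = g1 x" by blast
    then show "\<exists>f'. ((\<lambda>x. f x + g x) has_derivative f') (at x) \<and> f' (axis j 1) = f1 x + g1 x"
      by (intro exI[of _ "\<lambda>h. f' h + g' h"]) (auto intro!: derivative_intros)
  qed (use * in \<open>auto intro: logistic_poly.intros\<close>)
next
  case (mult f g)
  then obtain f1 g1 where *: "logistic_poly f1" "logistic_poly g1"
    "\<And>x. \<exists>f'. (f has_derivative f') (at x) \<and> f' (axis j 1) = f1 x"
    "\<And>x. \<exists>g'. (g has_derivative g') (at x) \<and> g' (axis j 1) = g1 x" by blast
  show ?case
  proof (rule exI[of _ "\<lambda>x. f x * g1 x + f1 x * g x"], intro conjI allI)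
    fix x :: "real^'n"
    from *(3,4)[of x] obtain f' g' where "(f has_derivative f') (at x)" "f' (axis j 1) = f1 x"
       "(g has_derivative g') (at x)" "g' (axis j 1) = g1 x" by blast
    then show "\<exists>f'. ((\<lambda>x. f x * g x) has_derivative f') (at x) \<and> f' (axis j 1) = f x * g1 x + f1 x * g x"
      by (intro exI[of _ "\<lambda>h. f x * g' h + f' h * g x"]) (auto intro!: has_derivative_mult)
  qed (use * mult in \<open>auto intro: logistic_poly.intros\<close>)
qed

lemma logistic_poly_bound:
  fixes f :: "real^'n::finite \<Rightarrow> complex"
  assumes "logistic_poly f"
  shows "\<exists>C N. \<forall>x. cmod (f x) \<le> C * (1 + norm x) ^ N"
  using assms
proof induction
  case (const c)
  show ?case by (rule exI[of _ "cmod c"], rule exI[of _ 0]) simp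
next
  case (coord i)
  show ?case
  proof (rule exI[of _ 1], rule exI[of _ 1], rule allI)
    fix x :: "real^'n"
    show "cmod (of_real (x $ i)) \<le> 1 * (1 + norm x) ^ 1"
      using component_le_norm_cart[of x i] by simp
  qed
next
  case (logistic a i b)
  show ?case
    by (rule exI[of _ 1], rule exI[of _ 0]) (use logistic_bounds in \<open>simp add: abs_of_nonneg\<close>)
next
  case (add f g)
  then obtain C N D K where *: "\<And>x. cmod (f x) \<le> C * (1 + norm x) ^ N" "\<And>x. cmod (g x) \<le> D * (1 + norm x) ^ K" by blast
  show ?case
  proof (rule exI[of _ "\<bar>C\<bar> + \<bar>D\<bar>"], rule exI[of _ "N + K"], rule allI)
    fix x :: "real^'n"
    have "cmod (f x) \<le> \<bar>C\<bar> * (1 + norm x) ^ N"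
      by (rule order_trans[OF *(1)]) (intro mult_right_mono, auto)
    also have "\<dots> \<le> \<bar>C\<bar> * (1 + norm x) ^ (N + K)"
      by (intro mult_left_mono power_increasing) auto
    finally have 1: "cmod (f x) \<le> \<bar>C\<bar> * (1 + norm x) ^ (N + K)" .
    have "cmod (g x) \<le> \<bar>D\<bar> * (1 + norm x) ^ K"
      by (rule order_trans[OF *(2)]) (intro mult_right_mono, auto)
    also have "\<dots> \<le> \<bar>D\<bar> * (1 + norm x) ^ (N + K)"
      by (intro mult_left_mono power_increasing) auto
    finally show "cmod (f x + g x) \<le> (\<bar>C\<bar> + \<bar>D\<bar>) * (1 + norm x) ^ (N + K)"
      using norm_triangle_ineq[of "f x" "g x"] 1 by (simp add: distrib_right)
  qed
next
  case (mult f g)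
  then obtain C N D K where *: "\<And>x. cmod (f x) \<le> C * (1 + norm x) ^ N" "\<And>x. cmod (g x) \<le> D * (1 + norm x) ^ K" by blast
  show ?case
  proof (rule exI[of _ "C * D"], rule exI[of _ "N + K"], rule allI)
    fix x :: "real^'n"
    have "cmod (f x * g x) \<le> (C * (1 + norm x) ^ N) * (D * (1 + norm x) ^ K)"
      unfolding norm_mult by (intro mult_mono *) (use norm_ge_zero order_trans[OF norm_ge_zero *(1)] in auto)
    then show "cmod (f x * g x) \<le> C * D * (1 + norm x) ^ (N + K)"
      by (simp add: power_add mult_ac)
  qed
qed

section \<open>Schwartz functions from Gaussians and logistic polynomials\<close>

lemma frechet_derivative_eqI:
  "(f has_derivative f') (at x) \<Longrightarrow> frechet_derivative f (at x) v = f' v"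
  using frechet_derivative_at by metis

lemma gauss_has_derivative:
  "((\<lambda>x::real^'n::finite. complex_of_real (gauss x)) has_derivative (\<lambda>h. of_real (- (x \<bullet> h) * gauss x))) (at x)"
proof -
  have g: "gauss = (\<lambda>x::real^'n. exp (- (x \<bullet> x) / 2))"
    by (simp add: gauss_def[abs_def] power2_norm_eq_inner)
  have "(gauss has_derivative (\<lambda>h. - (x \<bullet> h) * gauss x)) (at x)"
    unfolding g by (auto intro!: derivative_eq_intros simp: inner_commute algebra_simps)
  then show ?thesis by (rule has_derivative_of_real)
qed

text \<open>Differentiating the Gaussian brings down the factor \<open>- x $ i\<close>; this is why
  the coordinate functions are among the generators.\<close>

lemma gauss_logistic_poly_iter_partial:
  assumes "logistic_poly f"
  shows "\<exists>g. logistic_poly g \<and> iter_partial is (\<lambda>x. of_real (gauss x) * f x) = (\<lambda>x. of_real (gauss x) * g x)"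
proof (induction "is")
  case Nil
  show ?case using assms by auto
next
  case (Cons i "is")
  then obtain g where g: "logistic_poly g" "iter_partial is (\<lambda>x. of_real (gauss x) * f x) = (\<lambda>x. of_real (gauss x) * g x)" by blast
  from logistic_poly_derivative[OF g(1), of i] obtain g1 where g1: "logistic_poly g1" 
     "\<And>x. \<exists>g'. (g has_derivative g') (at x) \<and> g' (axis i 1) = g1 x" by blast
  have "frechet_derivative (\<lambda>x. of_real (gauss x) * g x) (at x) (axis i 1) = of_real (gauss x) * (g1 x + (-1) * of_real (x $ i) * g x)" for x
  proof -
    obtain g' where g': "(g has_derivative g') (at x)" "g' (axis i 1) = g1 x" using g1(2) by blast
    show ?thesis
      by (subst frechet_derivative_eqI[OF has_derivative_mult[OF gauss_has_derivative g'(1)]])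
         (simp add: g'(2) inner_axis algebra_simps)
  qed
  moreover have "logistic_poly (\<lambda>x. g1 x + (-1) * of_real (x $ i) * g x)"
    by (intro logistic_poly.intros g g1)
  ultimately show ?case using g(2) by auto
qed

text \<open>By \<open>1 + r \<le> exp r\<close> the left side is at most the exponential of
  \<open>N r - r^2 / 2\<close>, and completing the square bounds this exponent by
  \<open>N^2 / 2\<close>.\<close>

lemma gauss_decay: "(1 + norm x) ^ N * gauss x \<le> exp ((real N)\<^sup>2 / 2)"
proof -
  have "(1 + norm x) ^ N \<le> exp (norm x) ^ N"
    by (intro power_mono exp_ge_add_one_self) auto
  also have "\<dots> = exp (N * norm x)"
    by (simp add: exp_of_nat_mult)
  finally have "(1 + norm x) ^ N * gauss x \<le> exp (N * norm x) * exp (- (norm x)\<^sup>2 / 2)"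
    unfolding gauss_def by (intro mult_right_mono) auto
  also have "\<dots> = exp (N * norm x - (norm x)\<^sup>2 / 2)"
    by (simp add: exp_add[symmetric])
  also have "\<dots> \<le> exp ((real N)\<^sup>2 / 2)"
    using zero_le_power2[of "real N - norm x"] by (simp add: power2_diff)
  finally show ?thesis .
qed

lemma test_function_gauss_logistic_poly:
  fixes f :: "real^'n::finite \<Rightarrow> complex"
  assumes "logistic_poly f"
  shows "test_function Euclidean (\<lambda>x. of_real (gauss x) * f x)"
  unfolding test_function_def
proof (intro conjI allI)
  show "function_on Euclidean (\<lambda>x. of_real (gauss x) * f x)" by (simp add: function_on_def)
  show "smooth (\<lambda>x. of_real (gauss x) * f x)"
    unfolding smooth_def
  proof (intro allI)
    fix "is" and x :: "real^'n"
    from gauss_logistic_poly_iter_partial[OF assms, of "is"] obtain g where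
      g: "logistic_poly g" "iter_partial is (\<lambda>x. of_real (gauss x) * f x) = (\<lambda>x. of_real (gauss x) * g x)" by blast
    obtain g' where "(g has_derivative g') (at x)" using logistic_poly_derivative[OF g(1)] by blast
    from has_derivative_mult[OF gauss_has_derivative this]
    show "iter_partial is (\<lambda>x. of_real (gauss x) * f x) differentiable (at x)"
      unfolding g(2) differentiable_def by blast
  qed
  fix N and "is" :: "'n list"
  from gauss_logistic_poly_iter_partial[OF assms, of "is"] obtain g where
    g: "logistic_poly g" "iter_partial is (\<lambda>x. of_real (gauss x) * f x) = (\<lambda>x. of_real (gauss x) * g x)" by blast
  from logistic_poly_bound[OF g(1)] obtain C K where b: "\<And>x. cmod (g x) \<le> C * (1 + norm x) ^ K" by blast
  show "bdd_above (range (\<lambda>x. decay_weight Euclidean x ^ N * cmod (iter_partial is (\<lambda>x. of_real (gauss x) * f x) x)))"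
  proof (rule bdd_aboveI2)
    fix x :: "real^'n"
    have C: "0 \<le> C" using order_trans[OF norm_ge_zero b[of 0]] by simp
    have "decay_weight Euclidean x ^ N * cmod (iter_partial is (\<lambda>x. of_real (gauss x) * f x) x)
        = (1 + norm x) ^ N * (gauss x * cmod (g x))"
      by (simp add: g(2) decay_weight_def norm_mult)
    also have "\<dots> \<le> (1 + norm x) ^ N * (gauss x * (C * (1 + norm x) ^ K))"
      by (intro mult_left_mono b less_imp_le[OF gauss_bounds(1)]) auto
    also have "\<dots> = C * ((1 + norm x) ^ (N + K) * gauss x)"
      by (simp add: power_add mult_ac)
    also have "\<dots> \<le> C * exp ((real (N + K))\<^sup>2 / 2)"
      by (rule mult_left_mono[OF gauss_decay C])
    finally show "decay_weight Euclidean x ^ N * cmod (iter_partial is (\<lambda>x. of_real (gauss x) * f x) x) \<le> C * exp ((real (N + K))\<^sup>2 / 2)" .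
  qed
qed

text \<open>Nothing is assumed about integrability of \<open>g\<close> alone, so it is first
  multiplied by a Gaussian. The resulting \<open>h\<close> is integrable, and testing
  \<open>g\<close> with a Gaussian times logistic factors amounts to testing \<open>h\<close> with
  bounded approximations of box indicators.\<close>

lemma AE_zero_if_test_integrals_zero:
  fixes g :: "real^'n::finite \<Rightarrow> complex"
  assumes g: "\<And>\<phi>. test_function Euclidean \<phi> \<Longrightarrow> integrable lborel (\<lambda>\<xi>. g \<xi> * \<phi> \<xi>)"
    and z: "\<And>\<phi>. test_function Euclidean \<phi> \<Longrightarrow> (\<integral>\<xi>. g \<xi> * \<phi> \<xi> \<partial>lborel) = 0"
  shows "AE \<xi> in lborel. g \<xi> = 0"
proof -
  define h where "h \<xi> = g \<xi> * (of_real (gauss \<xi>) * 1)" for \<xi>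
  have h: "integrable lborel h"
    unfolding h_def by (intro g test_function_gauss_logistic_poly logistic_poly.const)
  have "AE x in lborel. h x = 0"
  proof (rule AE_zero_if_integrals_box_zero[OF h])
    fix a b :: "real^'n"
    \<comment> \<open>With \<open>c = x $ i - a $ i\<close> the first argument is
      \<open>n^2 c - n\<close>: the quadratic term wins if \<open>c > 0\<close>, and the extra
      \<open>- n\<close> forces the limit \<open>0\<close> also at \<open>c = 0\<close>. Together
      with the mirrored second factor the limit is exactly the indicator of the open box, boundary
      included.\<close>
    define p where "p n x i = logistic ((real n)\<^sup>2 * x $ i + (- ((real n)\<^sup>2 * a $ i) - n)) * (1 - logistic ((real n)\<^sup>2 * x $ i + (n - (real n)\<^sup>2 * b $ i)))" for n and x :: "real^'n" and i
    define P where "P n x = (\<Prod>i\<in>UNIV. complex_of_real (p n x i))" for n x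
    have "logistic_poly (\<lambda>x. complex_of_real (logistic ((real n)\<^sup>2 * x $ i + (- ((real n)\<^sup>2 * a $ i) - n))) * (1 + (-1) * of_real (logistic ((real n)\<^sup>2 * x $ i + (n - (real n)\<^sup>2 * b $ i)))))" for n i
      by (intro logistic_poly.intros)
    then have P: "logistic_poly (P n)" for n
      unfolding P_def p_def by (intro logistic_poly_prod) auto
    have Pm: "P n \<in> borel_measurable borel" for n
    proof (rule borel_measurable_continuous_onI, rule differentiable_imp_continuous_on)
      show "P n differentiable_on UNIV"
        using logistic_poly_derivative[OF P[of n]] by (auto simp: differentiable_on_def differentiable_def)
    qed
    have P1: "norm (P n x) \<le> 1" for n x
    proof -
      have "\<bar>p n x i\<bar> \<le> 1" for i
        unfolding p_def
        by (subst abs_of_nonneg) (auto intro!: mult_nonneg_nonneg mult_le_one simp: logistic_bounds)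
      then show ?thesis unfolding P_def prod_norm[symmetric]
        by (intro prod_le_1) auto
    qed
    have z: "(\<integral>x. P n x * h x \<partial>lborel) = 0" for n
      using z[OF test_function_gauss_logistic_poly[OF P[of n]]] by (simp add: h_def mult_ac)
    have lim: "(\<lambda>n. P n x) \<longlonglongrightarrow> indicator (box a b) x" for x
    proof -
      have n: "filterlim real at_top sequentially" by (rule filterlim_real_sequentially)
      have up: "filterlim (\<lambda>n. (real n)\<^sup>2 * c - real n) at_top sequentially" if "0 < c" for c :: real
      proof -
        have "filterlim (\<lambda>n. (-1) + c * real n) at_top sequentially"
          by (rule filterlim_tendsto_add_at_top[OF tendsto_const]) (rule filterlim_tendsto_pos_mult_at_top[OF tendsto_const that n])
        from filterlim_at_top_mult_at_top[OF n this] show ?thesis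
          by (simp add: power2_eq_square algebra_simps)
      qed
      have down: "filterlim (\<lambda>n. (real n)\<^sup>2 * c - real n) at_bot sequentially" if "c \<le> 0" for c :: real
      proof (rule filterlim_at_bot_mono)
        show "filterlim (\<lambda>n. - real n) at_bot sequentially"
          using n by (simp add: filterlim_uminus_at_top)
        show "\<forall>\<^sub>F n in sequentially. (real n)\<^sup>2 * c - real n \<le> - real n"
          using that by (intro always_eventually) (auto simp: mult_nonneg_nonpos)
      qed
      have A: "(\<lambda>n. logistic ((real n)\<^sup>2 * x $ i + (- ((real n)\<^sup>2 * a $ i) - n))) \<longlonglongrightarrow> (if a $ i < x $ i then 1 else 0)" for i
        using logistic_tendsto(1)[OF up, of "x $ i - a $ i"] logistic_tendsto(2)[OF down, of "x $ i - a $ i"]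
        by (auto simp: algebra_simps)
      have "(\<lambda>n. logistic (- ((real n)\<^sup>2 * (b $ i - x $ i) - n))) \<longlonglongrightarrow> (if x $ i < b $ i then 0 else 1)" for i
      proof (cases "x $ i < b $ i")
        case True
        then have "filterlim (\<lambda>n. - ((real n)\<^sup>2 * (b $ i - x $ i) - n)) at_bot sequentially"
          using up[of "b $ i - x $ i"] unfolding filterlim_uminus_at_bot minus_minus by simp
        from logistic_tendsto(2)[OF this] True show ?thesis by simp
      next
        case False
        then have "filterlim (\<lambda>n. - ((real n)\<^sup>2 * (b $ i - x $ i) - n)) at_top sequentially"
          using down[of "b $ i - x $ i"] unfolding filterlim_uminus_at_top minus_minus by simp
        from logistic_tendsto(1)[OF this] False show ?thesis by simp
      qed
      then have B: "(\<lambda>n. logistic ((real n)\<^sup>2 * x $ i + (n - (real n)\<^sup>2 * b $ i))) \<longlonglongrightarrow> (if x $ i < b $ i then 0 else 1)" for i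
        by (simp add: algebra_simps)
      have "(\<lambda>n. P n x) \<longlonglongrightarrow> (\<Prod>i\<in>UNIV. complex_of_real ((if a $ i < x $ i then 1 else 0) * (1 - (if x $ i < b $ i then 0 else 1))))"
        unfolding P_def p_def by (intro tendsto_prod tendsto_of_real tendsto_mult A tendsto_diff B tendsto_const)
      also have "(\<Prod>i\<in>UNIV. complex_of_real ((if a $ i < x $ i then 1 else 0) * (1 - (if x $ i < b $ i then 0 else 1)))) = indicator (box a b) x"
        by (auto simp: indicator_def mem_box_cart not_less intro!: prod.neutral) (metis not_less)+
      finally show ?thesis .
    qed
    have "(\<lambda>n. \<integral>x. P n x * h x \<partial>lborel) \<longlonglongrightarrow> (\<integral>x. indicator (box a b) x * h x \<partial>lborel)"
    proof (rule integral_dominated_convergence[where w="\<lambda>x. norm (h x)"])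
      show "AE x in lborel. (\<lambda>n. P n x * h x) \<longlonglongrightarrow> indicator (box a b) x * h x"
        by (intro AE_I2 tendsto_mult lim tendsto_const)
      show "AE x in lborel. norm (P n x * h x) \<le> norm (h x)" for n
        using P1 by (auto simp: norm_mult intro!: AE_I2 mult_left_le_one_le)
    qed (use h Pm in auto)
    then have "(\<integral>x. indicator (box a b) x * h x \<partial>lborel) = 0"
      by (simp add: z LIMSEQ_const_iff)
    moreover have "(\<integral>x. indicator (box a b) x * h x \<partial>lborel) = (LINT x:box a b|lborel. h x)"
      unfolding set_lebesgue_integral_def by (intro Bochner_Integration.integral_cong) (auto simp: indicator_def)
    ultimately show "(LINT x:box a b|lborel. h x) = 0" by simp
  qed
  then show ?thesis
    by eventually_elim (auto simp: h_def gauss_def)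
qed

section \<open>The Fourier transform of Schwartz functions\<close>

lemma iter_partial_append: "iter_partial js (iter_partial is f) = iter_partial (js @ is) f"
  by (induction js) auto

lemma smoothD: "smooth f \<Longrightarrow> iter_partial is f differentiable (at x)"
  by (simp add: smooth_def)

lemma smooth_continuous: "smooth f \<Longrightarrow> continuous_on UNIV f"
  using smoothD[of f "[]"] by (auto intro!: differentiable_imp_continuous_on simp: differentiable_on_def)

lemma iter_partial_lincomb:
  assumes "smooth f" "smooth g"
  shows "iter_partial is (\<lambda>x. a * f x + b * g x) = (\<lambda>x. a * iter_partial is f x + b * iter_partial is g x)"
proof (induction "is")
  case (Cons i "is")
  have "frechet_derivative (\<lambda>x. a * iter_partial is f x + b * iter_partial is g x) (at x) v =
     a * frechet_derivative (iter_partial is f) (at x) v + b * frechet_derivative (iter_partial is g) (at x) v" for x v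
  proof -
    have "((\<lambda>x. a * iter_partial is f x + b * iter_partial is g x) has_derivative
       (\<lambda>v. a * frechet_derivative (iter_partial is f) (at x) v + b * frechet_derivative (iter_partial is g) (at x) v)) (at x)"
      using smoothD[OF assms(1)] smoothD[OF assms(2)]
      by (intro has_derivative_add has_derivative_mult_right) (auto simp: frechet_derivative_works[symmetric])
    then show ?thesis by (rule frechet_derivative_eqI)
  qed
  then show ?case using Cons by simp
qed simp

lemma smooth_lincomb:
  assumes "smooth f" "smooth g"
  shows "smooth (\<lambda>x. a * f x + b * g x)"
  unfolding smooth_def iter_partial_lincomb[OF assms]
  using smoothD[OF assms(1)] smoothD[OF assms(2)]
  by (intro allI differentiable_add differentiable_mult differentiable_const) auto

lemma test_functionD:
  assumes "test_function M \<phi>"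
  shows "smooth \<phi>" "continuous_on UNIV \<phi>" "\<phi> \<in> borel_measurable borel"
  using assms smooth_continuous[of \<phi>] by (auto simp: test_function_def intro: borel_measurable_continuous_onI)

lemma test_function_lincomb:
  assumes "test_function Euclidean \<phi>" "test_function Euclidean \<psi>"
  shows "test_function Euclidean (\<lambda>x. a * \<phi> x + b * \<psi> x)"
  unfolding test_function_def
proof (intro conjI allI)
  show "function_on Euclidean (\<lambda>x. a * \<phi> x + b * \<psi> x)" by (simp add: function_on_def)
  show "smooth (\<lambda>x. a * \<phi> x + b * \<psi> x)" using assms by (intro smooth_lincomb) (auto dest: test_functionD)
  fix N and "is" :: "'a list"
  obtain C where C: "\<And>x. decay_weight Euclidean x ^ N * cmod (iter_partial is \<phi> x) \<le> C"
    using assms(1) unfolding test_function_def bdd_above_def by blast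
  obtain D where D: "\<And>x. decay_weight Euclidean x ^ N * cmod (iter_partial is \<psi> x) \<le> D"
    using assms(2) unfolding test_function_def bdd_above_def by blast
  show "bdd_above (range (\<lambda>x. decay_weight Euclidean x ^ N * cmod (iter_partial is (\<lambda>x. a * \<phi> x + b * \<psi> x) x)))"
  proof (rule bdd_aboveI2)
    fix x :: "real^'a"
    let ?w = "decay_weight Euclidean x ^ N"
    have w: "0 \<le> ?w" by (simp add: decay_weight_def)
    have "?w * cmod (iter_partial is (\<lambda>x. a * \<phi> x + b * \<psi> x) x) \<le> ?w * (cmod a * cmod (iter_partial is \<phi> x) + cmod b * cmod (iter_partial is \<psi> x))"
      using test_functionD[OF assms(1)] test_functionD[OF assms(2)]
      by (auto simp: iter_partial_lincomb norm_mult[symmetric] intro!: mult_left_mono norm_triangle_ineq w)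
    also have "\<dots> = cmod a * (?w * cmod (iter_partial is \<phi> x)) + cmod b * (?w * cmod (iter_partial is \<psi> x))"
      by (simp add: algebra_simps)
    also have "\<dots> \<le> cmod a * C + cmod b * D"
      by (intro add_mono mult_left_mono C D) auto
    finally show "?w * cmod (iter_partial is (\<lambda>x. a * \<phi> x + b * \<psi> x) x) \<le> cmod a * C + cmod b * D" .
  qed
qed

lemma test_function_iter_partial:
  assumes "test_function Euclidean \<phi>"
  shows "test_function Euclidean (iter_partial is \<phi>)"
  using assms unfolding test_function_def smooth_def function_on_def by (auto simp: iter_partial_append)

lemma test_function_decay:
  assumes "test_function Euclidean \<phi>"
  obtains C where "\<And>x. cmod (\<phi> x) \<le> C * inverse ((1 + norm x) ^ N)" "0 \<le> C"
proof -
  have "bdd_above (range (\<lambda>x. decay_weight Euclidean x ^ N * cmod (iter_partial [] \<phi> x)))"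
    using assms by (simp only: test_function_def) 
  then obtain C where C: "\<And>x. (1 + norm x) ^ N * cmod (\<phi> x) \<le> C"
    by (auto simp: bdd_above_def decay_weight_def)
  have p: "0 < (1 + norm x) ^ N" for x :: "real^'a"
    by (intro zero_less_power add_pos_nonneg) auto
  show ?thesis
  proof (rule that)
    show "cmod (\<phi> x) \<le> C * inverse ((1 + norm x) ^ N)" for x
      using C[of x] p[of x] by (simp add: field_simps)
    show "0 \<le> C" using order_trans[OF mult_nonneg_nonneg C[of 0]] by simp
  qed
qed

text \<open>The reciprocal of the symbol of the product of all \<open>1 - \<partial>_i^2\<close>. In
  product form its integrability is a one-variable fact, and it lies above
  \<open>(1 + norm x)^(-2d)\<close>, so it serves as comparison function both in space and in
  frequency.\<close>

definition cauchy_weight :: "real^'n::finite \<Rightarrow> real"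
  where "cauchy_weight x = (\<Prod>i\<in>UNIV. inverse (1 + (x $ i)\<^sup>2))"

lemma cauchy_weight_pos: "0 < cauchy_weight x"
  unfolding cauchy_weight_def by (intro prod_pos) (auto intro: add_pos_nonneg)

lemma abs_cauchy_weight [simp]: "\<bar>cauchy_weight x\<bar> = cauchy_weight x"
  using cauchy_weight_pos[of x] by simp

lemma integrable_cauchy_weight: "integrable lborel (cauchy_weight :: real^'n::finite \<Rightarrow> real)"
proof -
  have "integrable lborel (\<lambda>x::real. inverse (1 + x\<^sup>2))"
    using integrable_inverse_1_plus_square by (simp add: set_integrable_def einterval_def)
  then have i: "integrable lborel (\<lambda>x::real. complex_of_real (inverse (1 + x\<^sup>2)))"
    by (rule integrable_of_real)
  have "integrable lborel (\<lambda>x::real^'n. \<Prod>i\<in>UNIV. complex_of_real (inverse (1 + (x $ i)\<^sup>2)))"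
    by (rule integrable_prod_vec[OF i])
  then have "integrable lborel (\<lambda>x::real^'n. complex_of_real (cauchy_weight x))"
    by (simp add: cauchy_weight_def)
  from integrable_norm[OF this] show ?thesis by simp
qed

lemma inverse_power_le_cauchy_weight:
  "inverse ((1 + norm x) ^ (2 * CARD('n))) \<le> cauchy_weight x" for x :: "real^'n::finite"
proof -
  have "(\<Prod>i\<in>UNIV. 1 + (x $ i)\<^sup>2) \<le> (\<Prod>i\<in>(UNIV::'n set). (1 + norm x)\<^sup>2)"
  proof (intro prod_mono conjI)
    fix i
    have "(x $ i)\<^sup>2 \<le> (norm x)\<^sup>2" using component_le_norm_cart[of x i] by (simp add: abs_le_square_iff[symmetric])
    then show "1 + (x $ i)\<^sup>2 \<le> (1 + norm x)\<^sup>2"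
      by (simp add: power2_sum add_increasing2)
  qed simp
  also have "\<dots> = (1 + norm x) ^ (2 * CARD('n))"
    by (simp add: power_mult)
  finally have *: "(\<Prod>i\<in>UNIV. 1 + (x $ i)\<^sup>2) \<le> (1 + norm x) ^ (2 * CARD('n))" .
  have "0 < (\<Prod>i\<in>UNIV. 1 + (x $ i)\<^sup>2)"
    by (intro prod_pos) (auto intro: add_pos_nonneg)
  with * show ?thesis
    using le_imp_inverse_le[of "\<Prod>i\<in>UNIV. 1 + (x $ i)\<^sup>2" "(1 + norm x) ^ (2 * CARD('n))"]
    by (simp add: cauchy_weight_def prod_inversef[symmetric] comp_def)
qed

lemma integrable_if_decay:
  fixes f :: "real^'n::finite \<Rightarrow> complex"
  assumes [measurable]: "f \<in> borel_measurable borel"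
    and C: "\<And>x. cmod (f x) \<le> C * inverse ((1 + norm x) ^ (2 * CARD('n)))" "0 \<le> C"
  shows "integrable lborel f" "(\<integral>x. cmod (f x) \<partial>lborel) \<le> C * (\<integral>(x::real^'n). cauchy_weight x \<partial>lborel)"
proof -
  have b: "cmod (f x) \<le> C * cauchy_weight x" for x
    by (rule order_trans[OF C(1)]) (rule mult_left_mono[OF inverse_power_le_cauchy_weight C(2)])
  have i: "integrable lborel (\<lambda>x::real^'n. C * cauchy_weight x)"
    using integrable_cauchy_weight by (rule integrable_mult_right)
  show f: "integrable lborel f"
    by (rule Bochner_Integration.integrable_bound[OF i])
       (use b cauchy_weight_pos C(2) in \<open>auto intro!: AE_I2 simp: abs_mult\<close>)
  show "(\<integral>x. cmod (f x) \<partial>lborel) \<le> C * (\<integral>(x::real^'n). cauchy_weight x \<partial>lborel)"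
    unfolding Bochner_Integration.integral_mult_right_zero[symmetric]
    by (rule integral_mono[OF integrable_norm[OF f] i]) (rule b)
qed

lemma test_function_integrable:
  assumes "test_function Euclidean (\<phi> :: real^'n::finite \<Rightarrow> complex)"
  shows "integrable lborel \<phi>"
  using test_function_decay[OF assms, of "2 * CARD('n)"] integrable_if_decay(1)[of \<phi>] test_functionD[OF assms]
  by metis

lemma integrable_cis_mult:
  fixes f :: "real^'n::finite \<Rightarrow> complex"
  assumes "integrable lborel f"
  shows "integrable lborel (\<lambda>x. cis (- (x \<bullet> \<xi>)) * f x)"
  by (rule Bochner_Integration.integrable_bound[OF assms]) (use assms in \<open>auto simp: norm_mult\<close>)

definition fourier_raw :: "(real^'n::finite \<Rightarrow> complex) \<Rightarrow> real^'n \<Rightarrow> complex"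
  where "fourier_raw \<phi> \<xi> = (\<integral>x. cis (- (x \<bullet> \<xi>)) * \<phi> x \<partial>lborel)"

lemma fourier_raw_lincomb:
  assumes "integrable lborel \<phi>" "integrable lborel \<psi>"
  shows "fourier_raw (\<lambda>x. a * \<phi> x + b * \<psi> x) \<xi> = a * fourier_raw \<phi> \<xi> + b * fourier_raw \<psi> \<xi>"
proof -
  have "(\<lambda>x. cis (- (x \<bullet> \<xi>)) * (a * \<phi> x + b * \<psi> x)) = (\<lambda>x. a * (cis (- (x \<bullet> \<xi>)) * \<phi> x) + b * (cis (- (x \<bullet> \<xi>)) * \<psi> x))"
    by (auto simp: algebra_simps)
  then show ?thesis unfolding fourier_raw_def
    by (simp only:) (subst Bochner_Integration.integral_add, auto intro!: integrable_mult_right integrable_cis_mult assms)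
qed

text \<open>Difference quotients take the place of integration by parts: translating
  \<open>\<phi>\<close> by \<open>e n\<close> along the axis multiplies its transform by
  \<open>cis (e n * \<xi> $ i)\<close>, so the quotient acts as
  \<open>(cis (e n * \<xi> $ i) - 1) / e n\<close>, and \<open>e n \<rightarrow> 0\<close> is taken
  on both sides.\<close>

lemma fourier_raw_partial:
  fixes \<phi> :: "real^'n::finite \<Rightarrow> complex"
  assumes "test_function Euclidean \<phi>"
  shows "fourier_raw (iter_partial [i] \<phi>) \<xi> = \<i> * of_real (\<xi> $ i) * fourier_raw \<phi> \<xi>"
proof -
  define a :: "real^'n" where "a = axis i 1"
  define p where "p = iter_partial [i] \<phi>"
  have p: "test_function Euclidean p" unfolding p_def by (rule test_function_iter_partial[OF assms])
  obtain C where C: "\<And>x. cmod (p x) \<le> C * inverse ((1 + norm x) ^ (2 * CARD('n)))" "0 \<le> C"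
    using test_function_decay[OF p] by blast
  define e :: "nat \<Rightarrow> real" where "e n = inverse (Suc n)" for n
  have e0: "0 < e n" "e n \<le> 1" for n by (auto simp: e_def field_simps)
  have e: "e \<longlonglongrightarrow> 0" unfolding e_def by (rule LIMSEQ_inverse_real_of_nat)
  define D where "D n x = (\<phi> (e n *\<^sub>R a + x) - \<phi> x) / of_real (e n)" for n x
  have [measurable]: "\<phi> \<in> borel_measurable borel" "p \<in> borel_measurable borel"
    using test_functionD assms p by auto
  have der: "((\<lambda>t. \<phi> (t *\<^sub>R a + x)) has_derivative (\<lambda>h. h *\<^sub>R p (t *\<^sub>R a + x))) (at t within S)" for t x S
  proof -
    let ?F = "frechet_derivative \<phi> (at (t *\<^sub>R a + x))"
    have F: "(\<phi> has_derivative ?F) (at (t *\<^sub>R a + x))"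
      using smoothD[OF test_functionD(1)[OF assms], of "[]"] by (simp add: frechet_derivative_works)
    have "((\<lambda>t. t *\<^sub>R a + x) has_derivative (\<lambda>h. h *\<^sub>R a)) (at t within S)"
      by (auto intro!: derivative_eq_intros)
    from has_derivative_compose[OF this F] have "((\<lambda>t. \<phi> (t *\<^sub>R a + x)) has_derivative (\<lambda>h. ?F (h *\<^sub>R a))) (at t within S)" .
    moreover have "?F (h *\<^sub>R a) = h *\<^sub>R p (t *\<^sub>R a + x)" for h
      using linear_cmul[OF has_derivative_linear[OF F]] by (simp add: p_def a_def)
    ultimately show ?thesis by simp
  qed
  have na: "norm a = 1" by (simp add: a_def)
  \<comment> \<open>A domination uniform in \<open>n\<close>: the mean value inequality bounds the
    quotient by values of \<open>p\<close> on a segment of length at most \<open>1\<close>, and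
    moving the base point along it costs at most a factor \<open>2\<close> in
    \<open>1 + norm x\<close>.\<close>
  have bound: "cmod (D n x) \<le> 2 ^ (2 * CARD('n)) * C * inverse ((1 + norm x) ^ (2 * CARD('n)))" (is "_ \<le> ?B") for n x
  proof -
    have pb: "cmod (p (t *\<^sub>R a + x)) \<le> ?B" if "t \<in> {0..e n}" for t
    proof -
      have "norm x \<le> norm (t *\<^sub>R a + x) + norm (t *\<^sub>R a)" by (metis add_diff_cancel_left' norm_triangle_ineq4 add.commute)
      moreover have "norm (t *\<^sub>R a) \<le> 1" using that e0(2)[of n] by (simp add: na)
      moreover have "X \<le> N + A \<Longrightarrow> A \<le> 1 \<Longrightarrow> 0 \<le> N \<Longrightarrow> 1 + X \<le> 2 * (1 + N)" for X N A :: real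
        by simp
      ultimately have "1 + norm x \<le> 2 * (1 + norm (t *\<^sub>R a + x))"
        using norm_ge_zero by blast
      then have "(1 + norm x) ^ (2 * CARD('n)) \<le> (2 * (1 + norm (t *\<^sub>R a + x))) ^ (2 * CARD('n))"
        by (intro power_mono) auto
      then have *: "(1 + norm x) ^ (2 * CARD('n)) \<le> 2 ^ (2 * CARD('n)) * (1 + norm (t *\<^sub>R a + x)) ^ (2 * CARD('n))"
        unfolding power_mult_distrib .
      have pos: "0 < (1 + norm y) ^ (2 * CARD('n))" for y :: "real^'n"
        by (intro zero_less_power add_pos_nonneg) auto
      have "inverse ((1 + norm (t *\<^sub>R a + x)) ^ (2 * CARD('n))) \<le> 2 ^ (2 * CARD('n)) * inverse ((1 + norm x) ^ (2 * CARD('n)))"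
      proof -
        have "A \<le> K * B \<Longrightarrow> 0 < A \<Longrightarrow> 0 < B \<Longrightarrow> inverse B \<le> K * inverse A" for A B K :: real
          by (simp add: field_simps)
        from this[OF * pos pos] show ?thesis .
      qed
      from mult_left_mono[OF this C(2)] C(1)[of "t *\<^sub>R a + x"] show ?thesis by (simp add: mult_ac)
    qed
    have "cmod (\<phi> (e n *\<^sub>R a + x) - \<phi> (0 *\<^sub>R a + x)) \<le> ?B * norm (e n - 0)"
    proof (rule differentiable_bound[where S="{0..e n}" and f'="\<lambda>t h. h *\<^sub>R p (t *\<^sub>R a + x)"])
      fix t assume t: "t \<in> {0..e n}"
      show "onorm (\<lambda>h::real. h *\<^sub>R p (t *\<^sub>R a + x)) \<le> ?B"
        by (rule onorm_le) (unfold norm_scaleR real_norm_def, subst mult.commute, rule mult_right_mono[OF pb[OF t]], simp)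
    qed (use e0[of n] der in auto)
    then show ?thesis using e0[of n] by (simp add: D_def norm_divide field_simps)
  qed
  have lim: "(\<lambda>n. D n x) \<longlonglongrightarrow> p x" for x
  proof -
    have "((\<lambda>h. norm (\<phi> ((0 + h) *\<^sub>R a + x) - \<phi> (0 *\<^sub>R a + x) - h *\<^sub>R p (0 *\<^sub>R a + x)) / norm h) \<longlongrightarrow> 0) (at 0)"
      using der[where t=0 and x=x and S=UNIV] unfolding has_derivative_at by blast
    then have "(\<lambda>n. norm (\<phi> ((0 + e n) *\<^sub>R a + x) - \<phi> (0 *\<^sub>R a + x) - e n *\<^sub>R p (0 *\<^sub>R a + x)) / norm (e n)) \<longlonglongrightarrow> 0"
    proof (rule filterlim_compose)
      have "e n \<noteq> 0" for n using e0[of n] by simp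
      then show "filterlim e (at 0) sequentially"
        using e by (simp add: filterlim_at)
    qed
    moreover have "norm (\<phi> ((0 + e n) *\<^sub>R a + x) - \<phi> (0 *\<^sub>R a + x) - e n *\<^sub>R p (0 *\<^sub>R a + x)) / norm (e n) = norm (D n x - p x)" for n
    proof -
      have "D n x - p x = (\<phi> (e n *\<^sub>R a + x) - \<phi> x - e n *\<^sub>R p x) / of_real (e n)"
        using e0[of n] by (simp add: D_def field_simps scaleR_conv_of_real)
      then show ?thesis using e0[of n] by (simp add: norm_divide)
    qed
    ultimately have "(\<lambda>n. norm (D n x - p x)) \<longlonglongrightarrow> 0" by simp
    then show ?thesis by (simp only: tendsto_norm_zero_iff LIM_zero_iff)
  qed
  have phi: "integrable lborel \<phi>" by (rule test_function_integrable[OF assms])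
  have int: "(\<integral>x. cis (- (x \<bullet> \<xi>)) * D n x \<partial>lborel) = (cis (e n * \<xi> $ i) - 1) / of_real (e n) * fourier_raw \<phi> \<xi>" for n
  proof -
    define g where "g x = cis (- ((x - e n *\<^sub>R a) \<bullet> \<xi>)) * \<phi> x" for x
    have g: "g x = cis (e n * \<xi> $ i) * (cis (- (x \<bullet> \<xi>)) * \<phi> x)" for x
    proof -
      have "a \<bullet> \<xi> = \<xi> $ i" by (subst inner_commute) (simp add: a_def inner_axis)
      then show ?thesis by (simp add: g_def inner_diff_left cis_mult mult.assoc[symmetric])
    qed
    have "integrable lborel (\<lambda>x. cis (e n * \<xi> $ i) * (cis (- (x \<bullet> \<xi>)) * \<phi> x))" by (intro integrable_mult_right integrable_cis_mult phi)
    then have gi: "integrable lborel g" by (simp add: g[abs_def])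
    have 1: "(\<integral>x. cis (- (x \<bullet> \<xi>)) * \<phi> (e n *\<^sub>R a + x) \<partial>lborel) = cis (e n * \<xi> $ i) * fourier_raw \<phi> \<xi>"
    proof -
      have "(\<integral>x. g x \<partial>lborel) = cis (e n * \<xi> $ i) * fourier_raw \<phi> \<xi>"
        by (simp add: g fourier_raw_def)
      moreover have "(\<integral>x. g x \<partial>lborel) = (\<integral>x. g (e n *\<^sub>R a + x) \<partial>lborel)"
        using integral_lborel_affine(2)[OF _ gi, of 1 "e n *\<^sub>R a"] by simp
      moreover have "g (e n *\<^sub>R a + x) = cis (- (x \<bullet> \<xi>)) * \<phi> (e n *\<^sub>R a + x)" for x
        by (simp add: g_def)
      ultimately show ?thesis by simp
    qed
    have i1: "integrable lborel (\<lambda>x. cis (- (x \<bullet> \<xi>)) * \<phi> (e n *\<^sub>R a + x))"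
      using integral_lborel_affine(1)[OF _ gi, of 1 "e n *\<^sub>R a"] by (simp add: g_def)
    have "(\<integral>x. cis (- (x \<bullet> \<xi>)) * D n x \<partial>lborel) = (\<integral>x. (cis (- (x \<bullet> \<xi>)) * \<phi> (e n *\<^sub>R a + x) - cis (- (x \<bullet> \<xi>)) * \<phi> x) / of_real (e n) \<partial>lborel)"
      by (simp add: D_def right_diff_distrib)
    also have "\<dots> = (cis (e n * \<xi> $ i) * fourier_raw \<phi> \<xi> - fourier_raw \<phi> \<xi>) / of_real (e n)"
      by (subst Bochner_Integration.integral_divide_zero, subst Bochner_Integration.integral_diff)
         (auto simp: 1 i1 fourier_raw_def intro: integrable_cis_mult phi)
    finally show ?thesis by (simp add: field_simps)
  qed
  have L1: "(\<lambda>n. \<integral>x. cis (- (x \<bullet> \<xi>)) * D n x \<partial>lborel) \<longlonglongrightarrow> fourier_raw p \<xi>"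
    unfolding fourier_raw_def
  proof (rule integral_dominated_convergence[where w="\<lambda>x::real^'n. 2 ^ (2 * CARD('n)) * C * cauchy_weight x"])
    show "integrable lborel (\<lambda>x::real^'n. 2 ^ (2 * CARD('n)) * C * cauchy_weight x)"
      by (intro integrable_mult_right integrable_cauchy_weight)
    show "AE x in lborel. (\<lambda>n. cis (- (x \<bullet> \<xi>)) * D n x) \<longlonglongrightarrow> cis (- (x \<bullet> \<xi>)) * p x"
      by (intro AE_I2 tendsto_mult_left lim)
    show "AE x in lborel. norm (cis (- (x \<bullet> \<xi>)) * D n x) \<le> 2 ^ (2 * CARD('n)) * C * cauchy_weight x" for n
      using order_trans[OF bound mult_left_mono[OF inverse_power_le_cauchy_weight]] C(2) by (auto simp: norm_mult)
    show "(\<lambda>x. cis (- (x \<bullet> \<xi>)) * D n x) \<in> borel_measurable lborel" for n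
      unfolding D_def by measurable
  qed measurable
  have L2: "(\<lambda>n. (cis (e n * \<xi> $ i) - 1) / of_real (e n) * fourier_raw \<phi> \<xi>) \<longlonglongrightarrow> \<i> * of_real (\<xi> $ i) * fourier_raw \<phi> \<xi>"
  proof (rule tendsto_mult_right)
    have "((\<lambda>z. exp (\<i> * of_real (\<xi> $ i) * z)) has_field_derivative \<i> * of_real (\<xi> $ i)) (at 0)"
      by (auto intro!: derivative_eq_intros)
    then have "((\<lambda>h. (exp (\<i> * of_real (\<xi> $ i) * (0 + h)) - exp (\<i> * of_real (\<xi> $ i) * 0)) / h) \<longlongrightarrow> \<i> * of_real (\<xi> $ i)) (at 0)"
      by (simp add: DERIV_def)
    moreover have "filterlim (\<lambda>n. complex_of_real (e n)) (at 0) sequentially"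
    proof -
      have "e n \<noteq> 0" for n using e0[of n] by simp
      then show ?thesis using tendsto_of_real[OF e, where 'a=complex] by (simp add: filterlim_at)
    qed
    ultimately have "(\<lambda>n. (exp (\<i> * of_real (\<xi> $ i) * (0 + of_real (e n))) - exp (\<i> * of_real (\<xi> $ i) * 0)) / of_real (e n)) \<longlonglongrightarrow> \<i> * of_real (\<xi> $ i)"
      by (rule filterlim_compose)
    then show "(\<lambda>n. (cis (e n * \<xi> $ i) - 1) / complex_of_real (e n)) \<longlonglongrightarrow> \<i> * of_real (\<xi> $ i)"
      by (simp add: cis_conv_exp mult_ac)
  qed
  show ?thesis using LIMSEQ_unique[OF L1[unfolded int] L2] by (simp only: p_def)
qed

lemma fourier_raw_bound:
  assumes "integrable lborel \<phi>"
  shows "cmod (fourier_raw \<phi> \<xi>) \<le> (\<integral>x. cmod (\<phi> x) \<partial>lborel)"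
  unfolding fourier_raw_def
  by (rule order_trans[OF integral_norm_bound]) (simp add: norm_mult)

text \<open>Applying \<open>1 - \<partial>_i^2\<close> once in every coordinate keeps
  \<open>\<phi>\<close> a test function and multiplies its transform by the product of all
  \<open>1 + (\<xi> $ i)^2\<close>. The result is the transform of an integrable function, hence
  bounded, so the original transform decays like \<open>cauchy_weight\<close>.\<close>

lemma fourier_raw_integrable:
  fixes \<phi> :: "real^'n::finite \<Rightarrow> complex"
  assumes "test_function Euclidean \<phi>"
  shows "integrable lborel (fourier_raw \<phi>)"
proof -
  have "\<exists>\<psi>. test_function Euclidean \<psi> \<and> (\<forall>\<xi>. fourier_raw \<psi> \<xi> = (\<Prod>i\<in>A. of_real (1 + (\<xi> $ i)\<^sup>2)) * fourier_raw \<phi> \<xi>)"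
    if "finite A" for A :: "'n set"
    using that
  proof induction
    case empty
    show ?case using assms by auto
  next
    case (insert i A)
    then obtain \<psi> where psi: "test_function Euclidean \<psi>"
      "\<And>\<xi>. fourier_raw \<psi> \<xi> = (\<Prod>i\<in>A. of_real (1 + (\<xi> $ i)\<^sup>2)) * fourier_raw \<phi> \<xi>" by blast
    let ?p = "iter_partial [i] (iter_partial [i] \<psi>)"
    have p: "test_function Euclidean (iter_partial [i] \<psi>)" "test_function Euclidean ?p"
      by (intro test_function_iter_partial psi)+
    have "fourier_raw (\<lambda>x. 1 * \<psi> x + (-1) * ?p x) \<xi> = of_real (1 + (\<xi> $ i)\<^sup>2) * fourier_raw \<psi> \<xi>" for \<xi>
      by (subst fourier_raw_lincomb)
         (simp_all only: fourier_raw_partial[OF p(1)] fourier_raw_partial[OF psi(1)] test_function_integrable psi p,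
          simp add: algebra_simps power2_eq_square)
    then show ?case using insert
      by (intro exI[of _ "\<lambda>x. 1 * \<psi> x + (-1) * ?p x"] conjI test_function_lincomb psi p allI)
         (simp only: prod.insert psi(2) mult_ac, simp)
  qed
  from this[OF finite_class.finite_UNIV] obtain \<psi> where psi: "test_function Euclidean \<psi>"
    "\<And>\<xi>. fourier_raw \<psi> \<xi> = (\<Prod>i\<in>UNIV. of_real (1 + (\<xi> $ i)\<^sup>2)) * fourier_raw \<phi> \<xi>" by blast
  have nz: "(\<Prod>i\<in>UNIV. complex_of_real (1 + (\<xi> $ i)\<^sup>2)) \<noteq> 0" for \<xi> :: "real^'n"
  proof -
    have "0 < 1 + (\<xi> $ i)\<^sup>2" for i by (intro add_pos_nonneg) auto
    then show ?thesis by (simp del: of_real_add) (metis less_irrefl)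
  qed
  have "complex_of_real (cauchy_weight \<xi>) * (\<Prod>i\<in>UNIV. complex_of_real (1 + (\<xi> $ i)\<^sup>2)) = 1" for \<xi> :: "real^'n"
  proof -
    have "complex_of_real (cauchy_weight \<xi>) = inverse (\<Prod>i\<in>UNIV. complex_of_real (1 + (\<xi> $ i)\<^sup>2))"
      using prod_inversef[of "\<lambda>i. complex_of_real (1 + (\<xi> $ i)\<^sup>2)" UNIV]
      by (simp add: cauchy_weight_def comp_def)
    then show ?thesis using nz[of \<xi>] by simp
  qed
  then have eq: "fourier_raw \<phi> \<xi> = of_real (cauchy_weight \<xi>) * fourier_raw \<psi> \<xi>" for \<xi>
    unfolding psi(2) mult.assoc[symmetric] by simp
  have m: "fourier_raw \<phi> \<in> borel_measurable lborel"
  proof -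
    note [measurable] = test_functionD(3)[OF assms]
    show ?thesis unfolding fourier_raw_def[abs_def]
      by (intro lborel.borel_measurable_lebesgue_integral) measurable
  qed
  let ?K = "\<integral>x. cmod (\<psi> x) \<partial>lborel"
  have "integrable lborel (\<lambda>\<xi>::real^'n. ?K * cauchy_weight \<xi>)"
    by (intro integrable_mult_right integrable_cauchy_weight)
  then show ?thesis
  proof (rule Bochner_Integration.integrable_bound[OF _ m])
    show "AE \<xi> in lborel. norm (fourier_raw \<phi> \<xi>) \<le> norm (?K * cauchy_weight \<xi>)"
      using fourier_raw_bound[OF test_function_integrable[OF psi(1)]] cauchy_weight_pos
      by (auto simp: eq norm_mult abs_mult mult.commute intro!: AE_I2 mult_left_mono cauchy_weight_pos[THEN less_imp_le])
  qed
qed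

lemma fourier_raw_inversion:
  fixes \<phi> :: "real^'n::finite \<Rightarrow> complex"
  assumes "test_function Euclidean \<phi>"
  shows "(\<integral>x. cis (x \<bullet> \<xi>) * fourier_raw \<phi> x \<partial>lborel) = of_real ((2 * pi) ^ CARD('n)) * \<phi> \<xi>"
proof -
  obtain C where C: "\<And>x. cmod (\<phi> x) \<le> C * inverse ((1 + norm x) ^ 0)"
    using test_function_decay[OF assms] by blast
  show ?thesis
    unfolding fourier_raw_def[abs_def]
    by (rule fourier_inversion_integrable[where B=C])
       (use C fourier_raw_integrable[OF assms] in \<open>auto simp: fourier_raw_def[abs_def] intro: test_function_integrable test_functionD assms\<close>)
qed

lemma fourier_const_sq: "fourier_const TYPE('n::finite) * fourier_const TYPE('n) * (2 * pi) ^ CARD('n) = 1"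
proof -
  have "fourier_const TYPE('n) * fourier_const TYPE('n) = (2 * pi) powr (- real CARD('n))"
    by (simp add: fourier_const_def powr_add[symmetric])
  moreover have "(2 * pi) ^ CARD('n) = (2 * pi) powr real CARD('n)"
    by (rule powr_realpow[symmetric]) simp
  ultimately show ?thesis by (simp only: powr_add[symmetric]) simp
qed

lemma fourier_const_pos: "0 < fourier_const TYPE('n::finite)"
  by (simp add: fourier_const_def)

lemma fourier_integral_raw: "fourier_integral \<phi> = (\<lambda>\<xi>. of_real (fourier_const TYPE('n::finite)) * fourier_raw \<phi> \<xi>)"
  for \<phi> :: "real^'n \<Rightarrow> complex"
  by (auto simp: fourier_integral_def fourier_raw_def)

section \<open>The dual group and the physical space\<close>

lemma int_lattice_simps [simp]:
  "0 \<in> int_lattice" "x \<in> int_lattice \<Longrightarrow> y \<in> int_lattice \<Longrightarrow> x + y \<in> int_lattice"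
  "x \<in> int_lattice \<Longrightarrow> y \<in> int_lattice \<Longrightarrow> x - y \<in> int_lattice"
  "x \<in> int_lattice \<Longrightarrow> - x \<in> int_lattice"
  "axis i (of_int m) \<in> int_lattice"
  by (auto simp: int_lattice_def axis_def)

lemma finite_int_lattice_cball: "finite (int_lattice \<inter> cball (0::real^'n::finite) r)"
proof -
  let ?S = "real_of_int ` {- \<lceil>r\<rceil>..\<lceil>r\<rceil>}"
  have "int_lattice \<inter> cball (0::real^'n) r \<subseteq> vec_lambda ` (PiE UNIV (\<lambda>_. ?S))"
  proof
    fix x :: "real^'n" assume x: "x \<in> int_lattice \<inter> cball 0 r"
    have "x $ i \<in> ?S" for i
    proof -
      obtain m where m: "x $ i = of_int m" using x by (auto simp: int_lattice_def Ints_def)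
      have "\<bar>x $ i\<bar> \<le> r" using component_le_norm_cart[of x i] x by auto
      then have "\<bar>real_of_int m\<bar> \<le> r" using m by simp
      then have "m \<le> \<lceil>r\<rceil> \<and> - m \<le> \<lceil>r\<rceil>"
        by linarith
      then show ?thesis using m by auto
    qed
    then have "(\<lambda>i. x $ i) \<in> PiE UNIV (\<lambda>_. ?S)" by auto
    then show "x \<in> vec_lambda ` (PiE UNIV (\<lambda>_. ?S))"
      by (metis image_eqI vec_nth_inverse)
  qed
  then show ?thesis by (rule finite_subset) (intro finite_imageI finite_PiE, auto)
qed

lemma countable_int_lattice: "countable (int_lattice :: (real^'n::finite) set)"
proof -
  have "int_lattice = (\<Union>n::nat. int_lattice \<inter> cball (0::real^'n) n)"
    by (auto simp: real_arch_simple)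
  then show ?thesis
    by (metis countable_UN countable_finite finite_int_lattice_cball countableI_type)
qed

lemma dual_measure_simps [simp]:
  "dual_measure Euclidean = lborel" "dual_measure Torus = count_space int_lattice"
  by (simp_all add: dual_measure_def)

lemma sigma_finite_dual: "sigma_finite_measure (dual_measure M :: (real^'n::finite) measure)"
  by (cases M) (simp_all add: sigma_finite_lborel sigma_finite_measure_count_space_countable countable_int_lattice)

lemma ident_dual_borel: "(\<lambda>x. x) \<in> dual_measure M \<rightarrow>\<^sub>M borel"
  by (cases M) simp_all

lemma borel_measurable_dual: "f \<in> borel \<rightarrow>\<^sub>M N \<Longrightarrow> f \<in> dual_measure M \<rightarrow>\<^sub>M N"
  using measurable_compose[OF ident_dual_borel] by blast

text \<open>In the periodic case both sides are discrete: countability of the lattice identifies the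
  product with a counting measure.\<close>

lemma diff_dual_measurable: "(\<lambda>p. fst p - snd p) \<in> dual_measure M \<Otimes>\<^sub>M dual_measure M \<rightarrow>\<^sub>M (dual_measure M :: (real^'n::finite) measure)"
proof (cases M)
  case Torus
  then show ?thesis by (auto simp: pair_measure_countable countable_int_lattice)
next
  case Euclidean
  then show ?thesis by (auto simp: borel_prod[symmetric])
qed

lemma space_dual_diff: "x \<in> space (dual_measure M) \<Longrightarrow> y \<in> space (dual_measure M) \<Longrightarrow> x - y \<in> space (dual_measure M)"
  and space_dual_add: "x \<in> space (dual_measure M) \<Longrightarrow> y \<in> space (dual_measure M) \<Longrightarrow> x + y \<in> space (dual_measure M)"
  and space_dual_uminus: "x \<in> space (dual_measure M) \<Longrightarrow> - x \<in> space (dual_measure M)"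
  and space_dual_axis: "axis i (real_of_int m) \<in> space (dual_measure M)"
  by (cases M; simp)+

text \<open>Invariance of Haar measure on the dual group, stated once for Lebesgue and counting
  measure so that the convolution calculus needs no case split. The sign \<open>e = 1\<close> gives
  translations, \<open>e = -1\<close> the reflection \<open>y \<mapsto> a - y\<close> inside a
  convolution.\<close>

lemma dual_affine:
  fixes f :: "real^'n::finite \<Rightarrow> 'b::{banach, second_countable_topology}"
  assumes a: "a \<in> space (dual_measure M)" and e: "e = 1 \<or> e = -1" and f: "integrable (dual_measure M) f"
  shows "integrable (dual_measure M) (\<lambda>x. f (a + e *\<^sub>R x))"
    and "(\<integral>x. f (a + e *\<^sub>R x) \<partial>dual_measure M) = (\<integral>x. f x \<partial>dual_measure M)"
proof -
  have "integrable (dual_measure M) (\<lambda>x. f (a + e *\<^sub>R x)) \<and> (\<integral>x. f (a + e *\<^sub>R x) \<partial>dual_measure M) = (\<integral>x. f x \<partial>dual_measure M)"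
  proof (cases M)
    case Euclidean
    then show ?thesis using integral_lborel_affine_scaleR[of e f a] f e by auto
  next
    case Torus
    have "bij_betw (\<lambda>x. a + e *\<^sub>R x) int_lattice (int_lattice :: (real^'n) set)"
      by (rule bij_betwI[where g="\<lambda>x. e *\<^sub>R (x - a)"]) (use a e Torus in auto)
    from integrable_bij_count_space[OF this, of f] integral_bij_count_space[OF this, of f] show ?thesis
      using f Torus by simp
  qed
  then show "integrable (dual_measure M) (\<lambda>x. f (a + e *\<^sub>R x))"
    "(\<integral>x. f (a + e *\<^sub>R x) \<partial>dual_measure M) = (\<integral>x. f x \<partial>dual_measure M)" by auto
qed

lemma integrable_indicator_cball: "integrable (dual_measure M :: (real^'n::finite) measure) (indicator (cball 0 r) :: _ \<Rightarrow> real)"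
proof (cases M)
  case Euclidean
  then show ?thesis using emeasure_lborel_cball_finite[of "0::real^'n" r] by (simp add: integrable_indicator_iff less_top[symmetric])
next
  case Torus
  have "finite (int_lattice \<inter> cball (0::real^'n) r)" by (rule finite_int_lattice_cball)
  then have "emeasure (count_space int_lattice) (cball (0::real^'n) r \<inter> int_lattice) < \<infinity>"
    by (subst emeasure_count_space_finite) (auto simp: Int_commute ennreal_of_nat_eq_real_of_nat)
  then show ?thesis using Torus by (simp add: integrable_indicator_iff)
qed

text \<open>On the torus the single lattice point \<open>0\<close> already has mass one.\<close>

lemma integral_indicator_cball_pos:
  assumes "0 < r"
  shows "0 < (\<integral>x. indicator (cball 0 r) x \<partial>(dual_measure M :: (real^'n::finite) measure) :: real)"
proof (cases M)
  case Euclidean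
  then show ?thesis using assms content_cball_pos[of r "0::real^'n"] by simp
next
  case Torus
  have i: "integrable (count_space int_lattice :: (real^'n) measure) (indicator (cball 0 \<rho>) :: _ \<Rightarrow> real)" for \<rho>
    using integrable_indicator_cball[of Torus \<rho>] by simp
  have "(\<integral>x. indicator (cball 0 0) x \<partial>(count_space int_lattice :: (real^'n) measure)) \<le> (\<integral>x. indicator (cball 0 r) x \<partial>(count_space int_lattice :: (real^'n) measure) :: real)"
    by (rule integral_mono[OF i i]) (use assms in \<open>auto simp: indicator_def\<close>)
  then show ?thesis using Torus by (simp add: measure_count_space)
qed

section \<open>Inverse Fourier integrals as functions on the physical space\<close>

lemma integrable_dual_cis_mult:
  fixes g :: "real^'n::finite \<Rightarrow> complex"
  assumes "integrable (dual_measure M) g"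
  shows "integrable (dual_measure M) (\<lambda>\<xi>. cis (x \<bullet> \<xi>) * g \<xi>)"
proof -
  have [measurable]: "(\<lambda>\<xi>. cis (x \<bullet> \<xi>)) \<in> borel_measurable (dual_measure M)"
    by (rule borel_measurable_dual) measurable
  show ?thesis
    by (rule Bochner_Integration.integrable_bound[OF assms]) (use assms in \<open>auto simp: norm_mult\<close>)
qed

lemma inv_fourier_bound:
  fixes g :: "real^'n::finite \<Rightarrow> complex"
  shows "cmod (inv_fourier M g x) \<le> fourier_const TYPE('n) * (\<integral>\<xi>. cmod (g \<xi>) \<partial>dual_measure M)"
  unfolding inv_fourier_def norm_mult
  using order_trans[OF integral_norm_bound, of "dual_measure M" "\<lambda>\<xi>. cis (x \<bullet> \<xi>) * g \<xi>"] fourier_const_pos[where 'n='n]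
  by (auto simp: norm_mult intro!: mult_left_mono)

lemma inv_fourier_continuous:
  fixes g :: "real^'n::finite \<Rightarrow> complex"
  assumes g: "integrable (dual_measure M) g"
  shows "continuous_on UNIV (inv_fourier M g)"
proof -
  have "(\<lambda>n. inv_fourier M g (X n)) \<longlonglongrightarrow> inv_fourier M g x" if X: "X \<longlonglongrightarrow> x" for X :: "nat \<Rightarrow> real^'n" and x
    unfolding inv_fourier_def
  proof (intro tendsto_mult_left integral_dominated_convergence[where w="\<lambda>\<xi>. cmod (g \<xi>)"])
    show "AE \<xi> in dual_measure M. (\<lambda>n. cis (X n \<bullet> \<xi>) * g \<xi>) \<longlonglongrightarrow> cis (x \<bullet> \<xi>) * g \<xi>"
      by (intro AE_I2 tendsto_mult_right continuous_on_tendsto_compose[OF continuous_on_cis[OF continuous_on_id, of UNIV]] tendsto_inner X) auto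
    show "(\<lambda>\<xi>. cis (X n \<bullet> \<xi>) * g \<xi>) \<in> borel_measurable (dual_measure M)" 
     "(\<lambda>\<xi>. cis (x \<bullet> \<xi>) * g \<xi>) \<in> borel_measurable (dual_measure M)" for n
      using borel_measurable_integrable[OF integrable_dual_cis_mult[OF g]] by auto
    show "AE \<xi> in dual_measure M. norm (cis (X n \<bullet> \<xi>) * g \<xi>) \<le> cmod (g \<xi>)" for n
      by (simp add: norm_mult)
  qed (use g in auto)
  then show ?thesis by (auto simp: continuous_on_sequentially comp_def)
qed

lemma inv_fourier_periodic:
  fixes g :: "real^'n::finite \<Rightarrow> complex"
  shows "function_on M (inv_fourier M g)"
proof (cases M)
  case Torus
  have "cis ((x + (2 * pi) *\<^sub>R axis i 1) \<bullet> \<xi>) = cis (x \<bullet> \<xi>)" if "\<xi> \<in> int_lattice" for x \<xi> :: "real^'n" and i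
  proof -
    have "(axis i 1 :: real^'n) \<bullet> \<xi> = \<xi> $ i" by (subst inner_commute) (simp add: inner_axis)
    moreover have "cis (2 * pi * \<xi> $ i) = 1" using that by (intro cis_multiple_2pi) (simp add: int_lattice_def)
    ultimately show ?thesis by (simp add: inner_add_left cis_mult[symmetric])
  qed
  then show ?thesis using Torus
    by (auto simp: function_on_def inv_fourier_def intro!: Bochner_Integration.integral_cong)
qed (simp add: function_on_def)

text \<open>\<open>test_function\<close> bounds each derivative separately; the supremum in the
  seminorm is finite because there are only finitely many index lists of length at most
  \<open>N\<close>.\<close>

lemma test_seminorm_ge:
  assumes "test_function M \<phi>" "length is \<le> N"
  shows "decay_weight M x ^ N * cmod (iter_partial is \<phi> x) \<le> test_seminorm M N \<phi>"
proof -
  have fin: "finite {is::'a list. length is \<le> N}"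
    using finite_lists_length_le[of "UNIV::'a set" N] by simp
  have "\<exists>C. \<forall>x. decay_weight M x ^ N * cmod (iter_partial is \<phi> x) \<le> C" for "is"
    using assms(1) unfolding test_function_def bdd_above_def by auto
  then obtain C where C: "\<And>is x. decay_weight M x ^ N * cmod (iter_partial is \<phi> x) \<le> C is" by metis
  have "bdd_above ((\<lambda>(is, x). decay_weight M x ^ N * cmod (iter_partial is \<phi> x)) ` ({is. length is \<le> N} \<times> UNIV))"
  proof (rule bdd_aboveI2)
    fix p :: "'a list \<times> (real^'a)" assume "p \<in> {is. length is \<le> N} \<times> UNIV"
    then obtain js x where p: "p = (js, x)" "length js \<le> N" by auto
    show "(case p of (is, x) \<Rightarrow> decay_weight M x ^ N * cmod (iter_partial is \<phi> x)) \<le> Max (C ` {is. length is \<le> N})"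
    proof -
      have "C js \<le> Max (C ` {is. length is \<le> N})" using fin p by (intro Max_ge) auto
      then show ?thesis using C[of x js] by (simp add: p(1))
    qed
  qed
  from cSUP_upper[OF _ this, of "(is, x)"] assms(2) show ?thesis by (simp add: test_seminorm_def)
qed

lemma test_seminorm_nonneg: "test_function M \<phi> \<Longrightarrow> 0 \<le> test_seminorm M N \<phi>"
  using test_seminorm_ge[of M \<phi> "[]" N 0] by (auto simp: decay_weight_def split: manifold.splits intro: order_trans[rotated])

lemma test_seminorm_mono:
  assumes "test_function M (\<phi> :: real^'n::finite \<Rightarrow> complex)" "N \<le> K"
  shows "test_seminorm M N \<phi> \<le> test_seminorm M K \<phi>"
  unfolding test_seminorm_def[of M N]
proof (rule cSUP_least)
  fix p :: "'n list \<times> (real^'n)" assume "p \<in> {is. length is \<le> N} \<times> UNIV"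
  then obtain js x where p: "p = (js, x)" "length js \<le> N" by auto
  have "decay_weight M x ^ N \<le> decay_weight M x ^ K"
    by (rule power_increasing[OF assms(2)]) (auto simp: decay_weight_def split: manifold.splits)
  then have "decay_weight M x ^ N * cmod (iter_partial js \<phi> x) \<le> decay_weight M x ^ K * cmod (iter_partial js \<phi> x)"
    by (rule mult_right_mono) simp
  also have "\<dots> \<le> test_seminorm M K \<phi>" using p assms by (intro test_seminorm_ge) auto
  finally show "(case p of (is, x) \<Rightarrow> decay_weight M x ^ N * cmod (iter_partial is \<phi> x)) \<le> test_seminorm M K \<phi>"
    by (simp add: p)
qed (auto intro: exI[of _ "[]"])

lemma phys_measure_simps [simp]:
  "phys_measure Euclidean = lborel" "phys_measure Torus = restrict_space lborel (cbox 0 (\<chi> i. 2 * pi))"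
  by (simp_all add: phys_measure_def)

lemma borel_measurable_phys: "f \<in> borel \<rightarrow>\<^sub>M N \<Longrightarrow> f \<in> phys_measure M \<rightarrow>\<^sub>M N"
  by (cases M) (auto intro: measurable_restrict_space1)

lemma finite_measure_torus: "finite_measure (phys_measure Torus :: (real^'n::finite) measure)"
  by (rule finite_measureI) (simp add: space_restrict_space emeasure_restrict_space emeasure_lborel_cbox_eq)

lemma sigma_finite_phys: "sigma_finite_measure (phys_measure M :: (real^'n::finite) measure)"
proof (cases M)
  case Torus
  interpret finite_measure "phys_measure Torus :: (real^'n::finite) measure" by (rule finite_measure_torus)
  show ?thesis using Torus sigma_finite_measure_axioms by simp
qed (simp add: sigma_finite_lborel)

text \<open>One seminorm controls the \<open>L^1\<close> norm, which makes bounded measurable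
  functions distributions. On \<open>\<real>^d\<close> the order \<open>2d\<close> reaches the
  comparison weight; on the torus order \<open>0\<close> is enough since the period cell has finite
  measure.\<close>

lemma test_function_phys_integrable:
  "\<exists>K N. 0 \<le> K \<and> (\<forall>\<phi>::real^'n::finite \<Rightarrow> complex. test_function M \<phi> \<longrightarrow>
     integrable (phys_measure M) \<phi> \<and> (\<integral>x. cmod (\<phi> x) \<partial>phys_measure M) \<le> K * test_seminorm M N \<phi>)"
proof (cases M)
  case Euclidean
  show ?thesis
  proof (intro exI[of _ "\<integral>(x::real^'n). cauchy_weight x \<partial>lborel"] exI[of _ "2 * CARD('n)"] conjI allI impI)
    show "0 \<le> (\<integral>(x::real^'n). cauchy_weight x \<partial>lborel)"
      using cauchy_weight_pos by (intro integral_nonneg_AE AE_I2 less_imp_le) auto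
    fix \<phi> :: "real^'n \<Rightarrow> complex" assume p: "test_function M \<phi>"
    have b: "cmod (\<phi> x) \<le> test_seminorm M (2 * CARD('n)) \<phi> * inverse ((1 + norm x) ^ (2 * CARD('n)))" for x
    proof -
      have "0 < (1 + norm x) ^ (2 * CARD('n))" by (intro zero_less_power add_pos_nonneg) auto
      then show ?thesis using test_seminorm_ge[OF p, of "[]" "2 * CARD('n)" x] Euclidean
        by (simp add: decay_weight_def field_simps)
    qed
    show "integrable (phys_measure M) \<phi>" using p test_function_integrable Euclidean by simp
    show "(\<integral>x. cmod (\<phi> x) \<partial>phys_measure M) \<le> (\<integral>(x::real^'n). cauchy_weight x \<partial>lborel) * test_seminorm M (2 * CARD('n)) \<phi>"
      using integrable_if_decay(2)[OF test_functionD(3)[OF p] b test_seminorm_nonneg[OF p]] Euclidean by (simp add: mult.commute)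
  qed
next
  case Torus
  interpret finite_measure "phys_measure Torus :: (real^'n::finite) measure" by (rule finite_measure_torus)
  show ?thesis
  proof (intro exI[of _ "measure (phys_measure Torus :: (real^'n::finite) measure) (space (phys_measure Torus :: (real^'n::finite) measure))"] exI[of _ 0] conjI allI impI)
    fix \<phi> :: "real^'n \<Rightarrow> complex" assume p: "test_function M \<phi>"
    have b: "cmod (\<phi> x) \<le> test_seminorm M 0 \<phi>" for x
      using test_seminorm_ge[OF p, of "[]" 0 x] by simp
    have m: "\<phi> \<in> borel_measurable (phys_measure Torus)"
      by (rule borel_measurable_phys[OF test_functionD(3)[OF p]])
    show i: "integrable (phys_measure M) \<phi>" unfolding Torus
      by (rule integrable_const_bound[where B="test_seminorm M 0 \<phi>"]) (use b m in auto)
    have "(\<integral>x. cmod (\<phi> x) \<partial>phys_measure Torus) \<le> (\<integral>(x::real^'n). test_seminorm M 0 \<phi> \<partial>phys_measure Torus)"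
      using i[unfolded Torus] b by (intro integral_mono integrable_norm integrable_const) auto
    then show "(\<integral>x. cmod (\<phi> x) \<partial>phys_measure M) \<le> measure (phys_measure Torus :: (real^'n::finite) measure) (space (phys_measure Torus :: (real^'n::finite) measure)) * test_seminorm M 0 \<phi>"
      using Torus by simp
  qed simp
qed

lemma bounded_mult_test_function_integrable:
  fixes f \<phi> :: "real^'n::finite \<Rightarrow> complex"
  assumes f: "f \<in> borel_measurable borel" "\<And>x. cmod (f x) \<le> B" and p: "test_function M \<phi>"
  shows "integrable (phys_measure M) (\<lambda>x. f x * \<phi> x)"
proof -
  have i: "integrable (phys_measure M) \<phi>" using test_function_phys_integrable[where 'n='n and M=M] p by blast
  have [measurable]: "f \<in> borel_measurable (phys_measure M)" by (rule borel_measurable_phys[OF f(1)])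
  have "integrable (phys_measure M) (\<lambda>x. of_real B * \<phi> x)" using i by (rule integrable_mult_right)
  then show ?thesis
  proof (rule Bochner_Integration.integrable_bound)
    have "cmod (f x) \<le> \<bar>B\<bar>" for x using f(2)[of x] by linarith
    then show "AE x in phys_measure M. cmod (f x * \<phi> x) \<le> cmod (of_real B * \<phi> x)"
      by (auto simp: norm_mult intro!: AE_I2 mult_right_mono)
  qed (use i in measurable)
qed

lemma distribution_regular:
  fixes f :: "real^'n::finite \<Rightarrow> complex"
  assumes f: "f \<in> borel_measurable borel" "\<And>x. cmod (f x) \<le> B"
  shows "distribution M (regular_distr M f)"
proof -
  obtain K N where KN: "0 \<le> K" "\<And>\<phi>::real^'n \<Rightarrow> complex. test_function M \<phi> \<Longrightarrow>
     integrable (phys_measure M) \<phi>" "\<And>\<phi>::real^'n \<Rightarrow> complex. test_function M \<phi> \<Longrightarrow> (\<integral>x. cmod (\<phi> x) \<partial>phys_measure M) \<le> K * test_seminorm M N \<phi>"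
    using test_function_phys_integrable[where 'n='n and M=M] by blast
  have B: "0 \<le> B" using order_trans[OF norm_ge_zero f(2)[of 0]] .
  show ?thesis unfolding distribution_def
  proof (intro conjI allI impI exI)
    fix a b and \<phi> \<psi> :: "real^'n \<Rightarrow> complex" assume p: "test_function M \<phi>" "test_function M \<psi>"
    have "(\<lambda>x. f x * (a * \<phi> x + b * \<psi> x)) = (\<lambda>x. a * (f x * \<phi> x) + b * (f x * \<psi> x))"
      by (auto simp: algebra_simps)
    then show "regular_distr M f (\<lambda>x. a * \<phi> x + b * \<psi> x) = a * regular_distr M f \<phi> + b * regular_distr M f \<psi>"
      unfolding regular_distr_def
      by (simp only:) (subst Bochner_Integration.integral_add, auto intro!: integrable_mult_right bounded_mult_test_function_integrable[OF f] p)
  next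
    fix \<phi> :: "real^'n \<Rightarrow> complex" assume p: "test_function M \<phi>"
    have "cmod (regular_distr M f \<phi>) \<le> (\<integral>x. cmod (f x * \<phi> x) \<partial>phys_measure M)"
      unfolding regular_distr_def by (rule integral_norm_bound)
    also have "\<dots> \<le> (\<integral>x. B * cmod (\<phi> x) \<partial>phys_measure M)"
      using integrable_norm[OF bounded_mult_test_function_integrable[OF f p]] integrable_norm[OF KN(2)[OF p]] f(2)
      by (intro integral_mono) (auto simp: norm_mult intro!: mult_right_mono)
    also have "\<dots> \<le> B * (K * test_seminorm M N \<phi>)"
      using mult_left_mono[OF KN(3)[OF p] B] by simp
    finally show "cmod (regular_distr M f \<phi>) \<le> B * K * test_seminorm M N \<phi>" by (simp add: mult.assoc)
  qed
qed

section \<open>Functions with integrable Fourier transform\<close>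

lemma has_fourier_measurable: "has_fourier M T g \<Longrightarrow> g \<in> borel_measurable (dual_measure M)"
  by (cases M) (auto simp: has_fourier_def)

text \<open>\<open>fourier\<close> picks an arbitrary transform, so computing with it requires that
  any two candidates agree almost everywhere. On the torus the coefficients are determined outright;
  on \<open>\<real>^d\<close> the difference of two candidates integrates to zero against all test
  functions.\<close>

lemma has_fourier_unique:
  fixes g h :: "real^'n::finite \<Rightarrow> complex"
  assumes g: "has_fourier M T g" and h: "has_fourier M T h"
  shows "AE \<xi> in dual_measure M. g \<xi> = h \<xi>"
proof (cases M)
  case Torus
  show ?thesis by (rule AE_I2) (use g h Torus in \<open>simp add: has_fourier_def\<close>)
next
  case Euclidean
  have "AE \<xi> in lborel. g \<xi> - h \<xi> = 0"
  proof (rule AE_zero_if_test_integrals_zero)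
    fix \<phi> :: "real^'n \<Rightarrow> complex" assume p: "test_function Euclidean \<phi>"
    have i: "integrable lborel (\<lambda>\<xi>. g \<xi> * \<phi> \<xi>)" "integrable lborel (\<lambda>\<xi>. h \<xi> * \<phi> \<xi>)"
      and e: "(\<integral>\<xi>. g \<xi> * \<phi> \<xi> \<partial>lborel) = (\<integral>\<xi>. h \<xi> * \<phi> \<xi> \<partial>lborel)"
      using g h p Euclidean by (auto simp: has_fourier_def)
    show "integrable lborel (\<lambda>\<xi>. (g \<xi> - h \<xi>) * \<phi> \<xi>)"
      using Bochner_Integration.integrable_diff[OF i] by (simp add: left_diff_distrib)
    show "(\<integral>\<xi>. (g \<xi> - h \<xi>) * \<phi> \<xi> \<partial>lborel) = 0"
      using Bochner_Integration.integral_diff[OF i] e by (simp add: left_diff_distrib)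
  qed
  then show ?thesis unfolding Euclidean dual_measure_simps by simp
qed

lemma has_fourier_fourier:
  assumes "has_fourier M T g"
  shows "has_fourier M T (fourier M T)" "AE \<xi> in dual_measure M. fourier M T \<xi> = g \<xi>"
    "fourier M T \<in> borel_measurable (dual_measure M)"
proof -
  show 1: "has_fourier M T (fourier M T)" unfolding fourier_def by (rule someI[where P="has_fourier M T"]) (rule assms)
  show "AE \<xi> in dual_measure M. fourier M T \<xi> = g \<xi>" by (rule has_fourier_unique[OF 1 assms])
  show "fourier M T \<in> borel_measurable (dual_measure M)" by (rule has_fourier_measurable[OF 1])
qed

lemma japanese_pos: "0 < japanese \<xi>"
  and japanese_ge_1: "1 \<le> japanese \<xi>"
  and norm_le_japanese: "norm \<xi> \<le> japanese \<xi>"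
proof -
  show "norm \<xi> \<le> japanese \<xi>" unfolding japanese_def by (rule real_le_rsqrt) simp
qed (auto simp: japanese_def add_pos_nonneg)

lemma japanese_powr_measurable: "(\<lambda>\<xi>. japanese \<xi> powr s) \<in> borel_measurable (dual_measure M)"
  by (rule borel_measurable_dual) (simp add: japanese_def)

text \<open>The bridge from the chosen transform to a computed one. Joint measurability of
  \<open>F\<close> in frequency and value makes both integrands measurable, so that equality almost
  everywhere suffices.\<close>

lemma fourier_integral_cong:
  assumes g: "has_fourier M T g" and F: "case_prod F \<in> borel_measurable (dual_measure M \<Otimes>\<^sub>M borel)"
  shows "integrable (dual_measure M) (\<lambda>\<xi>. F \<xi> (fourier M T \<xi>)) \<longleftrightarrow> integrable (dual_measure M) (\<lambda>\<xi>. F \<xi> (g \<xi>) :: 'c::{banach, second_countable_topology})"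
    "(\<integral>\<xi>. F \<xi> (fourier M T \<xi>) \<partial>dual_measure M) = (\<integral>\<xi>. F \<xi> (g \<xi>) \<partial>dual_measure M)"
proof -
  have [measurable]: "fourier M T \<in> borel_measurable (dual_measure M)" "g \<in> borel_measurable (dual_measure M)"
    using has_fourier_fourier(3)[OF g] has_fourier_measurable[OF g] by auto
  have m: "h \<in> borel_measurable (dual_measure M) \<Longrightarrow> (\<lambda>\<xi>. F \<xi> (h \<xi>)) \<in> borel_measurable (dual_measure M)" for h
    using measurable_compose[OF measurable_Pair[OF measurable_ident_sets[OF refl]] F, of h] by simp
  have ae: "AE \<xi> in dual_measure M. F \<xi> (fourier M T \<xi>) = F \<xi> (g \<xi>)"
    using has_fourier_fourier(2)[OF g] by eventually_elim simp
  show "integrable (dual_measure M) (\<lambda>\<xi>. F \<xi> (fourier M T \<xi>)) \<longleftrightarrow> integrable (dual_measure M) (\<lambda>\<xi>. F \<xi> (g \<xi>) :: 'c)"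
    by (rule integrable_cong_AE[OF m m ae]) measurable
  show "(\<integral>\<xi>. F \<xi> (fourier M T \<xi>) \<partial>dual_measure M) = (\<integral>\<xi>. F \<xi> (g \<xi>) \<partial>dual_measure M)"
    by (rule integral_cong_AE[OF m m ae]) measurable
qed

lemma weighted_pair_measurable:
  fixes w :: "_ \<Rightarrow> 'c::{real_normed_algebra, second_countable_topology}"
  assumes "w \<in> borel_measurable N" "f \<in> borel_measurable borel"
  shows "(\<lambda>(\<xi>, z). w \<xi> * f z) \<in> borel_measurable (N \<Otimes>\<^sub>M borel)"
  using measurable_compose[OF measurable_fst assms(1), of borel] measurable_compose[OF measurable_snd assms(2), of N]
  unfolding case_prod_beta' by (rule borel_measurable_times)

lemma weighted_norm_measurable:
  "(\<lambda>(\<xi>, z). japanese \<xi> powr s * cmod z) \<in> borel_measurable (dual_measure M \<Otimes>\<^sub>M borel)"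
  by (rule weighted_pair_measurable[OF japanese_powr_measurable borel_measurable_norm])

lemma in_FL_iff:
  assumes "has_fourier M T g"
  shows "in_FL M s T \<longleftrightarrow> distribution M T \<and> integrable (dual_measure M) (\<lambda>\<xi>. japanese \<xi> powr s * cmod (g \<xi>))"
    and "FL_norm M s T = (\<integral>\<xi>. japanese \<xi> powr s * cmod (g \<xi>) \<partial>dual_measure M)"
  using fourier_integral_cong[OF assms weighted_norm_measurable[of s]] has_fourier_fourier(1)[OF assms]
  by (auto simp: in_FL_def FL_norm_def)

lemma in_Hs_iff:
  assumes "has_fourier M T g"
  shows "in_Hs M s T \<longleftrightarrow> distribution M T \<and> integrable (dual_measure M) (\<lambda>\<xi>. (japanese \<xi> powr s * cmod (g \<xi>))\<^sup>2)"
    and "Hs_norm M s T = sqrt (\<integral>\<xi>. (japanese \<xi> powr s * cmod (g \<xi>))\<^sup>2 \<partial>dual_measure M)"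
proof -
  have "(\<lambda>(\<xi>, z). (japanese \<xi> powr s * cmod z)\<^sup>2) \<in> borel_measurable (dual_measure M \<Otimes>\<^sub>M borel)"
    using borel_measurable_power[OF weighted_norm_measurable[of s M], of 2] by (simp add: case_prod_beta')
  from fourier_integral_cong[OF assms this] has_fourier_fourier(1)[OF assms]
  show "in_Hs M s T \<longleftrightarrow> distribution M T \<and> integrable (dual_measure M) (\<lambda>\<xi>. (japanese \<xi> powr s * cmod (g \<xi>))\<^sup>2)"
    and "Hs_norm M s T = sqrt (\<integral>\<xi>. (japanese \<xi> powr s * cmod (g \<xi>))\<^sup>2 \<partial>dual_measure M)"
    by (auto simp: in_Hs_def Hs_norm_def)
qed

lemma fourier_mult_eq:
  fixes T :: "'n::finite distr"
  assumes g: "has_fourier M T g" and m: "m \<in> borel_measurable borel"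
  shows "fourier_mult M m T = inv_fourier M (\<lambda>\<xi>. of_real (m (norm \<xi>)) * g \<xi>)"
proof
  fix x :: "real^'n"
  have 1: "(\<lambda>\<xi>. cis (x \<bullet> \<xi>) * of_real (m (norm \<xi>))) \<in> borel_measurable (dual_measure M)"
    by (rule borel_measurable_dual) (use m in measurable)
  show "fourier_mult M m T x = inv_fourier M (\<lambda>\<xi>. of_real (m (norm \<xi>)) * g \<xi>) x"
    using fourier_integral_cong(2)[OF g weighted_pair_measurable[OF 1, of "\<lambda>z. z"]]
    by (simp add: fourier_mult_def inv_fourier_def mult.assoc)
qed

lemma has_fourier_diff:
  assumes g: "has_fourier M T g" and h: "has_fourier M S h"
  shows "has_fourier M (\<lambda>\<phi>. T \<phi> - S \<phi>) (\<lambda>\<xi>. g \<xi> - h \<xi>)"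
  using assms by (cases M) (auto simp: has_fourier_def right_diff_distrib left_diff_distrib)

lemma distribution_diff:
  fixes T S :: "'n::finite distr"
  assumes T: "distribution M T" and S: "distribution M S"
  shows "distribution M (\<lambda>\<phi>. T \<phi> - S \<phi>)"
proof -
  obtain C N where C: "\<And>\<phi>. test_function M \<phi> \<Longrightarrow> cmod (T \<phi>) \<le> C * test_seminorm M N \<phi>"
    using T unfolding distribution_def by blast
  obtain D K where D: "\<And>\<phi>. test_function M \<phi> \<Longrightarrow> cmod (S \<phi>) \<le> D * test_seminorm M K \<phi>"
    using S unfolding distribution_def by blast
  have b: "C' * test_seminorm M N' \<phi> \<le> \<bar>C'\<bar> * test_seminorm M (N + K) \<phi>" if "test_function M \<phi>" "N' \<le> N + K" for C' N' and \<phi> :: "real^'n \<Rightarrow> complex"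
    using test_seminorm_mono[OF that] test_seminorm_nonneg[OF that(1), of N'] by (intro mult_mono) auto
  show ?thesis unfolding distribution_def
  proof (intro conjI allI impI exI)
    fix a b and \<phi> \<psi> :: "real^'n \<Rightarrow> complex" assume "test_function M \<phi>" "test_function M \<psi>"
    then show "T (\<lambda>x. a * \<phi> x + b * \<psi> x) - S (\<lambda>x. a * \<phi> x + b * \<psi> x) = a * (T \<phi> - S \<phi>) + b * (T \<psi> - S \<psi>)"
      using T S unfolding distribution_def by (simp add: algebra_simps)
  next
    fix \<phi> :: "real^'n \<Rightarrow> complex" assume p: "test_function M \<phi>"
    have "cmod (T \<phi> - S \<phi>) \<le> cmod (T \<phi>) + cmod (S \<phi>)" by (rule norm_triangle_ineq4)
    also have "\<dots> \<le> (\<bar>C\<bar> + \<bar>D\<bar>) * test_seminorm M (N + K) \<phi>"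
      using order_trans[OF C[OF p] b[OF p, of N]] order_trans[OF D[OF p] b[OF p, of K]] by (simp add: distrib_right)
    finally show "cmod (T \<phi> - S \<phi>) \<le> (\<bar>C\<bar> + \<bar>D\<bar>) * test_seminorm M (N + K) \<phi>" .
  qed
qed

text \<open>Orthogonality of the characters: the indicator of the cell and the character both factor
  over the coordinates, and where \<open>n $ i \<noteq> 0\<close> the antiderivative
  \<open>cis (y * n $ i) / (\<i> * n $ i)\<close> takes equal values at the ends of the
  period.\<close>

lemma integral_cell_cis:
  fixes n :: "real^'n::finite"
  assumes n: "n \<in> int_lattice"
  shows "(\<integral>x. cis (x \<bullet> n) \<partial>phys_measure Torus) = (if n = 0 then of_real ((2 * pi) ^ CARD('n)) else 0)"
proof -
  let ?f = "\<lambda>i y. complex_of_real (indicator {0..2*pi} y) * cis (y * n $ i)"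
  have c: "continuous_on {0..2*pi} (\<lambda>y. cis (y * m))" for m by (intro continuous_intros)
  have int: "integrable lborel (?f i)" for i
    using borel_integrable_compact[OF _ c[of "n $ i"]] by (simp add: scaleR_conv_of_real)
  have val: "(\<integral>y. ?f i y \<partial>lborel) = (if n $ i = 0 then of_real (2 * pi) else 0)" for i
  proof (cases "n $ i = 0")
    case True
    have "(\<integral>y. complex_of_real (indicator {0..2*pi} y) \<partial>lborel) = of_real (2 * pi)"
      by (subst integral_complex_of_real) simp
    then show ?thesis using True by simp
  next
    case False
    let ?F = "\<lambda>y. cis (y * n $ i) / (\<i> * of_real (n $ i))"
    have "(\<integral>y. indicator {0..2*pi} y *\<^sub>R cis (y * n $ i) \<partial>lborel) = ?F (2 * pi) - ?F 0"
    proof (rule integral_FTC_Icc)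
      fix y
      show "(?F has_vector_derivative cis (y * n $ i)) (at y within {0..2*pi})"
        using False unfolding has_vector_derivative_def
        by (auto intro!: derivative_eq_intros simp: scaleR_conv_of_real field_simps)
    qed (auto intro!: continuous_intros)
    also have "cis (2 * pi * n $ i) = 1" using n by (intro cis_multiple_2pi) (simp add: int_lattice_def)
    finally show ?thesis using False by (simp add: scaleR_conv_of_real)
  qed
  have ind: "complex_of_real (indicator (cbox 0 (\<chi> i. 2 * pi)) x) = (\<Prod>i\<in>UNIV. complex_of_real (indicator {0..2*pi} (x $ i)))" for x :: "real^'n"
  proof (cases "x \<in> cbox 0 (\<chi> i. 2 * pi)")
    case True
    then show ?thesis by (auto simp: mem_box_cart intro!: prod.neutral[symmetric])
  next
    case False
    then obtain i where "x $ i \<notin> {0..2*pi}" by (auto simp: mem_box_cart)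
    then have "(\<Prod>i\<in>UNIV. complex_of_real (indicator {0..2*pi} (x $ i))) = 0"
      by (intro prod_zero bexI[of _ i]) (auto simp: indicator_def)
    then show ?thesis using False by simp
  qed
  have "(\<integral>x. cis (x \<bullet> n) \<partial>phys_measure Torus) = (\<integral>x. (\<Prod>i\<in>UNIV. ?f i (x $ i)) \<partial>lborel)"
    unfolding phys_measure_simps
    by (subst integral_restrict_space) (auto simp: scaleR_conv_of_real ind cis_inner prod.distrib)
  also have "\<dots> = (\<Prod>i\<in>UNIV. if n $ i = 0 then of_real (2 * pi) else 0)"
    by (subst integral_prod_vec[OF int]) (simp add: val)
  also have "\<dots> = (if n = 0 then of_real ((2 * pi) ^ CARD('n)) else 0)"
    by (auto simp: vec_eq_iff)
  finally show ?thesis .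
qed

lemma cis_phys_dual_measurable:
  "(\<lambda>p::(real^'a::finite) \<times> (real^'a). cis (fst p \<bullet> snd p)) \<in> borel_measurable (borel \<Otimes>\<^sub>M dual_measure M)" (is ?A)
  "(\<lambda>p::(real^'a) \<times> (real^'a). cis (fst p \<bullet> snd p)) \<in> borel_measurable (phys_measure K \<Otimes>\<^sub>M dual_measure M)" (is ?B)
proof -
  have c: "(\<lambda>p::(real^'a) \<times> (real^'a). cis (fst p \<bullet> snd p)) \<in> borel_measurable (borel \<Otimes>\<^sub>M borel)"
    by measurable
  have "(\<lambda>p. (fst p, snd p)) \<in> L \<Otimes>\<^sub>M dual_measure M \<rightarrow>\<^sub>M borel \<Otimes>\<^sub>M borel" if "(\<lambda>x. x) \<in> L \<rightarrow>\<^sub>M borel" for L :: "(real^'a) measure"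
    by (intro measurable_Pair measurable_compose[OF measurable_fst that] measurable_compose[OF measurable_snd ident_dual_borel])
  note * = measurable_compose[OF this c]
  show ?A using *[of borel] by simp
  show ?B using *[of "phys_measure K"] by (simp add: borel_measurable_phys)
qed

text \<open>Fubini moves the exponential onto the object tested against. On \<open>\<real>^d\<close>
  inversion for test functions then finishes; on the torus orthogonality of the characters picks out
  one coefficient.\<close>

lemma has_fourier_inv_fourier:
  fixes g :: "real^'n::finite \<Rightarrow> complex"
  assumes g: "integrable (dual_measure M) g"
  shows "has_fourier M (regular_distr M (inv_fourier M g)) g"
proof -
  define c where "c = complex_of_real (fourier_const TYPE('n))"
  have cc: "c * c * of_real ((2 * pi) ^ CARD('n)) = 1"
    unfolding c_def of_real_mult[symmetric] fourier_const_sq by simp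
  \<comment> \<open>Stated for every integrable \<open>\<psi>\<close>: it is applied to the Fourier
    transform of a test function, of which integrability is what has been established, and to a
    character on the period cell.\<close>
  have key: "(\<integral>x. inv_fourier M g x * \<psi> x \<partial>phys_measure M) = c * (\<integral>\<xi>. g \<xi> * (\<integral>x. cis (x \<bullet> \<xi>) * \<psi> x \<partial>phys_measure M) \<partial>dual_measure M)"
    if psi: "integrable (phys_measure M) \<psi>" for \<psi>
  proof -
    interpret P: pair_sigma_finite "phys_measure M :: (real^'n) measure" "dual_measure M :: (real^'n) measure"
      by (intro pair_sigma_finite.intro sigma_finite_phys sigma_finite_dual)
    note [measurable] = borel_measurable_integrable[OF psi] borel_measurable_integrable[OF g] cis_phys_dual_measurable(2)[of M M]
    have "integrable (phys_measure M \<Otimes>\<^sub>M dual_measure M) (\<lambda>(x, \<xi>). \<psi> x * g \<xi>)"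
      by (rule P.integrable_product_mult[OF psi g])
    then have I: "integrable (phys_measure M \<Otimes>\<^sub>M dual_measure M) (\<lambda>(x, \<xi>). cis (x \<bullet> \<xi>) * (\<psi> x * g \<xi>))"
      by (rule Bochner_Integration.integrable_bound) (auto simp: norm_mult case_prod_beta')
    have "(\<integral>x. inv_fourier M g x * \<psi> x \<partial>phys_measure M) = c * (\<integral>x. (\<integral>\<xi>. cis (x \<bullet> \<xi>) * (\<psi> x * g \<xi>) \<partial>dual_measure M) \<partial>phys_measure M)"
      unfolding inv_fourier_def c_def[symmetric] Bochner_Integration.integral_mult_right_zero[symmetric]
      by (intro Bochner_Integration.integral_cong refl)
         (simp add: Bochner_Integration.integral_mult_right_zero[symmetric] Bochner_Integration.integral_mult_left_zero[symmetric] mult_ac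
           del: Bochner_Integration.integral_mult_right_zero Bochner_Integration.integral_mult_left_zero)
    also have "(\<integral>x. (\<integral>\<xi>. cis (x \<bullet> \<xi>) * (\<psi> x * g \<xi>) \<partial>dual_measure M) \<partial>phys_measure M) = (\<integral>\<xi>. (\<integral>x. cis (x \<bullet> \<xi>) * (\<psi> x * g \<xi>) \<partial>phys_measure M) \<partial>dual_measure M)"
      using P.Fubini_integral[OF I] by simp
    also have "\<dots> = (\<integral>\<xi>. g \<xi> * (\<integral>x. cis (x \<bullet> \<xi>) * \<psi> x \<partial>phys_measure M) \<partial>dual_measure M)"
      by (intro Bochner_Integration.integral_cong refl)
         (simp add: Bochner_Integration.integral_mult_right_zero[symmetric] mult_ac
           del: Bochner_Integration.integral_mult_right_zero Bochner_Integration.integral_mult_left_zero)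
    finally show ?thesis .
  qed
  show ?thesis
  proof (cases M)
    case Euclidean
    have gi: "integrable lborel g" using g Euclidean by simp
    show ?thesis unfolding has_fourier_def Euclidean manifold.case
    proof (intro conjI allI impI)
      show "g \<in> borel_measurable lborel" using gi by simp
      fix \<phi> :: "real^'n \<Rightarrow> complex" assume p: "test_function Euclidean \<phi>"
      obtain C where C: "\<And>x. cmod (\<phi> x) \<le> C * inverse ((1 + norm x) ^ 0)"
        using test_function_decay[OF p] by blast
      have [measurable]: "\<phi> \<in> borel_measurable borel" by (rule test_functionD(3)[OF p])
      have "integrable lborel (\<lambda>\<xi>. of_real C * g \<xi>)" using gi by (rule integrable_mult_right)
      then show "integrable lborel (\<lambda>\<xi>. g \<xi> * \<phi> \<xi>)"
      proof (rule Bochner_Integration.integrable_bound)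
        have "cmod (\<phi> x) \<le> \<bar>C\<bar>" for x using C[of x] by simp
        then show "AE \<xi> in lborel. cmod (g \<xi> * \<phi> \<xi>) \<le> cmod (of_real C * g \<xi>)"
          by (auto simp: norm_mult mult.commute[of "\<bar>C\<bar>"] intro!: AE_I2 mult_left_mono)
      qed (use gi in measurable)
      have "regular_distr Euclidean (inv_fourier Euclidean g) (fourier_integral \<phi>) = c * (\<integral>\<xi>. g \<xi> * (c * of_real ((2 * pi) ^ CARD('n)) * \<phi> \<xi>) \<partial>lborel)"
      proof -
        have "(\<integral>x. cis (x \<bullet> \<xi>) * (c * fourier_raw \<phi> x) \<partial>lborel) = c * of_real ((2 * pi) ^ CARD('n)) * \<phi> \<xi>" for \<xi>
          unfolding mult.left_commute[of "cis _" c] mult.assoc fourier_raw_inversion[OF p, symmetric]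
          by (rule Bochner_Integration.integral_mult_right_zero)
        moreover have "integrable lborel (\<lambda>x. c * fourier_raw \<phi> x)"
          by (rule integrable_mult_right[OF fourier_raw_integrable[OF p]])
        ultimately show ?thesis
          unfolding regular_distr_def fourier_integral_raw c_def[symmetric]
          using key[unfolded Euclidean phys_measure_simps dual_measure_simps] by simp
      qed
      also have "\<dots> = c * c * of_real ((2 * pi) ^ CARD('n)) * (\<integral>\<xi>. g \<xi> * \<phi> \<xi> \<partial>lborel)"
      proof -
        have "(\<lambda>\<xi>. g \<xi> * (c * of_real ((2 * pi) ^ CARD('n)) * \<phi> \<xi>)) = (\<lambda>\<xi>. (c * of_real ((2 * pi) ^ CARD('n))) * (g \<xi> * \<phi> \<xi>))"
          by (intro ext) (simp only: mult_ac)
        then show ?thesis by (simp only: Bochner_Integration.integral_mult_right_zero mult.assoc)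
      qed
      finally show "regular_distr Euclidean (inv_fourier Euclidean g) (fourier_integral \<phi>) = (\<integral>\<xi>. g \<xi> * \<phi> \<xi> \<partial>lborel)"
        unfolding cc by simp
    qed
  next
    case Torus
    interpret F: finite_measure "phys_measure Torus :: (real^'n::finite) measure" by (rule finite_measure_torus)
    show ?thesis unfolding has_fourier_def Torus manifold.case
    proof
      fix \<eta> :: "real^'n" assume eta: "\<eta> \<in> int_lattice"
      have m: "(\<lambda>x. cis (- (x \<bullet> \<eta>))) \<in> borel_measurable (phys_measure Torus)"
        by (rule borel_measurable_phys) measurable
      have i: "integrable (phys_measure Torus) (\<lambda>x. cis (- (x \<bullet> \<eta>)))"
        by (rule F.integrable_const_bound[where B=1]) (use m in auto)
      have "regular_distr Torus (inv_fourier Torus g) (\<lambda>x. cis (- (x \<bullet> \<eta>))) =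
         c * (\<integral>\<xi>. g \<xi> * (\<integral>x. cis (x \<bullet> (\<xi> - \<eta>)) \<partial>phys_measure Torus) \<partial>count_space int_lattice)"
        unfolding regular_distr_def using key[unfolded Torus, OF i]
        by (simp add: cis_mult inner_diff_right)
      also have "(\<integral>\<xi>. g \<xi> * (\<integral>x. cis (x \<bullet> (\<xi> - \<eta>)) \<partial>phys_measure Torus) \<partial>count_space int_lattice)
         = (\<integral>\<xi>. indicator {\<eta>} \<xi> *\<^sub>R (g \<eta> * of_real ((2 * pi) ^ CARD('n))) \<partial>count_space int_lattice)"
        using eta by (intro Bochner_Integration.integral_cong refl) (subst integral_cell_cis, auto simp: indicator_def)
      also have "\<dots> = g \<eta> * of_real ((2 * pi) ^ CARD('n))"
        using eta by (subst integral_scaleR_left) (auto simp: measure_count_space)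
      finally have "regular_distr Torus (inv_fourier Torus g) (\<lambda>x. cis (- (x \<bullet> \<eta>))) = c * (g \<eta> * of_real ((2 * pi) ^ CARD('n)))" .
      then show "g \<eta> = of_real (fourier_const TYPE('n)) * regular_distr Torus (inv_fourier Torus g) (\<lambda>x. cis (- (x \<bullet> \<eta>)))"
        using cc by (simp add: c_def[symmetric] mult_ac)
    qed
  qed
qed

lemma distribution_inv_fourier:
  "integrable (dual_measure M) g \<Longrightarrow> distribution M (regular_distr M (inv_fourier M g))"
  by (rule distribution_regular[OF borel_measurable_continuous_onI[OF inv_fourier_continuous] inv_fourier_bound])

lemma FL1_function_inv_fourier:
  assumes g: "integrable (dual_measure M) g"
  shows "FL1_function M (inv_fourier M g)"
  unfolding FL1_function_def
proof (intro conjI allI impI)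
  show "function_on M (inv_fourier M g)" by (rule inv_fourier_periodic)
  show c: "continuous_on UNIV (inv_fourier M g)" by (rule inv_fourier_continuous[OF g])
  show "in_FL M 0 (regular_distr M (inv_fourier M g))"
    using g by (simp add: in_FL_iff[OF has_fourier_inv_fourier[OF g]] distribution_inv_fourier japanese_pos[THEN less_imp_neq, symmetric])
  show "integrable (phys_measure M) (\<lambda>x. inv_fourier M g x * \<phi> x)" if "test_function M \<phi>" for \<phi>
    by (rule bounded_mult_test_function_integrable[OF borel_measurable_continuous_onI[OF c] inv_fourier_bound that])
qed

lemma FL_norm_inv_fourier:
  assumes g: "integrable (dual_measure M) g"
  shows "FL_norm M 0 (regular_distr M (inv_fourier M g)) = (\<integral>\<xi>. cmod (g \<xi>) \<partial>dual_measure M)"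
  by (simp add: in_FL_iff[OF has_fourier_inv_fourier[OF g]] japanese_pos[THEN less_imp_neq, symmetric])

section \<open>Convolution powers\<close>

text \<open>The factor \<open>fourier_const\<close> is the one for which \<open>inv_fourier\<close>
  turns this operation into the pointwise product. Values in a general field allow complex solutions
  and their real majorants to be treated alike.\<close>

definition convolution :: "manifold \<Rightarrow> (real^'n::finite \<Rightarrow> 'b) \<Rightarrow> (real^'n \<Rightarrow> 'b) \<Rightarrow> real^'n \<Rightarrow> 'b::{real_normed_field, banach, second_countable_topology}"
  where "convolution M f g x = of_real (fourier_const TYPE('n)) * (\<integral>y. f (x - y) * g y \<partial>dual_measure M)"

text \<open>Convolutions of bounded integrable functions are defined everywhere, not just almost
  everywhere.\<close>

definition bdd_integrable :: "manifold \<Rightarrow> (real^'n::finite \<Rightarrow> 'b::{banach, second_countable_topology}) \<Rightarrow> bool"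
  where "bdd_integrable M f \<longleftrightarrow> integrable (dual_measure M) f \<and> (\<exists>B. \<forall>x\<in>space (dual_measure M). norm (f x) \<le> B)"

lemma bdd_integrableD:
  assumes "bdd_integrable M f"
  shows "integrable (dual_measure M) f" "f \<in> borel_measurable (dual_measure M)"
  using assms by (auto simp: bdd_integrable_def)

lemma bdd_integrable_bound:
  assumes "bdd_integrable M f"
  obtains B where "0 \<le> B" "\<And>x. x \<in> space (dual_measure M) \<Longrightarrow> norm (f x) \<le> B"
proof -
  obtain B where B: "\<And>x. x \<in> space (dual_measure M) \<Longrightarrow> norm (f x) \<le> B"
    using assms by (auto simp: bdd_integrable_def)
  have "norm (f x) \<le> \<bar>B\<bar>" if "x \<in> space (dual_measure M)" for x using B[OF that] by linarith
  then show ?thesis by (intro that[of "\<bar>B\<bar>"]) auto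
qed

lemma bdd_integrable_dominated:
  assumes A: "bdd_integrable M A" and f: "f \<in> borel_measurable (dual_measure M)"
    and le: "\<And>x. x \<in> space (dual_measure M) \<Longrightarrow> norm (f x) \<le> norm (A x)"
  shows "bdd_integrable M f"
proof -
  obtain B where B: "\<And>x. x \<in> space (dual_measure M) \<Longrightarrow> norm (A x) \<le> B" using bdd_integrable_bound[OF A] by blast
  have "integrable (dual_measure M) f"
    by (rule Bochner_Integration.integrable_bound[OF bdd_integrableD(1)[OF A] f]) (use le in auto)
  then show ?thesis using order_trans[OF le B] unfolding bdd_integrable_def by blast
qed

lemma bdd_integrable_add:
  assumes "bdd_integrable M f" "bdd_integrable M g"
  shows "bdd_integrable M (\<lambda>x. f x + g x)"
proof -
  obtain B where B: "\<And>x. x \<in> space (dual_measure M) \<Longrightarrow> norm (f x) \<le> B" using bdd_integrable_bound[OF assms(1)] by blast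
  obtain C where C: "\<And>x. x \<in> space (dual_measure M) \<Longrightarrow> norm (g x) \<le> C" using bdd_integrable_bound[OF assms(2)] by blast
  have "norm (f x + g x) \<le> B + C" if "x \<in> space (dual_measure M)" for x
    using norm_triangle_ineq[of "f x" "g x"] B[OF that] C[OF that] by linarith
  then show ?thesis using assms unfolding bdd_integrable_def by blast
qed

lemma bdd_integrable_mult:
  fixes f :: "real^'n::finite \<Rightarrow> 'b::{real_normed_field, banach, second_countable_topology}"
  assumes f: "bdd_integrable M f" and w: "w \<in> borel_measurable (dual_measure M)"
    and b: "\<And>x. x \<in> space (dual_measure M) \<Longrightarrow> norm (w x) \<le> C"
  shows "bdd_integrable M (\<lambda>x. w x * f x)"
proof (rule bdd_integrable_dominated[where A="\<lambda>x. of_real C * f x"])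
  obtain B where B: "\<And>x. x \<in> space (dual_measure M) \<Longrightarrow> norm (f x) \<le> B" using bdd_integrable_bound[OF f] by blast
  have "norm (of_real C * f x) \<le> \<bar>C\<bar> * B" if "x \<in> space (dual_measure M)" for x
    using B[OF that] by (simp add: norm_mult mult_left_mono)
  then show "bdd_integrable M (\<lambda>x. of_real C * f x)"
    using bdd_integrableD(1)[OF f] unfolding bdd_integrable_def by blast
  show "(\<lambda>x. w x * f x) \<in> borel_measurable (dual_measure M)" using w bdd_integrableD(2)[OF f] by measurable
  show "norm (w x * f x) \<le> norm (of_real C * f x)" if "x \<in> space (dual_measure M)" for x
    using b[OF that] by (auto simp: norm_mult intro!: mult_right_mono)
qed

lemma bdd_integrable_cmult:
  fixes f :: "real^'n::finite \<Rightarrow> 'b::{real_normed_field, banach, second_countable_topology}"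
  shows "bdd_integrable M f \<Longrightarrow> bdd_integrable M (\<lambda>x. c * f x)"
  by (rule bdd_integrable_mult[where C="norm c"]) auto

lemma bdd_integrable_diff:
  fixes f :: "real^'n::finite \<Rightarrow> 'b::{real_normed_field, banach, second_countable_topology}"
  assumes "bdd_integrable M f" "bdd_integrable M g"
  shows "bdd_integrable M (\<lambda>x. f x - g x)"
  using bdd_integrable_add[OF assms(1) bdd_integrable_cmult[OF assms(2), of "-1"]] by simp

lemma bdd_integrable_norm: "bdd_integrable M f \<Longrightarrow> bdd_integrable M (\<lambda>x. norm (f x))"
  using integrable_norm[OF bdd_integrableD(1)] by (auto simp: bdd_integrable_def)

lemma bdd_integrable_sum:
  fixes f :: "'i \<Rightarrow> real^'n::finite \<Rightarrow> 'b::{banach, second_countable_topology}"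
  shows "finite I \<Longrightarrow> (\<And>i. i \<in> I \<Longrightarrow> bdd_integrable M (f i)) \<Longrightarrow> bdd_integrable M (\<lambda>x. \<Sum>i\<in>I. f i x)"
  by (induction I rule: finite_induct) (auto simp: bdd_integrable_def[of M "\<lambda>x. 0"] intro!: bdd_integrable_add)

lemma bdd_integrable_affine:
  fixes f :: "real^'n::finite \<Rightarrow> 'b::{banach, second_countable_topology}"
  assumes f: "bdd_integrable M f" and a: "a \<in> space (dual_measure M)" and e: "e = 1 \<or> e = -1"
  shows "bdd_integrable M (\<lambda>x. f (a + e *\<^sub>R x))"
proof -
  obtain B where B: "\<And>x. x \<in> space (dual_measure M) \<Longrightarrow> norm (f x) \<le> B" using bdd_integrable_bound[OF f] by blast
  have "norm (f (a + e *\<^sub>R x)) \<le> B" if "x \<in> space (dual_measure M)" for x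
    using e space_dual_add[OF a that] space_dual_diff[OF a that] B by auto
  then show ?thesis using dual_affine(1)[OF a e bdd_integrableD(1)[OF f]] unfolding bdd_integrable_def by blast
qed

lemma convolution_integrable:
  fixes f g :: "real^'n::finite \<Rightarrow> 'b::{real_normed_field, banach, second_countable_topology}"
  assumes f: "bdd_integrable M f" and g: "bdd_integrable M g" and x: "x \<in> space (dual_measure M)"
  shows "integrable (dual_measure M) (\<lambda>y. f (x - y) * g y)"
proof -
  have f': "bdd_integrable M (\<lambda>y. f (x - y))" using bdd_integrable_affine[OF f x, of "-1"] by simp
  obtain B where "\<And>y. y \<in> space (dual_measure M) \<Longrightarrow> norm (f (x - y)) \<le> B" using bdd_integrable_bound[OF f'] by blast
  from bdd_integrable_mult[OF g bdd_integrableD(2)[OF f'] this] show ?thesis by (rule bdd_integrableD)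
qed

text \<open>Translation invariance decouples the two integrals. Assuming integrability alone lets
  the lemma apply to functions multiplied by a character, which is how the product formula for
  \<open>inv_fourier\<close> arises.\<close>

lemma integral_convolution:
  fixes f g :: "real^'n::finite \<Rightarrow> 'b::{real_normed_field, banach, second_countable_topology}"
  assumes f: "integrable (dual_measure M) f" and g: "integrable (dual_measure M) g"
  shows "integrable (dual_measure M) (\<lambda>x. \<integral>y. f (x - y) * g y \<partial>dual_measure M)"
    and "(\<integral>x. (\<integral>y. f (x - y) * g y \<partial>dual_measure M) \<partial>dual_measure M) = (\<integral>x. f x \<partial>dual_measure M) * (\<integral>x. g x \<partial>dual_measure M)"
proof -
  let ?m = "dual_measure M :: (real^'n) measure"
  interpret P: pair_sigma_finite ?m ?m
    by (intro pair_sigma_finite.intro sigma_finite_dual)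
  have fm: "f \<in> borel_measurable ?m" and gm [measurable]: "g \<in> borel_measurable ?m"
    using f g by auto
  have [measurable]: "(\<lambda>p. f (snd p - fst p)) \<in> borel_measurable (?m \<Otimes>\<^sub>M ?m)"
    using measurable_compose[OF measurable_compose[OF measurable_Pair[OF measurable_snd measurable_fst] diff_dual_measurable] fm]
    by simp
  have sh: "integrable ?m (\<lambda>x. f (x - y))" "(\<integral>x. f (x - y) \<partial>?m) = (\<integral>x. f x \<partial>?m)" "(\<integral>x. norm (f (x - y)) \<partial>?m) = (\<integral>x. norm (f x) \<partial>?m)"
    if "y \<in> space ?m" for y
    using dual_affine[OF space_dual_uminus[OF that], of 1 f] dual_affine[OF space_dual_uminus[OF that], of 1 "\<lambda>x. norm (f x)"] f
    by auto
  have I: "integrable (?m \<Otimes>\<^sub>M ?m) (\<lambda>(y, x). f (x - y) * g y)"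
  proof (rule P.Fubini_integrable)
    show "(\<lambda>(y, x). f (x - y) * g y) \<in> borel_measurable (?m \<Otimes>\<^sub>M ?m)"
      unfolding case_prod_beta' by measurable
    have "integrable ?m (\<lambda>y. (\<integral>x. norm (f x) \<partial>?m) * norm (g y))"
      using g by (intro integrable_mult_right integrable_norm)
    then show "integrable ?m (\<lambda>y. \<integral>x. norm (case (y, x) of (y, x) \<Rightarrow> f (x - y) * g y) \<partial>?m)"
      by (rule Bochner_Integration.integrable_cong[THEN iffD1, rotated -1, OF _ refl]) (simp add: norm_mult sh)
    show "AE y in ?m. integrable ?m (\<lambda>x. case (y, x) of (y, x) \<Rightarrow> f (x - y) * g y)"
      by (intro AE_I2) (simp add: sh)
  qed
  have I': "integrable (?m \<Otimes>\<^sub>M ?m) (\<lambda>(x, y). f (x - y) * g y)"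
    using P.integrable_product_swap[OF I] by (simp add: case_prod_beta')
  show "integrable (dual_measure M) (\<lambda>x. \<integral>y. f (x - y) * g y \<partial>dual_measure M)"
    using P.integrable_fst[OF I'] .
  have "(\<integral>x. (\<integral>y. f (x - y) * g y \<partial>?m) \<partial>?m) = (\<integral>y. (\<integral>x. f (x - y) * g y \<partial>?m) \<partial>?m)"
    using P.Fubini_integral[OF I] by simp
  also have "\<dots> = (\<integral>y. (\<integral>x. f x \<partial>?m) * g y \<partial>?m)"
    by (intro Bochner_Integration.integral_cong refl) (simp add: sh)
  finally show "(\<integral>x. (\<integral>y. f (x - y) * g y \<partial>?m) \<partial>?m) = (\<integral>x. f x \<partial>?m) * (\<integral>x. g x \<partial>?m)" by simp
qed

text \<open>Convolutions of time-dependent functions have to be measurable jointly in time and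
  frequency before Fubini can be applied to the Duhamel integral.\<close>

lemma convolution_measurable_param:
  fixes F G :: "'t \<Rightarrow> real^'n::finite \<Rightarrow> 'b::{real_normed_field, banach, second_countable_topology}"
  assumes F: "(\<lambda>p. F (fst p) (snd p)) \<in> borel_measurable (N \<Otimes>\<^sub>M dual_measure M)"
    and G: "(\<lambda>p. G (fst p) (snd p)) \<in> borel_measurable (N \<Otimes>\<^sub>M dual_measure M)"
  shows "(\<lambda>p. convolution M (F (fst p)) (G (fst p)) (snd p)) \<in> borel_measurable (N \<Otimes>\<^sub>M dual_measure M)"
proof -
  interpret sigma_finite_measure "dual_measure M :: (real^'n) measure" by (rule sigma_finite_dual)
  let ?m = "dual_measure M :: (real^'n) measure"
  have d: "(\<lambda>q. snd (fst q) - snd q) \<in> (N \<Otimes>\<^sub>M ?m) \<Otimes>\<^sub>M ?m \<rightarrow>\<^sub>M ?m"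
    using measurable_compose[OF measurable_Pair[OF measurable_compose[OF measurable_fst measurable_snd] measurable_snd] diff_dual_measurable]
    by simp
  have 1: "(\<lambda>q. F (fst (fst q)) (snd (fst q) - snd q)) \<in> borel_measurable ((N \<Otimes>\<^sub>M ?m) \<Otimes>\<^sub>M ?m)"
    using measurable_compose[OF measurable_Pair[OF measurable_compose[OF measurable_fst measurable_fst] d] F] by simp
  have 2: "(\<lambda>q. G (fst (fst q)) (snd q)) \<in> borel_measurable ((N \<Otimes>\<^sub>M ?m) \<Otimes>\<^sub>M ?m)"
    using measurable_compose[OF measurable_Pair[OF measurable_compose[OF measurable_fst measurable_fst] measurable_snd] G] by simp
  have "(\<lambda>p. \<integral>y. F (fst p) (snd p - y) * G (fst p) y \<partial>?m) \<in> borel_measurable (N \<Otimes>\<^sub>M ?m)"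
    by (rule borel_measurable_lebesgue_integral) (use borel_measurable_times[OF 1 2] in \<open>simp add: case_prod_beta'\<close>)
  then show ?thesis unfolding convolution_def by measurable
qed

lemma convolution_norm_le:
  fixes f g :: "real^'n::finite \<Rightarrow> 'b::{real_normed_field, banach, second_countable_topology}"
  assumes f: "bdd_integrable M f" and g: "bdd_integrable M g" and A: "bdd_integrable M A" and B: "bdd_integrable M B"
    and fA: "\<And>x. x \<in> space (dual_measure M) \<Longrightarrow> norm (f x) \<le> A x"
    and gB: "\<And>x. x \<in> space (dual_measure M) \<Longrightarrow> norm (g x) \<le> B x"
    and x: "x \<in> space (dual_measure M)"
  shows "norm (convolution M f g x) \<le> (convolution M A B x :: real)"
proof -
  have "norm (\<integral>y. f (x - y) * g y \<partial>dual_measure M) \<le> (\<integral>y. norm (f (x - y) * g y) \<partial>dual_measure M)"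
    by (rule integral_norm_bound)
  also have "\<dots> \<le> (\<integral>y. A (x - y) * B y \<partial>dual_measure M)"
    using x by (intro integral_mono integrable_norm convolution_integrable f g A B)
      (auto simp: norm_mult intro!: mult_mono fA gB space_dual_diff order_trans[OF norm_ge_zero fA])
  finally show ?thesis using fourier_const_pos[where 'n='n] by (simp add: convolution_def norm_mult mult_left_mono)
qed

lemma convolution_sup_bound:
  fixes f g :: "real^'n::finite \<Rightarrow> 'b::{real_normed_field, banach, second_countable_topology}"
  assumes f: "bdd_integrable M f" and g: "bdd_integrable M g"
    and B: "\<And>x. x \<in> space (dual_measure M) \<Longrightarrow> norm (g x) \<le> B"
    and x: "x \<in> space (dual_measure M)"
  shows "norm (convolution M f g x) \<le> fourier_const TYPE('n) * (\<integral>y. norm (f y) \<partial>dual_measure M) * B"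
proof -
  let ?m = "dual_measure M :: (real^'n) measure"
  have sh: "integrable ?m (\<lambda>y. norm (f (x - y)))" "(\<integral>y. norm (f (x - y)) \<partial>?m) = (\<integral>y. norm (f y) \<partial>?m)"
    using dual_affine[OF x, of "-1" "\<lambda>y. norm (f y)"] bdd_integrableD(1)[OF f] by auto
  have "norm (\<integral>y. f (x - y) * g y \<partial>?m) \<le> (\<integral>y. norm (f (x - y) * g y) \<partial>?m)"
    by (rule integral_norm_bound)
  also have "\<dots> \<le> (\<integral>y. norm (f (x - y)) * B \<partial>?m)"
    using sh dual_affine(1)[OF x, of "-1" f] bdd_integrableD(1)[OF f] by (intro integral_mono integrable_norm convolution_integrable[OF f g x] integrable_mult_left)
      (auto simp: norm_mult intro!: mult_left_mono B)
  also have "\<dots> = (\<integral>y. norm (f y) \<partial>?m) * B" using sh by simp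
  finally show ?thesis using fourier_const_pos[where 'n='n] by (simp add: convolution_def norm_mult mult.assoc mult_left_mono)
qed

lemma bdd_integrable_convolution:
  fixes f g :: "real^'n::finite \<Rightarrow> 'b::{real_normed_field, banach, second_countable_topology}"
  assumes f: "bdd_integrable M f" and g: "bdd_integrable M g"
  shows "bdd_integrable M (convolution M f g)"
    and "(\<integral>x. norm (convolution M f g x) \<partial>dual_measure M) \<le> fourier_const TYPE('n) * (\<integral>x. norm (f x) \<partial>dual_measure M) * (\<integral>x. norm (g x) \<partial>dual_measure M)"
proof -
  let ?m = "dual_measure M :: (real^'n) measure"
  have i: "integrable ?m (convolution M f g)" unfolding convolution_def
    by (intro integrable_mult_right integral_convolution bdd_integrableD f g)
  obtain B where "\<And>x. x \<in> space ?m \<Longrightarrow> norm (g x) \<le> B" using bdd_integrable_bound[OF g] by blast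
  from convolution_sup_bound[OF f g this] i show "bdd_integrable M (convolution M f g)" unfolding bdd_integrable_def by blast
  have "(\<integral>x. norm (convolution M f g x) \<partial>?m) \<le> (\<integral>x. fourier_const TYPE('n) * (\<integral>y. norm (f (x - y)) * norm (g y) \<partial>?m) \<partial>?m)"
  proof (rule integral_mono)
    show "integrable ?m (\<lambda>x. fourier_const TYPE('n) * (\<integral>y. norm (f (x - y)) * norm (g y) \<partial>?m))"
      by (intro integrable_mult_right integral_convolution integrable_norm bdd_integrableD f g)
    show "norm (convolution M f g x) \<le> fourier_const TYPE('n) * (\<integral>y. norm (f (x - y)) * norm (g y) \<partial>?m)" if "x \<in> space ?m" for x
      using convolution_norm_le[OF f g bdd_integrable_norm[OF f] bdd_integrable_norm[OF g] order_refl order_refl that] by (simp add: convolution_def)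
  qed (use i in auto)
  also have "\<dots> = fourier_const TYPE('n) * (\<integral>x. norm (f x) \<partial>?m) * (\<integral>x. norm (g x) \<partial>?m)"
    by (simp add: integral_convolution(2)[OF integrable_norm integrable_norm] bdd_integrableD f g)
  finally show "(\<integral>x. norm (convolution M f g x) \<partial>?m) \<le> fourier_const TYPE('n) * (\<integral>x. norm (f x) \<partial>?m) * (\<integral>x. norm (g x) \<partial>?m)" .
qed

lemma inv_fourier_convolution:
  fixes f g :: "real^'n::finite \<Rightarrow> complex"
  assumes f: "bdd_integrable M f" and g: "bdd_integrable M g"
  shows "inv_fourier M (convolution M f g) x = inv_fourier M f x * inv_fourier M g x"
proof -
  let ?m = "dual_measure M :: (real^'n) measure"
  have "inv_fourier M (convolution M f g) x = of_real (fourier_const TYPE('n)) * (of_real (fourier_const TYPE('n)) *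
     (\<integral>z. (\<integral>y. (cis (x \<bullet> (z - y)) * f (z - y)) * (cis (x \<bullet> y) * g y) \<partial>?m) \<partial>?m))"
  proof -
    have "cis (x \<bullet> z) * (\<integral>y. f (z - y) * g y \<partial>?m) = (\<integral>y. (cis (x \<bullet> (z - y)) * f (z - y)) * (cis (x \<bullet> y) * g y) \<partial>?m)" for z
    proof -
      have "(cis (x \<bullet> (z - y)) * f (z - y)) * (cis (x \<bullet> y) * g y) = cis (x \<bullet> z) * (f (z - y) * g y)" for y
      proof -
        have "cis (x \<bullet> z) = cis (x \<bullet> (z - y)) * cis (x \<bullet> y)" by (simp add: cis_mult inner_diff_right)
        then show ?thesis by (simp only: mult_ac)
      qed
      then show ?thesis by (simp only: Bochner_Integration.integral_mult_right_zero)
    qed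
    then show ?thesis unfolding inv_fourier_def convolution_def by (simp add: mult.left_commute[of "cis _" "of_real (fourier_const TYPE('n))"])
  qed
  also have "\<dots> = inv_fourier M f x * inv_fourier M g x"
    unfolding inv_fourier_def
    by (subst integral_convolution(2)[OF integrable_dual_cis_mult[OF bdd_integrableD(1)[OF f]] integrable_dual_cis_mult[OF bdd_integrableD(1)[OF g]]]) simp
  finally show ?thesis .
qed

lemma convolution_diff_left:
  fixes f f' g :: "real^'n::finite \<Rightarrow> 'b::{real_normed_field, banach, second_countable_topology}"
  assumes "bdd_integrable M f" "bdd_integrable M f'" "bdd_integrable M g" "x \<in> space (dual_measure M)"
  shows "convolution M (\<lambda>x. f x - f' x) g x = convolution M f g x - convolution M f' g x"
  unfolding convolution_def
  by (simp add: left_diff_distrib right_diff_distrib Bochner_Integration.integral_diff[OF convolution_integrable[OF assms(1,3,4)] convolution_integrable[OF assms(2,3,4)]])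

lemma convolution_diff_right:
  fixes f g g' :: "real^'n::finite \<Rightarrow> 'b::{real_normed_field, banach, second_countable_topology}"
  assumes "bdd_integrable M f" "bdd_integrable M g" "bdd_integrable M g'" "x \<in> space (dual_measure M)"
  shows "convolution M f (\<lambda>x. g x - g' x) x = convolution M f g x - convolution M f g' x"
  unfolding convolution_def
  by (simp add: right_diff_distrib Bochner_Integration.integral_diff[OF convolution_integrable[OF assms(1,2,4)] convolution_integrable[OF assms(1,3,4)]])

text \<open>The index is shifted by one: \<open>cpow M m f\<close> has \<open>m + 1\<close> factors,
  since on \<open>\<real>^d\<close> convolution has no unit among functions. The nonlinearity
  \<open>u^k\<close> thus corresponds to \<open>m = k - 1\<close>.\<close>

primrec cpow :: "manifold \<Rightarrow> nat \<Rightarrow> (real^'n::finite \<Rightarrow> 'b) \<Rightarrow> real^'n \<Rightarrow> 'b::{real_normed_field, banach, second_countable_topology}"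
  where "cpow M 0 f = f"
  | "cpow M (Suc m) f = convolution M f (cpow M m f)"

lemma bdd_integrable_cpow: "bdd_integrable M f \<Longrightarrow> bdd_integrable M (cpow M m f)"
  by (induction m) (auto intro: bdd_integrable_convolution)

lemma inv_fourier_cpow: "bdd_integrable M f \<Longrightarrow> inv_fourier M (cpow M m f) x = inv_fourier M f x ^ Suc m"
  by (induction m) (simp_all add: inv_fourier_convolution bdd_integrable_cpow)

lemma cpow_L1_bound:
  fixes f :: "real^'n::finite \<Rightarrow> 'b::{real_normed_field, banach, second_countable_topology}"
  assumes f: "bdd_integrable M f" and R: "(\<integral>x. norm (f x) \<partial>dual_measure M) \<le> R"
  shows "(\<integral>x. norm (cpow M m f x) \<partial>dual_measure M) \<le> fourier_const TYPE('n) ^ m * R ^ Suc m"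
proof (induction m)
  case (Suc m)
  have c: "0 \<le> fourier_const TYPE('n)" by (rule less_imp_le[OF fourier_const_pos])
  have R0: "0 \<le> R" by (rule order_trans[OF _ R]) simp
  have "(\<integral>x. norm (cpow M (Suc m) f x) \<partial>dual_measure M) \<le> fourier_const TYPE('n) * (\<integral>x. norm (f x) \<partial>dual_measure M) * (\<integral>x. norm (cpow M m f x) \<partial>dual_measure M)"
    using bdd_integrable_convolution(2)[OF f bdd_integrable_cpow[OF f]] by simp
  also have "\<dots> \<le> fourier_const TYPE('n) * R * (fourier_const TYPE('n) ^ m * R ^ Suc m)"
    by (intro mult_mono Suc R mult_left_mono mult_nonneg_nonneg) (use c R0 in auto)
  finally show ?case by (simp add: mult_ac)
qed (use R in simp)

text \<open>One factor is measured in the supremum norm and the other \<open>m\<close> in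
  \<open>L^1\<close>, so a smallness condition on the \<open>L^1\<close> size alone also controls
  suprema.\<close>

lemma cpow_sup_bound:
  fixes f :: "real^'n::finite \<Rightarrow> 'b::{real_normed_field, banach, second_countable_topology}"
  assumes f: "bdd_integrable M f" and R: "(\<integral>x. norm (f x) \<partial>dual_measure M) \<le> R"
    and B: "\<And>x. x \<in> space (dual_measure M) \<Longrightarrow> norm (f x) \<le> B" and x: "x \<in> space (dual_measure M)"
  shows "norm (cpow M m f x) \<le> fourier_const TYPE('n) ^ m * R ^ m * B"
  using x
proof (induction m arbitrary: x)
  case (Suc m)
  have c: "0 \<le> fourier_const TYPE('n)" by (rule less_imp_le[OF fourier_const_pos])
  have R0: "0 \<le> R" by (rule order_trans[OF _ R]) simp
  have B0: "0 \<le> B" using order_trans[OF norm_ge_zero B[OF Suc.prems]] .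
  have "norm (cpow M (Suc m) f x) \<le> fourier_const TYPE('n) * (\<integral>x. norm (f x) \<partial>dual_measure M) * (fourier_const TYPE('n) ^ m * R ^ m * B)"
    using convolution_sup_bound[OF f bdd_integrable_cpow[OF f] Suc.IH Suc.prems] by simp
  also have "\<dots> \<le> fourier_const TYPE('n) * R * (fourier_const TYPE('n) ^ m * R ^ m * B)"
    by (intro mult_mono R mult_left_mono mult_nonneg_nonneg) (use c R0 B0 in auto)
  finally show ?case by (simp add: mult_ac)
qed (use B in simp)

lemma cpow_norm_le:
  fixes f :: "real^'n::finite \<Rightarrow> 'b::{real_normed_field, banach, second_countable_topology}"
  assumes f: "bdd_integrable M f" and A: "bdd_integrable M A"
    and fA: "\<And>x. x \<in> space (dual_measure M) \<Longrightarrow> norm (f x) \<le> A x"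
    and x: "x \<in> space (dual_measure M)"
  shows "norm (cpow M m f x) \<le> (cpow M m A x :: real)"
  using x by (induction m arbitrary: x)
    (auto simp: fA intro!: convolution_norm_le f A bdd_integrable_cpow)

text \<open>Telescoping with domination: each term of the expansion contains one difference
  \<open>f - g\<close>, dominated by \<open>A - B\<close>, and factors dominated by \<open>A\<close>
  or \<open>B\<close>; the same expansion for the majorants recombines exactly.\<close>

lemma cpow_diff_le:
  fixes f g :: "real^'n::finite \<Rightarrow> 'b::{real_normed_field, banach, second_countable_topology}"
  assumes f: "bdd_integrable M f" and g: "bdd_integrable M g" and A: "bdd_integrable M A" and B: "bdd_integrable M B"
    and fA: "\<And>x. x \<in> space (dual_measure M) \<Longrightarrow> norm (f x) \<le> A x"
    and gB: "\<And>x. x \<in> space (dual_measure M) \<Longrightarrow> norm (g x) \<le> B x"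
    and d: "\<And>x. x \<in> space (dual_measure M) \<Longrightarrow> norm (f x - g x) \<le> A x - B x"
    and x: "x \<in> space (dual_measure M)"
  shows "norm (cpow M m f x - cpow M m g x) \<le> (cpow M m A x - cpow M m B x :: real)"
  using x
proof (induction m arbitrary: x)
  case (Suc m)
  note bi = f g A B bdd_integrable_cpow bdd_integrable_diff
  have "cpow M (Suc m) f x - cpow M (Suc m) g x = convolution M (\<lambda>x. f x - g x) (cpow M m f) x + convolution M g (\<lambda>x. cpow M m f x - cpow M m g x) x"
    using Suc.prems by (simp add: convolution_diff_left convolution_diff_right bi)
  also have "norm \<dots> \<le> convolution M (\<lambda>x. A x - B x) (cpow M m A) x + convolution M B (\<lambda>x. cpow M m A x - cpow M m B x) x"
    by (intro order_trans[OF norm_triangle_ineq] add_mono convolution_norm_le bi cpow_norm_le[OF f A fA] gB d Suc)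
  also have "\<dots> = cpow M (Suc m) A x - cpow M (Suc m) B x"
    using Suc.prems by (simp add: convolution_diff_left convolution_diff_right bi)
  finally show ?case .
qed (use d in simp)

text \<open>Replacing the \<open>m + 1\<close> factors one at a time accounts for the constant
  \<open>Suc m\<close>.\<close>

lemma cpow_diff_L1:
  fixes f g :: "real^'n::finite \<Rightarrow> 'b::{real_normed_field, banach, second_countable_topology}"
  assumes f: "bdd_integrable M f" and g: "bdd_integrable M g"
    and fR: "(\<integral>x. norm (f x) \<partial>dual_measure M) \<le> R" and gR: "(\<integral>x. norm (g x) \<partial>dual_measure M) \<le> R"
  shows "(\<integral>x. norm (cpow M m f x - cpow M m g x) \<partial>dual_measure M)
     \<le> real (Suc m) * fourier_const TYPE('n) ^ m * R ^ m * (\<integral>x. norm (f x - g x) \<partial>dual_measure M)"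
proof (induction m)
  case (Suc m)
  let ?m = "dual_measure M :: (real^'n) measure" and ?c = "fourier_const TYPE('n)"
  let ?D = "\<integral>x. norm (f x - g x) \<partial>?m"
  have c: "0 \<le> ?c" by (rule less_imp_le[OF fourier_const_pos])
  have R0: "0 \<le> R" by (rule order_trans[OF _ fR]) simp
  note bi = f g bdd_integrable_cpow bdd_integrable_diff
  let ?a = "convolution M (\<lambda>x. f x - g x) (cpow M m f)" and ?b = "convolution M g (\<lambda>x. cpow M m f x - cpow M m g x)"
  have ab: "integrable ?m ?a" "integrable ?m ?b" by (intro bdd_integrableD(1) bdd_integrable_convolution bi)+
  have "(\<integral>x. norm (cpow M (Suc m) f x - cpow M (Suc m) g x) \<partial>?m) \<le> (\<integral>x. norm (?a x) + norm (?b x) \<partial>?m)"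
  proof (rule integral_mono)
    show "integrable ?m (\<lambda>x. norm (cpow M (Suc m) f x - cpow M (Suc m) g x))"
      by (intro integrable_norm bdd_integrableD(1) bi)
    show "norm (cpow M (Suc m) f x - cpow M (Suc m) g x) \<le> norm (?a x) + norm (?b x)" if "x \<in> space ?m" for x
    proof -
      have "cpow M (Suc m) f x - cpow M (Suc m) g x = ?a x + ?b x"
        using that by (simp add: convolution_diff_left convolution_diff_right bi)
      then show ?thesis by (simp only: norm_triangle_ineq)
    qed
  qed (use ab in auto)
  also have "\<dots> = (\<integral>x. norm (?a x) \<partial>?m) + (\<integral>x. norm (?b x) \<partial>?m)" using ab by simp
  also have "\<dots> \<le> ?c * ?D * (\<integral>x. norm (cpow M m f x) \<partial>?m) + ?c * (\<integral>x. norm (g x) \<partial>?m) * (\<integral>x. norm (cpow M m f x - cpow M m g x) \<partial>?m)"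
    by (intro add_mono bdd_integrable_convolution(2) bi)
  also have "\<dots> \<le> ?c * ?D * (?c ^ m * R ^ Suc m) + ?c * R * (real (Suc m) * ?c ^ m * R ^ m * ?D)"
    by (intro add_mono mult_mono Suc gR cpow_L1_bound[OF f fR] mult_left_mono mult_nonneg_nonneg) (use c R0 in auto)
  also have "\<dots> = real (Suc (Suc m)) * ?c ^ Suc m * R ^ Suc m * ?D"
    by (simp add: algebra_simps)
  finally show ?case .
qed simp

lemma cpow_measurable_param:
  assumes "(\<lambda>p. F (fst p) (snd p)) \<in> borel_measurable (N \<Otimes>\<^sub>M dual_measure M)"
  shows "(\<lambda>p. cpow M m (F (fst p)) (snd p)) \<in> borel_measurable (N \<Otimes>\<^sub>M dual_measure M)"
proof (induction m)
  case (Suc m)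
  from convolution_measurable_param[of F N M "\<lambda>t. cpow M m (F t)", OF assms Suc] show ?case by simp
qed (simp add: assms)

lemma cpow_nonneg:
  fixes A :: "real^'n::finite \<Rightarrow> real"
  assumes "bdd_integrable M A" "\<And>x. x \<in> space (dual_measure M) \<Longrightarrow> 0 \<le> A x" "x \<in> space (dual_measure M)"
  shows "0 \<le> cpow M m A x"
  by (rule order_trans[OF norm_ge_zero cpow_norm_le[OF assms(1,1) _ assms(3)]]) (simp add: assms(2))

text \<open>Pointwise convergence passes through the convolution integrals by dominated convergence,
  with the power of the common majorant \<open>A\<close> as dominating function.\<close>

lemma cpow_tendsto:
  fixes f :: "real^'n::finite \<Rightarrow> 'b::{real_normed_field, banach, second_countable_topology}"
  assumes F: "\<And>n. bdd_integrable M (F n)" and f: "bdd_integrable M f" and A: "bdd_integrable M A"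
    and FA: "\<And>n x. x \<in> space (dual_measure M) \<Longrightarrow> norm (F n x) \<le> A x"
    and lim: "\<And>x. x \<in> space (dual_measure M) \<Longrightarrow> (\<lambda>n. F n x) \<longlonglongrightarrow> f x"
    and x: "x \<in> space (dual_measure M)"
  shows "(\<lambda>n. cpow M m (F n) x) \<longlonglongrightarrow> cpow M m f x"
  using x
proof (induction m arbitrary: x)
  case (Suc m)
  let ?m = "dual_measure M :: (real^'n) measure"
  have "(\<lambda>n. \<integral>y. F n (x - y) * cpow M m (F n) y \<partial>?m) \<longlonglongrightarrow> (\<integral>y. f (x - y) * cpow M m f y \<partial>?m)"
  proof (rule integral_dominated_convergence[where w="\<lambda>y. A (x - y) * cpow M m A y"])
    show "(\<lambda>y. f (x - y) * cpow M m f y) \<in> borel_measurable ?m" "(\<lambda>y. F n (x - y) * cpow M m (F n) y) \<in> borel_measurable ?m" for n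
      using convolution_integrable[OF f bdd_integrable_cpow[OF f] Suc.prems] convolution_integrable[OF F bdd_integrable_cpow[OF F] Suc.prems] by auto
    show "integrable ?m (\<lambda>y. A (x - y) * cpow M m A y)"
      by (rule convolution_integrable[OF A bdd_integrable_cpow[OF A] Suc.prems])
    show "AE y in ?m. (\<lambda>n. F n (x - y) * cpow M m (F n) y) \<longlonglongrightarrow> f (x - y) * cpow M m f y"
      by (intro AE_I2 tendsto_mult lim Suc.IH space_dual_diff Suc.prems)
    show "AE y in ?m. norm (F n (x - y) * cpow M m (F n) y) \<le> A (x - y) * cpow M m A y" for n
      using Suc.prems by (auto simp: norm_mult intro!: AE_I2 mult_mono FA space_dual_diff cpow_norm_le[OF F A] order_trans[OF norm_ge_zero FA])
  qed
  then show ?case by (simp add: convolution_def tendsto_mult_left)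
qed (use lim in simp)

section \<open>Local well-posedness by Picard iteration\<close>

lemma abs_sin_diff_le: "\<bar>sin a - sin b\<bar> \<le> \<bar>a - b\<bar>" for a b :: real
proof -
  have "\<bar>sin a - sin b\<bar> = 2 * \<bar>sin ((a - b) / 2)\<bar> * \<bar>cos ((a + b) / 2)\<bar>"
    by (simp add: sin_diff_sin abs_mult)
  also have "\<dots> \<le> 2 * \<bar>(a - b) / 2\<bar> * 1"
    by (intro mult_mono abs_sin_x_le_abs_x) auto
  finally show ?thesis by simp
qed

lemma abs_cos_diff_le: "\<bar>cos a - cos b\<bar> \<le> \<bar>a - b\<bar>" for a b :: real
  using abs_sin_diff_le[of "pi / 2 - a" "pi / 2 - b"] by (simp add: cos_sin_eq)

text \<open>The time derivative of \<open>sin (t r) / r\<close> is \<open>cos (t r)\<close>, so the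
  Lipschitz constant is \<open>1\<close> at every frequency. With \<open>s = 0\<close> this becomes
  the bound by \<open>\<bar>t\<bar>\<close>, one source of the powers of \<open>T\<close>
  below.\<close>

lemma abs_wave_symbol_diff_le: "\<bar>wave_symbol t r - wave_symbol s r\<bar> \<le> \<bar>t - s\<bar>"
proof (cases "r = 0")
  case False
  have "\<bar>sin (t * r) - sin (s * r)\<bar> \<le> \<bar>t * r - s * r\<bar>"
    by (rule abs_sin_diff_le)
  then show ?thesis using False
    by (simp add: wave_symbol_def diff_divide_distrib[symmetric] abs_divide divide_le_eq abs_mult[symmetric] algebra_simps)
qed (simp add: wave_symbol_def)

lemma wave_symbol_0 [simp]: "wave_symbol 0 r = 0"
  by (simp add: wave_symbol_def)

lemma abs_wave_symbol_le: "\<bar>wave_symbol t r\<bar> \<le> \<bar>t\<bar>"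
  using abs_wave_symbol_diff_le[of t r 0] by simp

lemma wave_symbol_measurable [measurable]:
  "(\<lambda>p. wave_symbol (fst p) (snd p)) \<in> borel_measurable (borel \<Otimes>\<^sub>M borel)"
  unfolding wave_symbol_def by measurable

lemma wave_symbol_measurable' [measurable (raw)]:
  "f \<in> borel_measurable N \<Longrightarrow> g \<in> borel_measurable N \<Longrightarrow> (\<lambda>x. wave_symbol (f x) (g x)) \<in> borel_measurable N"
  using measurable_compose[OF measurable_Pair wave_symbol_measurable, of f N g] by simp

lemma norm_dual_measurable [measurable]: "norm \<in> borel_measurable (dual_measure M)"
  by (rule borel_measurable_dual) simp

lemma norm_dual_measurable' [measurable (raw)]: "f \<in> N \<rightarrow>\<^sub>M dual_measure M \<Longrightarrow> (\<lambda>x. norm (f x)) \<in> borel_measurable N"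
  by (rule measurable_compose[OF _ norm_dual_measurable])

lemma integrable_indicator_Icc [simp]: "integrable lborel (indicator {a..b::real} :: _ \<Rightarrow> real)"
  by (simp add: integrable_indicator_iff emeasure_lborel_Icc_eq)

lemma time_integral_bound:
  fixes F :: "real \<Rightarrow> 'b::{banach, second_countable_topology}"
  assumes "0 \<le> t" and F: "\<And>t'. t' \<in> {0..t} \<Longrightarrow> norm (F t') \<le> B"
  shows "norm (LINT t':{0..t}|lborel. F t') \<le> t * B"
proof -
  have B: "0 \<le> B" using order_trans[OF norm_ge_zero F[of 0]] assms(1) by simp
  have "norm (LINT t':{0..t}|lborel. F t') \<le> (\<integral>t'. norm (indicator {0..t} t' *\<^sub>R F t') \<partial>lborel)"
    unfolding set_lebesgue_integral_def by (rule integral_norm_bound)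
  also have "\<dots> \<le> (\<integral>t'. indicator {0..t} t' * B \<partial>lborel)"
    by (rule integral_mono'[OF integrable_mult_left[OF integrable_indicator_Icc]]) (use F B in \<open>auto simp: indicator_def\<close>)
  also have "\<dots> = t * B" using assms(1) by simp
  finally show ?thesis .
qed

lemma time_integrable:
  fixes F :: "real \<Rightarrow> 'b::{banach, second_countable_topology}"
  assumes [measurable]: "F \<in> borel_measurable borel" and F: "\<And>t'. t' \<in> {0..t} \<Longrightarrow> norm (F t') \<le> B"
  shows "set_integrable lborel {0..t} F"
  unfolding set_integrable_def
proof (rule Bochner_Integration.integrable_bound)
  show "integrable lborel (\<lambda>t'. indicator {0..t} t' * B)"
    by (rule integrable_mult_left[OF integrable_indicator_Icc])
  show "AE t' in lborel. norm (indicator {0..t} t' *\<^sub>R F t') \<le> norm (indicator {0..t} t' * B)"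
    using order_trans[OF F abs_ge_self] by (intro AE_I2) (auto simp: indicator_def)
qed measurable

lemma inv_fourier_cong:
  "(\<And>\<xi>. \<xi> \<in> space (dual_measure M) \<Longrightarrow> f \<xi> = g \<xi>) \<Longrightarrow> inv_fourier M f = inv_fourier M g"
  unfolding inv_fourier_def by (auto intro!: ext Bochner_Integration.integral_cong)

text \<open>Everything lives on the frequency side: \<open>v0\<close> and \<open>v1\<close> are
  transforms of the data, and \<open>m + 1\<close> is the power in the nonlinearity. In
  \<open>small\<close>, one \<open>T\<close> is the length of the time interval and the other bounds
  the propagator; with the data size \<open>G\<close> introduced below, the condition makes the
  \<open>L^1\<close> ball of radius \<open>2 * G\<close> stable under the iteration. The bounded
  frequency support of \<open>v0\<close> serves continuity in time.\<close>

locale picard =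
  fixes M :: manifold and m :: nat and \<sigma> T :: real and v0 v1 :: "real^'n::finite \<Rightarrow> complex" and R :: real
  assumes sigma: "\<bar>\<sigma>\<bar> = 1" and T: "0 < T"
    and v0: "bdd_integrable M v0" and v1: "bdd_integrable M v1"
    and v0_supp: "\<And>\<xi>. \<xi> \<in> space (dual_measure M) \<Longrightarrow> R < norm \<xi> \<Longrightarrow> v0 \<xi> = 0"
    and small: "T\<^sup>2 * fourier_const TYPE('n) ^ m * (2 * (\<integral>\<xi>. cmod (v0 \<xi>) + T * cmod (v1 \<xi>) \<partial>dual_measure M)) ^ m \<le> 1 / 2"
begin

section \<open>Free evolution and the scalar majorant sequence\<close>

abbreviation "mu \<equiv> dual_measure M :: (real^'n) measure"

definition free :: "real \<Rightarrow> real^'n \<Rightarrow> complex"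
  where "free t \<xi> = of_real (cos (t * norm \<xi>)) * v0 \<xi> + of_real (wave_symbol t (norm \<xi>)) * v1 \<xi>"

definition g :: "real^'n \<Rightarrow> real"
  where "g \<xi> = cmod (v0 \<xi>) + T * cmod (v1 \<xi>)"

definition G :: real where "G = (\<integral>\<xi>. g \<xi> \<partial>mu)"

lemma g: "bdd_integrable M g"
  unfolding g_def by (intro bdd_integrable_add bdd_integrable_cmult bdd_integrable_norm v0 v1)

lemma g_nonneg: "0 \<le> g \<xi>"
  using T by (simp add: g_def)

lemma G_nonneg: "0 \<le> G"
  unfolding G_def using g_nonneg by simp

lemma small_G: "T\<^sup>2 * (fourier_const TYPE('n) ^ m * (2 * G) ^ m) \<le> 1 / 2"
  using small by (simp add: G_def g_def mult.assoc)

lemma free_le: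
  assumes "t \<in> {0..T}"
  shows "cmod (free t \<xi>) \<le> g \<xi>"
proof -
  have "cmod (free t \<xi>) \<le> \<bar>cos (t * norm \<xi>)\<bar> * cmod (v0 \<xi>) + \<bar>wave_symbol t (norm \<xi>)\<bar> * cmod (v1 \<xi>)"
    unfolding free_def by (rule order_trans[OF norm_triangle_ineq]) (simp add: norm_mult)
  also have "\<dots> \<le> 1 * cmod (v0 \<xi>) + T * cmod (v1 \<xi>)"
    using assms abs_wave_symbol_le[of t "norm \<xi>"] by (intro add_mono mult_right_mono) auto
  finally show ?thesis by (simp add: g_def)
qed

text \<open>The Picard iteration with signs, oscillation and time dependence removed. At each
  frequency it increases, and its increments dominate those of the true iterates, so convergence of
  the latter follows from monotone bounded convergence of real sequences instead of completeness of
  a function space.\<close>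

primrec majorant :: "nat \<Rightarrow> real^'n \<Rightarrow> real" where
  "majorant 0 = (\<lambda>\<xi>. 0)"
| "majorant (Suc n) = (\<lambda>\<xi>. g \<xi> + T\<^sup>2 * cpow M m (majorant n) \<xi>)"

lemma bdd_integrable_majorant: "bdd_integrable M (majorant n)"
proof (induction n)
  case 0
  show ?case by (auto simp: bdd_integrable_def intro: exI[of _ 0])
next
  case (Suc n)
  then show ?case by (auto intro!: bdd_integrable_add bdd_integrable_cmult bdd_integrable_cpow g)
qed

lemma majorant_nonneg: "\<xi> \<in> space mu \<Longrightarrow> 0 \<le> majorant n \<xi>"
  by (induction n arbitrary: \<xi>) (auto intro!: add_nonneg_nonneg mult_nonneg_nonneg g_nonneg cpow_nonneg bdd_integrable_majorant)

text \<open>If one term has mass at most \<open>2 * G\<close>, then \<open>small_G\<close> bounds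
  the mass of the nonlinear part of the next term by half of that, namely \<open>G\<close>, and the
  free part adds another \<open>G\<close>.\<close>

lemma majorant_L1: "(\<integral>\<xi>. norm (majorant n \<xi>) \<partial>mu) \<le> 2 * G"
proof (induction n)
  case (Suc n)
  have i: "integrable mu g" "integrable mu (cpow M m (majorant n))"
    using bdd_integrableD(1) g bdd_integrable_cpow[OF bdd_integrable_majorant] by blast+
  have nn: "0 \<le> cpow M m (majorant n) \<xi>" if "\<xi> \<in> space mu" for \<xi>
    using cpow_nonneg[OF bdd_integrable_majorant majorant_nonneg that] .
  have "(\<integral>\<xi>. norm (majorant (Suc n) \<xi>) \<partial>mu) = (\<integral>\<xi>. g \<xi> + T\<^sup>2 * norm (cpow M m (majorant n) \<xi>) \<partial>mu)"
    by (intro Bochner_Integration.integral_cong refl) (use nn g_nonneg in \<open>auto simp: abs_of_nonneg add_nonneg_nonneg\<close>)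
  also have "\<dots> = G + T\<^sup>2 * (\<integral>\<xi>. norm (cpow M m (majorant n) \<xi>) \<partial>mu)"
    using i by (simp add: G_def)
  also have "\<dots> \<le> G + T\<^sup>2 * (fourier_const TYPE('n) ^ m * (2 * G) ^ Suc m)"
    by (intro add_mono order_refl mult_left_mono cpow_L1_bound[OF bdd_integrable_majorant Suc]) simp
  also have "\<dots> = G + (T\<^sup>2 * (fourier_const TYPE('n) ^ m * (2 * G) ^ m)) * (2 * G)" by simp
  also have "\<dots> \<le> G + 1 / 2 * (2 * G)"
    using G_nonneg by (intro add_mono order_refl mult_right_mono small_G) auto
  finally show ?case by simp
qed (simp add: G_nonneg)

text \<open>The limit has to be finite at every frequency, which an \<open>L^1\<close> bound cannot
  give. The supremum bound closes under the same smallness condition because only one factor of the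
  power is measured in the supremum norm.\<close>

lemma majorant_bounded: "\<exists>S. \<forall>n. \<forall>\<xi>\<in>space mu. majorant n \<xi> \<le> S"
proof -
  obtain S where S: "0 \<le> S" "\<And>\<xi>. \<xi> \<in> space mu \<Longrightarrow> norm (g \<xi>) \<le> S" using bdd_integrable_bound[OF g] by blast
  have "norm (majorant n \<xi>) \<le> 2 * S" if "\<xi> \<in> space mu" for n \<xi>
    using that
  proof (induction n arbitrary: \<xi>)
    case (Suc n)
    have "norm (majorant (Suc n) \<xi>) \<le> norm (g \<xi>) + T\<^sup>2 * norm (cpow M m (majorant n) \<xi>)"
      using norm_triangle_ineq[of "g \<xi>" "T\<^sup>2 * cpow M m (majorant n) \<xi>"] by (simp add: abs_mult)
    also have "\<dots> \<le> S + T\<^sup>2 * (fourier_const TYPE('n) ^ m * (2 * G) ^ m * (2 * S))"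
      by (intro add_mono S Suc.prems mult_left_mono cpow_sup_bound[OF bdd_integrable_majorant majorant_L1 Suc.IH Suc.prems]) auto
    also have "\<dots> = S + (T\<^sup>2 * (fourier_const TYPE('n) ^ m * (2 * G) ^ m)) * (2 * S)" by simp
    also have "\<dots> \<le> S + 1 / 2 * (2 * S)"
      using S(1) by (intro add_mono order_refl mult_right_mono small_G) auto
    finally show ?case by simp
  qed (use S in simp)
  then have "majorant n \<xi> \<le> 2 * S" if "\<xi> \<in> space mu" for n \<xi>
    using that unfolding real_norm_def by (blast intro: order_trans[OF abs_ge_self])
  then show ?thesis by blast
qed

lemma majorant_Suc_ge: "\<xi> \<in> space mu \<Longrightarrow> majorant n \<xi> \<le> majorant (Suc n) \<xi>"
proof (induction n arbitrary: \<xi>)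
  case 0
  then show ?case using majorant_nonneg[of \<xi> "Suc 0"] by simp
next
  case (Suc n)
  have "cpow M m (majorant n) \<xi> \<le> cpow M m (majorant (Suc n)) \<xi>"
  proof (rule order_trans[OF abs_ge_self], unfold real_norm_def[symmetric], rule cpow_norm_le[OF bdd_integrable_majorant bdd_integrable_majorant _ Suc.prems])
    fix x assume x: "x \<in> space mu"
    have "norm (majorant n x) = majorant n x" using majorant_nonneg[OF x, of n] by simp
    then show "norm (majorant n x) \<le> majorant (Suc n) x" using Suc.IH[OF x] by (simp only:)
  qed
  then show ?case by (simp only: majorant.simps) (intro add_mono mult_left_mono, auto)
qed

definition majorant_lim :: "real^'n \<Rightarrow> real" where "majorant_lim \<xi> = lim (\<lambda>n. majorant n \<xi>)"

lemma majorant_incseq: "\<xi> \<in> space mu \<Longrightarrow> incseq (\<lambda>n. majorant n \<xi>)"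
  by (rule incseq_SucI) (rule majorant_Suc_ge)

lemma majorant_tendsto: "\<xi> \<in> space mu \<Longrightarrow> (\<lambda>n. majorant n \<xi>) \<longlonglongrightarrow> majorant_lim \<xi>"
proof -
  assume x: "\<xi> \<in> space mu"
  obtain S where "\<forall>n. majorant n \<xi> \<le> S" using majorant_bounded x by blast
  from incseq_convergent[OF majorant_incseq[OF x] this] show ?thesis
    unfolding majorant_lim_def using limI by blast
qed

lemma majorant_le_majorant_lim: "\<xi> \<in> space mu \<Longrightarrow> majorant n \<xi> \<le> majorant_lim \<xi>"
  by (rule incseq_le[OF majorant_incseq majorant_tendsto])

lemma majorant_lim_nonneg: "\<xi> \<in> space mu \<Longrightarrow> 0 \<le> majorant_lim \<xi>"
  using majorant_le_majorant_lim[of \<xi> 0] by simp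

lemma majorant_lim: "bdd_integrable M majorant_lim" "(\<integral>\<xi>. majorant_lim \<xi> \<partial>mu) \<le> 2 * G"
proof -
  have le: "(\<integral>\<xi>. majorant n \<xi> \<partial>mu) \<le> 2 * G" for n
    using majorant_L1[of n] majorant_nonneg[of _ n] by (auto cong: Bochner_Integration.integral_cong)
  have inc: "incseq (\<lambda>n. \<integral>\<xi>. majorant n \<xi> \<partial>mu)"
    by (rule incseq_SucI, rule integral_mono) (auto intro!: bdd_integrableD(1)[OF bdd_integrable_majorant] majorant_Suc_ge simp del: majorant.simps)
  obtain L where L: "(\<lambda>n. \<integral>\<xi>. majorant n \<xi> \<partial>mu) \<longlonglongrightarrow> L" "\<forall>n. (\<integral>\<xi>. majorant n \<xi> \<partial>mu) \<le> L"
    using incseq_convergent[OF inc, of "2 * G"] le by blast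
  have meas: "majorant_lim \<in> borel_measurable mu"
    by (rule borel_measurable_LIMSEQ_real[OF majorant_tendsto]) (auto intro: bdd_integrableD bdd_integrable_majorant)
  have "has_bochner_integral mu majorant_lim L"
    by (rule has_bochner_integral_monotone_convergence[OF bdd_integrableD(1)[OF bdd_integrable_majorant] _ _ L(1) meas])
       (auto intro!: AE_I2 incseqD majorant_incseq majorant_tendsto simp: mono_def)
  then have i: "integrable mu majorant_lim" "(\<integral>\<xi>. majorant_lim \<xi> \<partial>mu) = L" by (auto simp: has_bochner_integral_iff)
  obtain S where S: "\<And>n \<xi>. \<xi> \<in> space mu \<Longrightarrow> majorant n \<xi> \<le> S" using majorant_bounded by blast
  have "norm (majorant_lim \<xi>) \<le> S" if "\<xi> \<in> space mu" for \<xi>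
    using LIMSEQ_le_const2[OF majorant_tendsto[OF that], of S] S[OF that] majorant_lim_nonneg[OF that] by auto
  with i show "bdd_integrable M majorant_lim" unfolding bdd_integrable_def by blast
  show "(\<integral>\<xi>. majorant_lim \<xi> \<partial>mu) \<le> 2 * G"
    using LIMSEQ_le_const2[OF L(1), of "2 * G"] le i by auto
qed

section \<open>The Duhamel operator and its measurability\<close>

definition duhamel :: "(real \<Rightarrow> real^'n \<Rightarrow> complex) \<Rightarrow> real \<Rightarrow> real^'n \<Rightarrow> complex"
  where "duhamel V t \<xi> = (LINT t':{0..t}|lborel. of_real (wave_symbol (t - t') (norm \<xi>)) * cpow M m (V t') \<xi>)"

lemma cpow_time_measurable:
  assumes V: "(\<lambda>p. V (fst p) (snd p)) \<in> borel_measurable (borel \<Otimes>\<^sub>M mu)" and x: "\<xi> \<in> space mu"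
  shows "(\<lambda>t'. cpow M m (V t') \<xi> :: complex) \<in> borel_measurable borel"
  using measurable_compose[OF measurable_Pair2'[OF x] cpow_measurable_param[OF V, of m]] by simp

lemma duhamel_integrand_measurable:
  assumes V: "(\<lambda>p. V (fst p) (snd p)) \<in> borel_measurable (borel \<Otimes>\<^sub>M mu)" and x: "\<xi> \<in> space mu"
  shows "(\<lambda>t'. of_real (wave_symbol (t - t') (norm \<xi>)) * cpow M m (V t') \<xi> :: complex) \<in> borel_measurable borel"
  using cpow_time_measurable[OF assms] by measurable

lemma duhamel_measurable:
  assumes V: "(\<lambda>p. V (fst p) (snd p)) \<in> borel_measurable (borel \<Otimes>\<^sub>M mu)"
  shows "(\<lambda>p. duhamel V (fst p) (snd p)) \<in> borel_measurable (borel \<Otimes>\<^sub>M mu)"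
proof -
  have 1: "(\<lambda>q. cpow M m (V (snd q)) (snd (fst q)) :: complex) \<in> borel_measurable ((borel \<Otimes>\<^sub>M mu) \<Otimes>\<^sub>M lborel)"
  proof -
    have "(\<lambda>q. (snd q, snd (fst q))) \<in> (borel \<Otimes>\<^sub>M mu) \<Otimes>\<^sub>M lborel \<rightarrow>\<^sub>M borel \<Otimes>\<^sub>M mu"
      by measurable
    from measurable_compose[OF this cpow_measurable_param[OF V, of m]] show ?thesis by simp
  qed
  \<comment> \<open>The domain \<open>{0..t}\<close> moves with the parameter, so its indicator is
    made part of the jointly measurable integrand.\<close>
  have "(\<lambda>q. (if 0 \<le> snd q \<and> snd q \<le> fst (fst q) then 1 else 0 :: real) *\<^sub>R (of_real (wave_symbol (fst (fst q) - snd q) (norm (snd (fst q)))) * cpow M m (V (snd q)) (snd (fst q))) :: complex) \<in> borel_measurable ((borel \<Otimes>\<^sub>M mu) \<Otimes>\<^sub>M lborel)"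
    using 1 by measurable
  then have "(\<lambda>p. \<integral>t'. (if 0 \<le> t' \<and> t' \<le> fst p then 1 else 0 :: real) *\<^sub>R (of_real (wave_symbol (fst p - t') (norm (snd p))) * cpow M m (V t') (snd p)) \<partial>lborel :: complex) \<in> borel_measurable (borel \<Otimes>\<^sub>M mu)"
    by (intro lborel.borel_measurable_lebesgue_integral) (simp only: case_prod_beta')
  then show ?thesis by (simp only: duhamel_def set_lebesgue_integral_def indicator_def atLeastAtMost_iff of_bool_def)
qed

lemma duhamel_integrand_le:
  assumes V: "\<And>t. t \<in> {0..T} \<Longrightarrow> bdd_integrable M (V t)" and A: "bdd_integrable M A"
    and VA: "\<And>t \<xi>. t \<in> {0..T} \<Longrightarrow> \<xi> \<in> space mu \<Longrightarrow> cmod (V t \<xi>) \<le> A \<xi>"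
    and t: "t \<in> {0..T}" "t' \<in> {0..t}" and x: "\<xi> \<in> space mu"
  shows "cmod (of_real (wave_symbol (t - t') (norm \<xi>)) * cpow M m (V t') \<xi>) \<le> T * cpow M m A \<xi>"
  unfolding norm_mult
proof (rule mult_mono)
  show "cmod (of_real (wave_symbol (t - t') (norm \<xi>))) \<le> T"
    using t abs_wave_symbol_le[of "t - t'" "norm \<xi>"] by auto
  show "cmod (cpow M m (V t') \<xi>) \<le> cpow M m A \<xi>"
    using t by (intro cpow_norm_le V A VA x) auto
qed (use T in auto)

section \<open>Picard iterates and their limit\<close>

primrec U :: "nat \<Rightarrow> real \<Rightarrow> real^'n \<Rightarrow> complex" where
  "U 0 = (\<lambda>t \<xi>. 0)"
| "U (Suc n) = (\<lambda>t \<xi>. free t \<xi> + of_real \<sigma> * duhamel (U n) t \<xi>)"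

lemma free_measurable: "(\<lambda>p. free (fst p) (snd p)) \<in> borel_measurable (borel \<Otimes>\<^sub>M mu)"
proof -
  have [measurable]: "v0 \<in> borel_measurable mu" "v1 \<in> borel_measurable mu"
    using bdd_integrableD(2) v0 v1 by blast+
  show ?thesis unfolding free_def by measurable
qed

lemma U_measurable: "(\<lambda>p. U n (fst p) (snd p)) \<in> borel_measurable (borel \<Otimes>\<^sub>M mu)"
proof (induction n)
  case (Suc n)
  note [measurable] = duhamel_measurable[OF Suc] free_measurable
  show ?case by simp
qed simp

lemma section_measurable:
  assumes V: "(\<lambda>p. V (fst p) (snd p) :: complex) \<in> borel_measurable (borel \<Otimes>\<^sub>M mu)"
  shows "V t \<in> borel_measurable mu"
  using measurable_compose[OF measurable_Pair1'[of t borel] V] by simp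

lemma bdd_integrable_section:
  assumes "(\<lambda>p. V (fst p) (snd p) :: complex) \<in> borel_measurable (borel \<Otimes>\<^sub>M mu)"
    and "bdd_integrable M A" "\<And>\<xi>. \<xi> \<in> space mu \<Longrightarrow> cmod (V t \<xi>) \<le> A \<xi>"
  shows "bdd_integrable M (V t)"
  by (rule bdd_integrable_dominated[OF assms(2) section_measurable[OF assms(1)]]) (use assms(3) in force)

lemma U_le: "t \<in> {0..T} \<Longrightarrow> \<xi> \<in> space mu \<Longrightarrow> cmod (U n t \<xi>) \<le> majorant n \<xi>"
proof (induction n arbitrary: t \<xi>)
  case (Suc n)
  have bi: "bdd_integrable M (U n t)" if "t \<in> {0..T}" for t
    by (rule bdd_integrable_section[OF U_measurable bdd_integrable_majorant[of n]]) (rule Suc.IH[OF that])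
  have "cmod (duhamel (U n) t \<xi>) \<le> t * (T * cpow M m (majorant n) \<xi>)"
    unfolding duhamel_def
    using Suc.prems by (intro time_integral_bound duhamel_integrand_le bi bdd_integrable_majorant Suc.IH) auto
  also have "\<dots> \<le> T * (T * cpow M m (majorant n) \<xi>)"
    using Suc.prems T by (intro mult_right_mono mult_nonneg_nonneg cpow_nonneg bdd_integrable_majorant majorant_nonneg) auto
  finally have d: "cmod (duhamel (U n) t \<xi>) \<le> T\<^sup>2 * cpow M m (majorant n) \<xi>" by (simp add: power2_eq_square)
  have "cmod (U (Suc n) t \<xi>) \<le> cmod (free t \<xi>) + cmod (of_real \<sigma> * duhamel (U n) t \<xi>)"
    by (simp add: norm_triangle_ineq)
  also have "\<dots> \<le> g \<xi> + T\<^sup>2 * cpow M m (majorant n) \<xi>"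
    using d sigma by (intro add_mono free_le Suc.prems) (simp add: norm_mult)
  finally show ?case by simp
qed simp

lemma bdd_integrable_U: "t \<in> {0..T} \<Longrightarrow> bdd_integrable M (U n t)"
  by (rule bdd_integrable_section[OF U_measurable bdd_integrable_majorant[of n]]) (rule U_le)

text \<open>The comparison of power differences, integrated in time, reproduces the increment of the
  majorant: \<open>\<sigma>\<close> has modulus one, one factor \<open>T\<close> bounds the interval
  and the other the propagator.\<close>

lemma U_diff_le: "t \<in> {0..T} \<Longrightarrow> \<xi> \<in> space mu \<Longrightarrow> cmod (U (Suc n) t \<xi> - U n t \<xi>) \<le> majorant (Suc n) \<xi> - majorant n \<xi>"
proof (induction n arbitrary: t \<xi>)
  case 0
  then show ?case using U_le[of t \<xi> "Suc 0"] by simp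
next
  case (Suc n)
  let ?w = "\<lambda>t'. complex_of_real (wave_symbol (t - t') (norm \<xi>))"
  let ?D = "cpow M m (majorant (Suc n)) \<xi> - cpow M m (majorant n) \<xi>"
  have i: "set_integrable lborel {0..t} (\<lambda>t'. ?w t' * cpow M m (U j t') \<xi>)" for j
    by (rule time_integrable[OF duhamel_integrand_measurable[OF U_measurable Suc.prems(2)]])
       (rule duhamel_integrand_le[OF bdd_integrable_U bdd_integrable_majorant U_le Suc.prems(1) _ Suc.prems(2)])
  have D: "cmod (cpow M m (U (Suc n) t') \<xi> - cpow M m (U n t') \<xi>) \<le> ?D" if "t' \<in> {0..t}" for t'
  proof -
    have t': "t' \<in> {0..T}" using that Suc.prems by auto
    show ?thesis
      by (rule cpow_diff_le[OF bdd_integrable_U[OF t'] bdd_integrable_U[OF t'] bdd_integrable_majorant bdd_integrable_majorant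
          U_le[OF t'] U_le[OF t'] Suc.IH[OF t'] Suc.prems(2)])
  qed
  have "duhamel (U (Suc n)) t \<xi> - duhamel (U n) t \<xi> = (LINT t':{0..t}|lborel. ?w t' * (cpow M m (U (Suc n) t') \<xi> - cpow M m (U n t') \<xi>))"
    unfolding duhamel_def by (subst set_integral_diff(2)[OF i i, symmetric]) (simp only: right_diff_distrib)
  also have "cmod \<dots> \<le> t * (T * ?D)"
  proof (rule time_integral_bound)
    fix t' assume t': "t' \<in> {0..t}"
    have "\<bar>wave_symbol (t - t') (norm \<xi>)\<bar> \<le> T"
      using t' Suc.prems abs_wave_symbol_le[of "t - t'" "norm \<xi>"] by auto
    then show "cmod (?w t' * (cpow M m (U (Suc n) t') \<xi> - cpow M m (U n t') \<xi>)) \<le> T * ?D"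
      unfolding norm_mult norm_of_real using T by (intro mult_mono D t') auto
  qed (use Suc.prems in auto)
  also have "\<dots> \<le> T * (T * ?D)"
    using Suc.prems T order_trans[OF norm_ge_zero D[of 0]] by (intro mult_right_mono mult_nonneg_nonneg) auto
  finally have d: "cmod (duhamel (U (Suc n)) t \<xi> - duhamel (U n) t \<xi>) \<le> T\<^sup>2 * ?D" by (simp add: power2_eq_square)
  have "U (Suc (Suc n)) t \<xi> - U (Suc n) t \<xi> = of_real \<sigma> * (duhamel (U (Suc n)) t \<xi> - duhamel (U n) t \<xi>)"
    by (simp only: U.simps right_diff_distrib) simp
  then have "cmod (U (Suc (Suc n)) t \<xi> - U (Suc n) t \<xi>) = cmod (duhamel (U (Suc n)) t \<xi> - duhamel (U n) t \<xi>)"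
    using sigma by (simp only: norm_mult norm_of_real mult_1)
  also note d
  also have "T\<^sup>2 * ?D = majorant (Suc (Suc n)) \<xi> - majorant (Suc n) \<xi>"
    by (simp only: majorant.simps right_diff_distrib)
  finally show ?case .
qed

definition V :: "real \<Rightarrow> real^'n \<Rightarrow> complex" where "V t \<xi> = lim (\<lambda>n. U n t \<xi>)"

lemma U_tendsto: "t \<in> {0..T} \<Longrightarrow> \<xi> \<in> space mu \<Longrightarrow> (\<lambda>n. U n t \<xi>) \<longlonglongrightarrow> V t \<xi>"
proof -
  assume t: "t \<in> {0..T}" and x: "\<xi> \<in> space mu"
  \<comment> \<open>The increments of the majorant form a convergent telescoping series and dominate
    those of the iterates.\<close>
  have "summable (\<lambda>n. U (Suc n) t \<xi> - U n t \<xi>)"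
    by (rule summable_comparison_test[OF _ telescope_summable[OF majorant_tendsto[OF x]]])
       (use U_diff_le[OF t x] in blast)
  then have "convergent (\<lambda>n. \<Sum>i<n. U (Suc i) t \<xi> - U i t \<xi>)" by (simp add: summable_iff_convergent)
  moreover have "(\<Sum>i<n. U (Suc i) t \<xi> - U i t \<xi>) = U n t \<xi>" for n
    using sum_lessThan_telescope[of "\<lambda>n. U n t \<xi>" n] by (simp del: U.simps(2))
  ultimately have "convergent (\<lambda>n. U n t \<xi>)" by (simp only:)
  then show ?thesis unfolding V_def by (simp add: convergent_LIMSEQ_iff)
qed

lemma V_measurable: "(\<lambda>p. V (fst p) (snd p)) \<in> borel_measurable (borel \<Otimes>\<^sub>M mu)"
  unfolding V_def by (rule borel_measurable_lim_metric) (rule U_measurable)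

lemma U_le_majorant_lim: "t \<in> {0..T} \<Longrightarrow> \<xi> \<in> space mu \<Longrightarrow> cmod (U n t \<xi>) \<le> majorant_lim \<xi>"
  by (rule order_trans[OF U_le majorant_le_majorant_lim])

lemma V_le: "t \<in> {0..T} \<Longrightarrow> \<xi> \<in> space mu \<Longrightarrow> cmod (V t \<xi>) \<le> majorant_lim \<xi>"
  by (rule LIMSEQ_le_const2[OF tendsto_norm[OF U_tendsto]]) (assumption | intro exI allI impI U_le_majorant_lim)+

lemma bdd_integrable_V: "t \<in> {0..T} \<Longrightarrow> bdd_integrable M (V t)"
  by (rule bdd_integrable_section[OF V_measurable majorant_lim(1)]) (rule V_le)

lemma V_L1: "t \<in> {0..T} \<Longrightarrow> (\<integral>\<xi>. cmod (V t \<xi>) \<partial>mu) \<le> 2 * G"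
  by (rule order_trans[OF integral_mono majorant_lim(2)])
     (auto intro: integrable_norm[OF bdd_integrableD(1)[OF bdd_integrable_V]] bdd_integrableD(1)[OF majorant_lim(1)] V_le)

text \<open>The recursion passes to the limit by dominated convergence in time, the integrands being
  bounded by \<open>T * cpow M m majorant_lim \<xi>\<close> for all \<open>n\<close>.\<close>

lemma V_eq:
  assumes t: "t \<in> {0..T}" and x: "\<xi> \<in> space mu"
  shows "V t \<xi> = free t \<xi> + of_real \<sigma> * duhamel V t \<xi>"
proof -
  let ?w = "\<lambda>t'. complex_of_real (wave_symbol (t - t') (norm \<xi>))"
  have "(\<lambda>n. duhamel (U n) t \<xi>) \<longlonglongrightarrow> duhamel V t \<xi>"
    unfolding duhamel_def set_lebesgue_integral_def
  proof (rule integral_dominated_convergence[where w="\<lambda>t'. indicator {0..t} t' * (T * cpow M m majorant_lim \<xi>)"])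
    show "(\<lambda>t'. indicator {0..t} t' *\<^sub>R (?w t' * cpow M m (V t') \<xi>)) \<in> borel_measurable lborel"
      "(\<lambda>t'. indicator {0..t} t' *\<^sub>R (?w t' * cpow M m (U n t') \<xi>)) \<in> borel_measurable lborel" for n
      using duhamel_integrand_measurable[OF V_measurable x] duhamel_integrand_measurable[OF U_measurable x] by measurable
    show "AE t' in lborel. (\<lambda>n. indicator {0..t} t' *\<^sub>R (?w t' * cpow M m (U n t') \<xi>)) \<longlonglongrightarrow> indicator {0..t} t' *\<^sub>R (?w t' * cpow M m (V t') \<xi>)"
    proof (rule AE_I2)
      fix t'
      show "(\<lambda>n. indicator {0..t} t' *\<^sub>R (?w t' * cpow M m (U n t') \<xi>)) \<longlonglongrightarrow> indicator {0..t} t' *\<^sub>R (?w t' * cpow M m (V t') \<xi>)"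
      proof (cases "t' \<in> {0..t}")
        case True
        then have t': "t' \<in> {0..T}" using t by auto
        show ?thesis
          by (intro tendsto_scaleR tendsto_mult tendsto_const cpow_tendsto[OF bdd_integrable_U[OF t'] bdd_integrable_V[OF t'] majorant_lim(1) U_le_majorant_lim[OF t'] U_tendsto[OF t'] x])
      qed simp
    qed
    show "AE t' in lborel. norm (indicator {0..t} t' *\<^sub>R (?w t' * cpow M m (U n t') \<xi>)) \<le> indicator {0..t} t' * (T * cpow M m majorant_lim \<xi>)" for n
    proof -
      have "norm (?w t' * cpow M m (U n t') \<xi>) \<le> T * cpow M m majorant_lim \<xi>" if "t' \<in> {0..t}" for t'
        by (rule duhamel_integrand_le[OF bdd_integrable_U majorant_lim(1) U_le_majorant_lim t that x])
      then show ?thesis by (intro AE_I2) (auto simp: indicator_def)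
    qed
  qed simp
  then have "(\<lambda>n. U (Suc n) t \<xi>) \<longlonglongrightarrow> free t \<xi> + of_real \<sigma> * duhamel V t \<xi>"
    by (auto intro!: tendsto_intros)
  from LIMSEQ_unique[OF LIMSEQ_Suc[OF U_tendsto[OF t x]] this] show ?thesis .
qed

lemma V_0: "\<xi> \<in> space mu \<Longrightarrow> V 0 \<xi> = v0 \<xi>"
proof -
  assume x: "\<xi> \<in> space mu"
  have "cmod (duhamel V 0 \<xi>) \<le> 0 * (T * cpow M m majorant_lim \<xi>)"
    unfolding duhamel_def using T
    by (intro time_integral_bound duhamel_integrand_le bdd_integrable_V majorant_lim V_le x) auto
  then show ?thesis using V_eq[OF _ x, of 0] T by (simp add: free_def)
qed

text \<open>A Lipschitz constant in time, frequency by frequency. Its three terms come from the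
  cosine, the free velocity part and the Duhamel integral; the first is integrable because
  \<open>v0\<close> is supported in a ball.\<close>

definition lip :: "real^'n \<Rightarrow> real"
  where "lip \<xi> = norm \<xi> * cmod (v0 \<xi>) + cmod (v1 \<xi>) + T * cpow M m majorant_lim \<xi>"

lemma integrable_lip: "integrable mu lip"
proof -
  have "integrable mu (\<lambda>\<xi>. norm \<xi> * cmod (v0 \<xi>))"
  proof (rule Bochner_Integration.integrable_bound[where f="\<lambda>\<xi>. R * cmod (v0 \<xi>)"])
    have [measurable]: "v0 \<in> borel_measurable mu" using bdd_integrableD(2) v0 by blast
    show "(\<lambda>\<xi>. norm \<xi> * cmod (v0 \<xi>)) \<in> borel_measurable mu" by measurable
    have "norm \<xi> * cmod (v0 \<xi>) \<le> \<bar>R\<bar> * cmod (v0 \<xi>)" if "\<xi> \<in> space mu" for \<xi>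
      using v0_supp[OF that] by (cases "R < norm \<xi>") (auto intro!: mult_right_mono)
    then show "AE \<xi> in mu. norm (norm \<xi> * cmod (v0 \<xi>)) \<le> norm (R * cmod (v0 \<xi>))"
      by (intro AE_I2) (auto simp: abs_mult)
  qed (use bdd_integrableD(1)[OF v0] in auto)
  then show ?thesis unfolding lip_def
    using bdd_integrableD(1)[OF bdd_integrable_norm[OF v1]] bdd_integrableD(1)[OF bdd_integrable_cpow[OF majorant_lim(1)]]
    by (intro Bochner_Integration.integrable_add integrable_mult_right)
qed

lemma V_lipschitz:
  assumes s: "s \<in> {0..T}" and t: "t \<in> {0..T}" and x: "\<xi> \<in> space mu"
  shows "cmod (V t \<xi> - V s \<xi>) \<le> \<bar>t - s\<bar> * lip \<xi>"
proof -
  let ?r = "norm \<xi>"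
  let ?F = "\<lambda>t'. cpow M m (V t') \<xi>"
  \<comment> \<open>For \<open>t' > t\<close> the truncated argument is \<open>0\<close>, where the
    symbol vanishes. Both Duhamel integrals thereby extend to the common interval
    \<open>{0..T}\<close> and can be subtracted under the integral sign.\<close>
  let ?w = "\<lambda>t t'. wave_symbol (max (t - t') 0) ?r"
  have ext: "duhamel V t \<xi> = (LINT t':{0..T}|lborel. of_real (?w t t') * ?F t')" if "t \<in> {0..T}" for t
    unfolding duhamel_def set_lebesgue_integral_def
    by (intro Bochner_Integration.integral_cong refl) (use that in \<open>auto simp: indicator_def max_def\<close>)
  have Fle: "cmod (?F t') \<le> cpow M m majorant_lim \<xi>" if "t' \<in> {0..T}" for t'
    by (rule cpow_norm_le[OF bdd_integrable_V[OF that] majorant_lim(1) V_le[OF that] x])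
  have [measurable]: "?F \<in> borel_measurable borel" by (rule cpow_time_measurable[OF V_measurable x])
  have i: "set_integrable lborel {0..T} (\<lambda>t'. of_real (?w t t') * ?F t')" if "t \<in> {0..T}" for t
  proof (rule time_integrable[where B="T * cpow M m majorant_lim \<xi>"])
    fix t' assume t': "t' \<in> {0..T}"
    have "\<bar>?w t t'\<bar> \<le> T"
      using t' that abs_wave_symbol_le[of "max (t - t') 0" ?r] by auto
    then show "cmod (of_real (?w t t') * ?F t') \<le> T * cpow M m majorant_lim \<xi>"
      unfolding norm_mult norm_of_real using T by (intro mult_mono Fle t') auto
  qed measurable
  have "duhamel V t \<xi> - duhamel V s \<xi> = (LINT t':{0..T}|lborel. (of_real (?w t t') - of_real (?w s t')) * ?F t')"
    unfolding ext[OF t] ext[OF s] by (subst set_integral_diff(2)[OF i[OF t] i[OF s], symmetric]) (simp only: left_diff_distrib)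
  also have "cmod \<dots> \<le> T * (\<bar>t - s\<bar> * cpow M m majorant_lim \<xi>)"
  proof (rule time_integral_bound)
    fix t' assume t': "t' \<in> {0..T}"
    have "\<bar>?w t t' - ?w s t'\<bar> \<le> \<bar>max (t - t') 0 - max (s - t') 0\<bar>" by (rule abs_wave_symbol_diff_le)
    also have "\<dots> \<le> \<bar>t - s\<bar>" by linarith
    finally show "cmod ((of_real (?w t t') - of_real (?w s t')) * ?F t') \<le> \<bar>t - s\<bar> * cpow M m majorant_lim \<xi>"
      unfolding norm_mult of_real_diff[symmetric] norm_of_real by (intro mult_mono Fle t') auto
  qed (use T in simp)
  finally have d: "cmod (duhamel V t \<xi> - duhamel V s \<xi>) \<le> \<bar>t - s\<bar> * (T * cpow M m majorant_lim \<xi>)" by (simp add: mult_ac)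
  have "cmod (free t \<xi> - free s \<xi>) \<le> \<bar>cos (t * ?r) - cos (s * ?r)\<bar> * cmod (v0 \<xi>) + \<bar>wave_symbol t ?r - wave_symbol s ?r\<bar> * cmod (v1 \<xi>)"
  proof -
    have "free t \<xi> - free s \<xi> = of_real (cos (t * ?r) - cos (s * ?r)) * v0 \<xi> + of_real (wave_symbol t ?r - wave_symbol s ?r) * v1 \<xi>"
      by (simp add: free_def algebra_simps)
    then show ?thesis
      by (simp only:) (rule order_trans[OF norm_triangle_ineq], simp only: norm_mult norm_of_real order_refl)
  qed
  also have "\<dots> \<le> (\<bar>t - s\<bar> * ?r) * cmod (v0 \<xi>) + \<bar>t - s\<bar> * cmod (v1 \<xi>)"
  proof (intro add_mono mult_right_mono abs_wave_symbol_diff_le)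
    have "\<bar>cos (t * ?r) - cos (s * ?r)\<bar> \<le> \<bar>t * ?r - s * ?r\<bar>" by (rule abs_cos_diff_le)
    then show "\<bar>cos (t * ?r) - cos (s * ?r)\<bar> \<le> \<bar>t - s\<bar> * ?r"
      by (simp add: left_diff_distrib[symmetric] abs_mult)
  qed auto
  finally have f: "cmod (free t \<xi> - free s \<xi>) \<le> (\<bar>t - s\<bar> * ?r) * cmod (v0 \<xi>) + \<bar>t - s\<bar> * cmod (v1 \<xi>)" .
  have "V t \<xi> - V s \<xi> = (free t \<xi> - free s \<xi>) + of_real \<sigma> * (duhamel V t \<xi> - duhamel V s \<xi>)"
    unfolding V_eq[OF t x] V_eq[OF s x] by (simp add: algebra_simps)
  also have "cmod \<dots> \<le> cmod (free t \<xi> - free s \<xi>) + cmod (duhamel V t \<xi> - duhamel V s \<xi>)"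
    by (rule order_trans[OF norm_triangle_ineq]) (simp add: norm_mult sigma)
  also have "\<dots> \<le> \<bar>t - s\<bar> * lip \<xi>" using f d by (simp add: lip_def algebra_simps)
  finally show ?thesis .
qed

text \<open>Fubini in time and frequency against a bounded weight. The character
  \<open>cis (x \<bullet> \<xi>)\<close> as weight yields the Duhamel formula at the point
  \<open>x\<close>; a low-frequency cutoff as weight yields the quantity whose growth is estimated
  later.\<close>

lemma duhamel_pairing:
  fixes e :: "real^'n \<Rightarrow> complex"
  assumes e [measurable]: "e \<in> borel_measurable mu" and e_le: "\<And>\<xi>. cmod (e \<xi>) \<le> 1" and t: "t \<in> {0..T}"
  defines "h \<equiv> \<lambda>t' \<xi>. e \<xi> * (of_real (wave_symbol (t - t') (norm \<xi>)) * cpow M m (V t') \<xi>)"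
  shows "set_integrable lborel {0..t} (\<lambda>t'. \<integral>\<xi>. h t' \<xi> \<partial>mu)"
    and "(LINT t':{0..t}|lborel. \<integral>\<xi>. h t' \<xi> \<partial>mu) = (\<integral>\<xi>. e \<xi> * duhamel V t \<xi> \<partial>mu)"
proof -
  interpret P: pair_sigma_finite "lborel :: real measure" mu
    by (intro pair_sigma_finite.intro sigma_finite_dual lborel.sigma_finite_measure_axioms)
  let ?H = "\<lambda>t' \<xi>. indicator {0..t} t' *\<^sub>R (h t' \<xi>)"
  have I: "integrable (lborel \<Otimes>\<^sub>M mu) (\<lambda>(t', \<xi>). ?H t' \<xi>)"
  proof (rule Bochner_Integration.integrable_bound)
    have "integrable lborel (\<lambda>t'. complex_of_real (indicator {0..t} t' * T))"
      by (intro integrable_of_real integrable_mult_left) simp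
    moreover have "integrable mu (\<lambda>\<xi>. complex_of_real (cpow M m majorant_lim \<xi>))"
      by (intro integrable_of_real bdd_integrableD(1) bdd_integrable_cpow majorant_lim)
    ultimately show "integrable (lborel \<Otimes>\<^sub>M mu) (\<lambda>(t', \<xi>). complex_of_real (indicator {0..t} t' * T) * complex_of_real (cpow M m majorant_lim \<xi>))"
      by (rule P.integrable_product_mult)
    have 1: "(\<lambda>p. cpow M m (V (fst p)) (snd p)) \<in> borel_measurable (lborel \<Otimes>\<^sub>M mu)"
    proof -
      have "sets (lborel \<Otimes>\<^sub>M mu) = sets (borel \<Otimes>\<^sub>M mu)" by (rule sets_pair_measure_cong) simp_all
      then have "borel_measurable (lborel \<Otimes>\<^sub>M mu) = (borel_measurable (borel \<Otimes>\<^sub>M mu) :: ((real \<times> (real^'n)) \<Rightarrow> complex) set)"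
        by (rule measurable_cong_sets) simp
      then show ?thesis using cpow_measurable_param[OF V_measurable, of m] by (simp only:)
    qed
    show "(\<lambda>(t', \<xi>). ?H t' \<xi>) \<in> borel_measurable (lborel \<Otimes>\<^sub>M mu)"
      unfolding case_prod_beta' h_def using 1 by measurable
    show "AE p in lborel \<Otimes>\<^sub>M mu. norm (case p of (t', \<xi>) \<Rightarrow> ?H t' \<xi>) \<le> norm (case p of (t', \<xi>) \<Rightarrow> complex_of_real (indicator {0..t} t' * T) * complex_of_real (cpow M m majorant_lim \<xi>))"
    proof (rule AE_I2)
      fix p :: "real \<times> (real^'n)" assume "p \<in> space (lborel \<Otimes>\<^sub>M mu)"
      then obtain t' \<xi> where p: "p = (t', \<xi>)" "\<xi> \<in> space mu" by (auto simp: space_pair_measure)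
      show "norm (case p of (t', \<xi>) \<Rightarrow> ?H t' \<xi>) \<le> norm (case p of (t', \<xi>) \<Rightarrow> complex_of_real (indicator {0..t} t' * T) * complex_of_real (cpow M m majorant_lim \<xi>))"
      proof (cases "t' \<in> {0..t}")
        case True
        let ?v = "of_real (wave_symbol (t - t') (norm \<xi>)) * cpow M m (V t') \<xi>"
        have "norm (h t' \<xi>) \<le> norm ?v"
          unfolding h_def norm_mult[of "e \<xi>"] by (rule mult_left_le_one_le) (use e_le in auto)
        also have "norm ?v \<le> T * cpow M m majorant_lim \<xi>"
          by (rule duhamel_integrand_le[OF bdd_integrable_V majorant_lim(1) V_le t True p(2)])
        also have "\<dots> \<le> \<bar>T * cpow M m majorant_lim \<xi>\<bar>" by (rule abs_ge_self)
        finally show ?thesis using True by (simp add: p norm_mult abs_mult)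
      qed (simp add: p)
    qed
  qed
  have sc: "(\<integral>\<xi>. ?H t' \<xi> \<partial>mu) = indicator {0..t} t' *\<^sub>R (\<integral>\<xi>. h t' \<xi> \<partial>mu)" for t'
    by simp
  show "set_integrable lborel {0..t} (\<lambda>t'. \<integral>\<xi>. h t' \<xi> \<partial>mu)"
    unfolding set_integrable_def sc[symmetric] by (rule P.integrable_fst[OF I])
  have "(LINT t':{0..t}|lborel. \<integral>\<xi>. h t' \<xi> \<partial>mu) = (\<integral>t'. (\<integral>\<xi>. ?H t' \<xi> \<partial>mu) \<partial>lborel)"
    unfolding set_lebesgue_integral_def sc[symmetric] ..
  also have "\<dots> = (\<integral>\<xi>. (\<integral>t'. ?H t' \<xi> \<partial>lborel) \<partial>mu)"
    using P.Fubini_integral[OF I] by simp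
  also have "\<dots> = (\<integral>\<xi>. e \<xi> * duhamel V t \<xi> \<partial>mu)"
    unfolding duhamel_def set_lebesgue_integral_def h_def
    by (simp add: Bochner_Integration.integral_mult_right_zero[symmetric] del: Bochner_Integration.integral_mult_right_zero)
  finally show "(LINT t':{0..t}|lborel. \<integral>\<xi>. h t' \<xi> \<partial>mu) = (\<integral>\<xi>. e \<xi> * duhamel V t \<xi> \<partial>mu)" .
qed

text \<open>Each term of the spatial formula is the inverse transform of the corresponding term of
  \<open>V_eq\<close>: the multipliers may be computed with \<open>v0\<close>, \<open>v1\<close> and
  the convolution power because these are transforms of the functions involved. Continuity in time
  comes from integrating \<open>V_lipschitz\<close> over all frequencies.\<close>

lemma solution:
  "nlw_solution M (Suc m) \<sigma> T (\<lambda>t. inv_fourier M (V t)) (regular_distr M (inv_fourier M v1))"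
  unfolding nlw_solution_def
proof (intro conjI ballI allI)
  have iV: "integrable mu (V t)" if "t \<in> {0..T}" for t by (rule bdd_integrableD(1)[OF bdd_integrable_V[OF that]])
  have iv1: "integrable mu v1" by (rule bdd_integrableD(1)[OF v1])
  fix t assume t: "t \<in> {0..T}"
  show "FL1_function M (inv_fourier M (V t))" by (rule FL1_function_inv_fourier[OF iV[OF t]])
  show "((\<lambda>t'. FL_norm M 0 (regular_distr M (\<lambda>x. inv_fourier M (V t') x - inv_fourier M (V t) x))) \<longlongrightarrow> 0) (at t within {0..T})"
  proof (rule tendsto_sandwich[OF _ _ tendsto_const])
    have le: "0 \<le> FL_norm M 0 (regular_distr M (\<lambda>x. inv_fourier M (V t') x - inv_fourier M (V t) x)) \<and>
        FL_norm M 0 (regular_distr M (\<lambda>x. inv_fourier M (V t') x - inv_fourier M (V t) x)) \<le> \<bar>t' - t\<bar> * (\<integral>\<xi>. lip \<xi> \<partial>mu)"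
      if t': "t' \<in> {0..T}" for t'
    proof -
      have i: "integrable mu (\<lambda>\<xi>. V t' \<xi> - V t \<xi>)" using iV t t' by auto
      have "(\<lambda>x. inv_fourier M (V t') x - inv_fourier M (V t) x) = inv_fourier M (\<lambda>\<xi>. V t' \<xi> - V t \<xi>)"
        unfolding inv_fourier_def right_diff_distrib[of "cis _"]
        by (subst Bochner_Integration.integral_diff[OF integrable_dual_cis_mult[OF iV[OF t']] integrable_dual_cis_mult[OF iV[OF t]]]) (simp add: right_diff_distrib)
      then have "FL_norm M 0 (regular_distr M (\<lambda>x. inv_fourier M (V t') x - inv_fourier M (V t) x)) = (\<integral>\<xi>. cmod (V t' \<xi> - V t \<xi>) \<partial>mu)"
        using FL_norm_inv_fourier[OF i] by simp
      moreover have "(\<integral>\<xi>. cmod (V t' \<xi> - V t \<xi>) \<partial>mu) \<le> (\<integral>\<xi>. \<bar>t' - t\<bar> * lip \<xi> \<partial>mu)"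
        by (intro integral_mono V_lipschitz[OF t t'] integrable_norm i integrable_mult_right integrable_lip)
      ultimately show ?thesis by simp
    qed
    show "\<forall>\<^sub>F t' in at t within {0..T}. 0 \<le> FL_norm M 0 (regular_distr M (\<lambda>x. inv_fourier M (V t') x - inv_fourier M (V t) x))"
      "\<forall>\<^sub>F t' in at t within {0..T}. FL_norm M 0 (regular_distr M (\<lambda>x. inv_fourier M (V t') x - inv_fourier M (V t) x)) \<le> \<bar>t' - t\<bar> * (\<integral>\<xi>. lip \<xi> \<partial>mu)"
      using le by (auto simp: eventually_at_filter)
    show "((\<lambda>t'. \<bar>t' - t\<bar> * (\<integral>\<xi>. lip \<xi> \<partial>mu)) \<longlongrightarrow> 0) (at t within {0..T})"
      by (auto intro!: tendsto_eq_intros)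
  qed
  fix x :: "real^'n"
  let ?e = "\<lambda>\<xi>. cis (x \<bullet> \<xi>)"
  have w: "wave_symbol s \<in> borel_measurable borel" for s by measurable
  have m1: "fourier_mult M (\<lambda>r. cos (t * r)) (regular_distr M (inv_fourier M (V 0))) x = of_real (fourier_const TYPE('n)) * (\<integral>\<xi>. ?e \<xi> * (of_real (cos (t * norm \<xi>)) * v0 \<xi>) \<partial>mu)"
  proof -
    have V0: "inv_fourier M (V 0) = inv_fourier M v0" by (rule inv_fourier_cong) (rule V_0)
    show ?thesis unfolding V0
      by (subst fourier_mult_eq[OF has_fourier_inv_fourier[OF bdd_integrableD(1)[OF v0]]]) (auto simp: inv_fourier_def)
  qed
  have m2: "fourier_mult M (wave_symbol t) (regular_distr M (inv_fourier M v1)) x = of_real (fourier_const TYPE('n)) * (\<integral>\<xi>. ?e \<xi> * (of_real (wave_symbol t (norm \<xi>)) * v1 \<xi>) \<partial>mu)"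
    by (subst fourier_mult_eq[OF has_fourier_inv_fourier[OF iv1] w]) (simp add: inv_fourier_def)
  let ?h = "\<lambda>t' \<xi>. of_real (wave_symbol (t - t') (norm \<xi>)) * cpow M m (V t') \<xi>"
  have m3: "(LINT t':{0..t}|lborel. fourier_mult M (wave_symbol (t - t')) (regular_distr M (\<lambda>y. inv_fourier M (V t') y ^ Suc m)) x)
     = (LINT t':{0..t}|lborel. of_real (fourier_const TYPE('n)) * (\<integral>\<xi>. ?e \<xi> * ?h t' \<xi> \<partial>mu))"
  proof (rule set_lebesgue_integral_cong)
    show "\<forall>t'. t' \<in> {0..t} \<longrightarrow> fourier_mult M (wave_symbol (t - t')) (regular_distr M (\<lambda>y. inv_fourier M (V t') y ^ Suc m)) x = of_real (fourier_const TYPE('n)) * (\<integral>\<xi>. ?e \<xi> * ?h t' \<xi> \<partial>mu)"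
    proof (intro allI impI)
      fix t' assume "t' \<in> {0..t}"
      then have t': "t' \<in> {0..T}" using t by auto
      \<comment> \<open>Here the pointwise power in space meets its frequency-side form.\<close>
      have eq: "(\<lambda>y. inv_fourier M (V t') y ^ Suc m) = inv_fourier M (cpow M m (V t'))"
        using inv_fourier_cpow[OF bdd_integrable_V[OF t'], of m] by (intro ext) simp
      show "fourier_mult M (wave_symbol (t - t')) (regular_distr M (\<lambda>y. inv_fourier M (V t') y ^ Suc m)) x = of_real (fourier_const TYPE('n)) * (\<integral>\<xi>. ?e \<xi> * ?h t' \<xi> \<partial>mu)"
        unfolding eq
        by (subst fourier_mult_eq[OF has_fourier_inv_fourier[OF bdd_integrableD(1)[OF bdd_integrable_cpow[OF bdd_integrable_V[OF t']]]] w])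
           (simp add: inv_fourier_def)
    qed
  qed simp
  have em: "?e \<in> borel_measurable mu" by (rule borel_measurable_dual) measurable
  have m3': "(LINT t':{0..t}|lborel. of_real (fourier_const TYPE('n)) * (\<integral>\<xi>. ?e \<xi> * ?h t' \<xi> \<partial>mu)) = of_real (fourier_const TYPE('n)) * (\<integral>\<xi>. ?e \<xi> * duhamel V t \<xi> \<partial>mu)"
    using duhamel_pairing(2)[OF em _ t] by (simp only: set_integral_mult_right norm_cis order_refl)
  have i1: "integrable mu (\<lambda>\<xi>. of_real (cos (t * norm \<xi>)) * v0 \<xi>)"
    by (rule bdd_integrableD(1)[OF bdd_integrable_mult[OF v0, of _ 1]]) (auto intro!: borel_measurable_of_real)
  have i2: "integrable mu (\<lambda>\<xi>. of_real (wave_symbol t (norm \<xi>)) * v1 \<xi>)"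
    by (rule bdd_integrableD(1)[OF bdd_integrable_mult[OF v1, of _ "\<bar>t\<bar>"]]) (auto intro!: borel_measurable_of_real abs_wave_symbol_le)
  have i3: "integrable mu (\<lambda>\<xi>. duhamel V t \<xi>)"
  proof -
    \<comment> \<open>Since \<open>\<sigma>^2 = 1\<close>, the equation can be solved for the
      Duhamel term, which thus inherits integrability from \<open>V\<close> and the free
      part.\<close>
    have "duhamel V t \<xi> = of_real \<sigma> * (V t \<xi> - free t \<xi>)" if "\<xi> \<in> space mu" for \<xi>
    proof -
      have "complex_of_real \<sigma> * complex_of_real \<sigma> = 1" using sigma by (auto simp: abs_if split: if_splits)
      then show ?thesis unfolding V_eq[OF t that] by (simp add: mult.assoc[symmetric])
    qed
    moreover have "integrable mu (\<lambda>\<xi>. of_real \<sigma> * (V t \<xi> - free t \<xi>))"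
      unfolding free_def using iV[OF t] i1 i2 by (intro integrable_mult_right Bochner_Integration.integrable_diff Bochner_Integration.integrable_add)
    ultimately show ?thesis by (simp cong: Bochner_Integration.integrable_cong)
  qed
  have "inv_fourier M (V t) x = inv_fourier M (\<lambda>\<xi>. of_real (cos (t * norm \<xi>)) * v0 \<xi> + of_real (wave_symbol t (norm \<xi>)) * v1 \<xi> + of_real \<sigma> * duhamel V t \<xi>) x"
    using V_eq[OF t] by (intro fun_cong[OF inv_fourier_cong]) (simp add: free_def)
  also have "\<dots> = of_real (fourier_const TYPE('n)) * ((\<integral>\<xi>. ?e \<xi> * (of_real (cos (t * norm \<xi>)) * v0 \<xi>) \<partial>mu) + (\<integral>\<xi>. ?e \<xi> * (of_real (wave_symbol t (norm \<xi>)) * v1 \<xi>) \<partial>mu) + of_real \<sigma> * (\<integral>\<xi>. ?e \<xi> * duhamel V t \<xi> \<partial>mu))"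
  proof -
    note ii = integrable_dual_cis_mult[OF i1, of x] integrable_dual_cis_mult[OF i2, of x] integrable_dual_cis_mult[OF i3, of x]
    have "(\<integral>\<xi>. ?e \<xi> * (of_real (cos (t * norm \<xi>)) * v0 \<xi>) + ?e \<xi> * (of_real (wave_symbol t (norm \<xi>)) * v1 \<xi>) + of_real \<sigma> * (?e \<xi> * duhamel V t \<xi>) \<partial>mu)
      = (\<integral>\<xi>. ?e \<xi> * (of_real (cos (t * norm \<xi>)) * v0 \<xi>) \<partial>mu) + (\<integral>\<xi>. ?e \<xi> * (of_real (wave_symbol t (norm \<xi>)) * v1 \<xi>) \<partial>mu) + of_real \<sigma> * (\<integral>\<xi>. ?e \<xi> * duhamel V t \<xi> \<partial>mu)"
      using ii by (simp only: Bochner_Integration.integral_add Bochner_Integration.integrable_add integrable_mult_right Bochner_Integration.integral_mult_right_zero)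
    then show ?thesis by (simp only: inv_fourier_def distrib_left mult.left_commute[of "cis _" "of_real \<sigma>"])
  qed
  finally show "inv_fourier M (V t) x = fourier_mult M (\<lambda>r. cos (t * r)) (regular_distr M (inv_fourier M (V 0))) x
     + fourier_mult M (wave_symbol t) (regular_distr M (inv_fourier M v1)) x
     + of_real \<sigma> * (LINT t':{0..t}|lborel. fourier_mult M (wave_symbol (t - t')) (regular_distr M (\<lambda>y. inv_fourier M (V t') y ^ Suc m)) x)"
    unfolding m1 m2 m3 m3' by (simp only: distrib_left mult.left_commute[of "of_real \<sigma>"])
next
  have iv1: "integrable mu v1" by (rule bdd_integrableD(1)[OF v1])
  have "integrable mu (\<lambda>\<xi>. japanese \<xi> powr (-1) * cmod (v1 \<xi>))"
  proof (rule Bochner_Integration.integrable_bound[OF iv1])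
    show "(\<lambda>\<xi>. japanese \<xi> powr (-1) * cmod (v1 \<xi>)) \<in> borel_measurable mu"
      using japanese_powr_measurable[of "-1" M] borel_measurable_integrable[OF integrable_norm[OF iv1]] by measurable
    have aux: "\<bar>a * b\<bar> \<le> b" if "0 \<le> a" "a \<le> 1" "0 \<le> b" for a b :: real
      using that by (simp add: abs_mult mult_left_le_one_le)
    have "japanese \<xi> powr (-1) \<le> 1" for \<xi> :: "real^'n"
      using powr_mono[of "-1" 0 "japanese \<xi>"] japanese_ge_1[of \<xi>] by simp
    from aux[OF powr_ge_zero this norm_ge_zero] show "AE \<xi> in mu. norm (japanese \<xi> powr (-1) * cmod (v1 \<xi>)) \<le> cmod (v1 \<xi>)"
      unfolding real_norm_def by (intro AE_I2)
  qed
  then show "in_FL M (- 1) (regular_distr M (inv_fourier M v1))"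
    unfolding in_FL_iff(1)[OF has_fourier_inv_fourier[OF iv1]] using distribution_inv_fourier[OF iv1] by blast
qed

end

section \<open>Resonant interactions\<close>

lemma integral_cpow:
  fixes f :: "real^'n::finite \<Rightarrow> 'b::{real_normed_field, banach, second_countable_topology}"
  assumes f: "bdd_integrable M f"
  shows "(\<integral>x. cpow M m f x \<partial>dual_measure M) = of_real (fourier_const TYPE('n)) ^ m * (\<integral>x. f x \<partial>dual_measure M) ^ Suc m"
proof (induction m)
  case (Suc m)
  have "(\<integral>x. cpow M (Suc m) f x \<partial>dual_measure M) = of_real (fourier_const TYPE('n)) * ((\<integral>x. f x \<partial>dual_measure M) * (\<integral>x. cpow M m f x \<partial>dual_measure M))"
    by (simp add: convolution_def integral_convolution(2)[OF bdd_integrableD(1)[OF f] bdd_integrableD(1)[OF bdd_integrable_cpow[OF f]]])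
  then show ?case by (simp add: Suc mult_ac)
qed simp

lemma cpow_support:
  fixes f :: "real^'n::finite \<Rightarrow> 'b::{real_normed_field, banach, second_countable_topology}"
  assumes f: "\<And>x. a < norm x \<Longrightarrow> f x = 0"
  shows "real (Suc m) * a < norm x \<Longrightarrow> cpow M m f x = 0"
proof (induction m arbitrary: x)
  case (Suc m)
  have "f (x - y) * cpow M m f y = 0" for y
  proof (cases "a < norm (x - y)")
    case False
    have "norm x \<le> norm (x - y) + norm y" using norm_triangle_ineq[of "x - y" y] by simp
    then have "real (Suc m) * a < norm y" using False Suc.prems by (simp add: algebra_simps)
    then show ?thesis using Suc.IH by simp
  qed (simp add: f)
  then show ?case by (simp only: cpow.simps convolution_def) simp
qed (simp add: f)

lemma inv_fourier_shift:
  fixes f :: "real^'n::finite \<Rightarrow> complex"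
  assumes f: "integrable (dual_measure M) f" and b: "b \<in> space (dual_measure M)"
  shows "inv_fourier M (\<lambda>\<xi>. f (\<xi> - b)) x = cis (x \<bullet> b) * inv_fourier M f x"
proof -
  let ?G = "\<lambda>\<xi>. cis (x \<bullet> b) * (cis (x \<bullet> \<xi>) * f \<xi>)"
  have G: "integrable (dual_measure M) ?G"
    by (intro integrable_mult_right integrable_dual_cis_mult f)
  have "cis (x \<bullet> b) * (cis (x \<bullet> (- b + 1 *\<^sub>R \<xi>)) * f (- b + 1 *\<^sub>R \<xi>)) = cis (x \<bullet> \<xi>) * f (\<xi> - b)" for \<xi>
    by (simp add: mult.assoc[symmetric] cis_mult inner_add_right inner_diff_right)
  then have "(\<integral>\<xi>. cis (x \<bullet> \<xi>) * f (\<xi> - b) \<partial>dual_measure M) = (\<integral>\<xi>. ?G \<xi> \<partial>dual_measure M)"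
    using dual_affine(2)[OF space_dual_uminus[OF b] disjI1[OF refl] G] by (simp only:)
  then show ?thesis unfolding inv_fourier_def
    by (simp only: Bochner_Integration.integral_mult_right_zero) (rule mult.left_commute)
qed

lemma inv_fourier_sum:
  fixes f :: "'i \<Rightarrow> real^'n::finite \<Rightarrow> complex"
  assumes "\<And>i. i \<in> I \<Longrightarrow> integrable (dual_measure M) (f i)"
  shows "inv_fourier M (\<lambda>\<xi>. \<Sum>i\<in>I. a i * f i \<xi>) x = (\<Sum>i\<in>I. a i * inv_fourier M (f i) x)"
proof -
  have "(\<integral>\<xi>. (\<Sum>i\<in>I. a i * (cis (x \<bullet> \<xi>) * f i \<xi>)) \<partial>dual_measure M) = (\<Sum>i\<in>I. \<integral>\<xi>. a i * (cis (x \<bullet> \<xi>) * f i \<xi>) \<partial>dual_measure M)"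
    by (intro Bochner_Integration.integral_sum integrable_mult_right integrable_dual_cis_mult assms)
  then show ?thesis
    by (simp add: inv_fourier_def sum_distrib_left mult.left_commute[of "cis _"]) (simp add: mult_ac)
qed

lemma inv_fourier_inj:
  assumes f: "integrable (dual_measure M) f" and g: "integrable (dual_measure M) g"
    and eq: "inv_fourier M f = inv_fourier M g"
  shows "AE \<xi> in dual_measure M. f \<xi> = g \<xi>"
  using has_fourier_unique has_fourier_inv_fourier[OF f] has_fourier_inv_fourier[OF g] unfolding eq by blast

lemma bdd_integrable_shift:
  fixes f :: "real^'n::finite \<Rightarrow> 'b::{banach, second_countable_topology}"
  assumes "bdd_integrable M f" "b \<in> space (dual_measure M)"
  shows "bdd_integrable M (\<lambda>\<xi>. f (\<xi> - b))"
  using bdd_integrable_affine[OF assms(1) space_dual_uminus[OF assms(2)], of 1] by simp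

text \<open>In physical space translations become characters, so the convolution power of a sum of two
  translates is read off the binomial theorem.\<close>

lemma cpow_two_translates:
  fixes \<psi> :: "real^'n::finite \<Rightarrow> complex" and b1 b2 :: "real^'n" and m :: nat
  assumes psi: "bdd_integrable M \<psi>" and b: "b1 \<in> space (dual_measure M)" "b2 \<in> space (dual_measure M)"
  defines "d \<equiv> \<lambda>j. real j *\<^sub>R b1 + real (Suc m - j) *\<^sub>R b2"
  assumes d: "\<And>j. d j \<in> space (dual_measure M)"
  shows "AE \<xi> in dual_measure M. cpow M m (\<lambda>\<xi>. \<alpha> * \<psi> (\<xi> - b1) + \<beta> * \<psi> (\<xi> - b2)) \<xi>
    = (\<Sum>j\<le>Suc m. (of_nat (Suc m choose j) * \<alpha> ^ j * \<beta> ^ (Suc m - j)) * cpow M m \<psi> (\<xi> - d j))"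
proof (rule inv_fourier_inj)
  let ?f = "\<lambda>\<xi>. \<alpha> * \<psi> (\<xi> - b1) + \<beta> * \<psi> (\<xi> - b2)"
  let ?a = "\<lambda>j. of_nat (Suc m choose j) * \<alpha> ^ j * \<beta> ^ (Suc m - j)"
  have f: "bdd_integrable M ?f"
    by (intro bdd_integrable_add bdd_integrable_cmult bdd_integrable_shift psi b)
  have p: "bdd_integrable M (\<lambda>\<xi>. cpow M m \<psi> (\<xi> - d j))" for j
    by (rule bdd_integrable_shift[OF bdd_integrable_cpow[OF psi] d])
  show "integrable (dual_measure M) (cpow M m ?f)"
    by (rule bdd_integrableD(1)[OF bdd_integrable_cpow[OF f]])
  show "integrable (dual_measure M) (\<lambda>\<xi>. \<Sum>j\<le>Suc m. ?a j * cpow M m \<psi> (\<xi> - d j))"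
    by (intro bdd_integrableD(1) bdd_integrable_sum bdd_integrable_cmult p) simp
  show "inv_fourier M (cpow M m ?f) = inv_fourier M (\<lambda>\<xi>. \<Sum>j\<le>Suc m. ?a j * cpow M m \<psi> (\<xi> - d j))"
  proof
    fix x :: "real^'n"
    let ?P = "inv_fourier M \<psi> x"
    have "inv_fourier M ?f x = \<alpha> * inv_fourier M (\<lambda>\<xi>. \<psi> (\<xi> - b1)) x + \<beta> * inv_fourier M (\<lambda>\<xi>. \<psi> (\<xi> - b2)) x"
    proof -
      have "inv_fourier M (\<lambda>\<xi>. \<Sum>i\<in>{True, False}. (if i then \<alpha> else \<beta>) * \<psi> (\<xi> - (if i then b1 else b2))) x = (\<Sum>i\<in>{True, False}. (if i then \<alpha> else \<beta>) * inv_fourier M (\<lambda>\<xi>. \<psi> (\<xi> - (if i then b1 else b2))) x)"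
        by (rule inv_fourier_sum) (auto intro!: bdd_integrableD(1) bdd_integrable_shift psi b)
      then show ?thesis by simp
    qed
    also have "\<dots> = (\<alpha> * cis (x \<bullet> b1)) * ?P + (\<beta> * cis (x \<bullet> b2)) * ?P"
      using inv_fourier_shift[OF bdd_integrableD(1)[OF psi] b(1)] inv_fourier_shift[OF bdd_integrableD(1)[OF psi] b(2)] by simp
    finally have F: "inv_fourier M ?f x = (\<alpha> * cis (x \<bullet> b1) + \<beta> * cis (x \<bullet> b2)) * ?P" by (simp add: distrib_right)
    have "inv_fourier M (cpow M m ?f) x = (\<alpha> * cis (x \<bullet> b1) + \<beta> * cis (x \<bullet> b2)) ^ Suc m * ?P ^ Suc m"
      by (simp only: inv_fourier_cpow[OF f] F power_mult_distrib)
    also have "\<dots> = (\<Sum>j\<le>Suc m. of_nat (Suc m choose j) * (\<alpha> * cis (x \<bullet> b1)) ^ j * (\<beta> * cis (x \<bullet> b2)) ^ (Suc m - j) * ?P ^ Suc m)"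
      by (subst binomial_ring) (simp only: sum_distrib_right)
    also have "\<dots> = (\<Sum>j\<le>Suc m. ?a j * (cis (x \<bullet> d j) * ?P ^ Suc m))"
    proof (intro sum.cong refl)
      fix j
      have "cis (x \<bullet> d j) = cis (x \<bullet> b1) ^ j * cis (x \<bullet> b2) ^ (Suc m - j)"
        by (simp add: d_def inner_add_right cis_mult Complex.DeMoivre)
      then show "of_nat (Suc m choose j) * (\<alpha> * cis (x \<bullet> b1)) ^ j * (\<beta> * cis (x \<bullet> b2)) ^ (Suc m - j) * ?P ^ Suc m = ?a j * (cis (x \<bullet> d j) * ?P ^ Suc m)"
        by (simp only: power_mult_distrib mult_ac)
    qed
    also have "\<dots> = (\<Sum>j\<le>Suc m. ?a j * inv_fourier M (\<lambda>\<xi>. cpow M m \<psi> (\<xi> - d j)) x)"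
      by (simp only: inv_fourier_shift[OF bdd_integrableD(1)[OF bdd_integrable_cpow[OF psi]] d] inv_fourier_cpow[OF psi])
    also have "\<dots> = inv_fourier M (\<lambda>\<xi>. \<Sum>j\<le>Suc m. ?a j * cpow M m \<psi> (\<xi> - d j)) x"
      by (rule inv_fourier_sum[symmetric]) (rule bdd_integrableD(1)[OF p])
    finally show "inv_fourier M (cpow M m ?f) x = inv_fourier M (\<lambda>\<xi>. \<Sum>j\<le>Suc m. ?a j * cpow M m \<psi> (\<xi> - d j)) x" .
  qed
qed

section \<open>Two bumps and their low-frequency interaction\<close>

abbreviation bump :: "real^'n::finite \<Rightarrow> 'b::{zero_neq_one}"
  where "bump \<equiv> indicator (cball 0 1)"

lemma bdd_integrable_indicator_cball:
  "bdd_integrable M (indicator (cball 0 r) :: real^'n::finite \<Rightarrow> real)"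
  "bdd_integrable M (indicator (cball 0 r) :: real^'n::finite \<Rightarrow> complex)"
proof -
  show r: "bdd_integrable M (indicator (cball 0 r) :: real^'n \<Rightarrow> real)"
    unfolding bdd_integrable_def using integrable_indicator_cball[of M r] by (auto intro!: exI[of _ 1] simp: indicator_def)
  show "bdd_integrable M (indicator (cball 0 r) :: real^'n \<Rightarrow> complex)"
  proof (rule bdd_integrable_dominated[of M "\<lambda>x. of_real (indicator (cball 0 r) x)"])
    have "integrable (dual_measure M) (\<lambda>x::real^'n. complex_of_real (indicator (cball 0 r) x))"
      by (intro integrable_of_real integrable_indicator_cball)
    then show "bdd_integrable M (\<lambda>x::real^'n. complex_of_real (indicator (cball 0 r) x))"
      unfolding bdd_integrable_def by (auto intro!: exI[of _ 1] simp: indicator_def)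
    show "(indicator (cball 0 r) :: real^'n \<Rightarrow> complex) \<in> borel_measurable (dual_measure M)"
      by (intro borel_measurable_dual borel_measurable_indicator) simp
  qed (simp add: indicator_def)
qed

lemma norm_axis: "norm (axis i a :: real^'n::finite) = \<bar>a\<bar>"
proof -
  have "axis i a = a *\<^sub>R (axis i 1 :: real^'n)" by (simp add: vec_eq_iff axis_def)
  then show ?thesis by (metis norm_axis_1 norm_scaleR mult_1_right)
qed

text \<open>A term with \<open>j\<close> factors at \<open>b1\<close> is centred at
  \<open>N (m + 1) (j - m)\<close> on the axis. Only \<open>j = m\<close> is centred at the origin;
  every other centre has norm at least \<open>3 (m + 1)\<close>, which exceeds the support radius
  \<open>m + 1\<close> plus the cutoff radius \<open>m + 1\<close>. The binomial coefficient at
  \<open>j = m\<close> is the factor \<open>Suc m\<close>.\<close>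

lemma cpow_two_bumps_low_frequency:
  fixes i :: "'n::finite" and N m :: nat
  assumes N: "3 \<le> N"
  defines "b1 \<equiv> axis i (real N)" and "b2 \<equiv> axis i (- real (m * N)) :: real^'n"
  shows "AE \<xi> in dual_measure M. norm \<xi> \<le> real (Suc m) \<longrightarrow>
     cpow M m (\<lambda>\<xi>. \<alpha> * bump (\<xi> - b1) + \<beta> * bump (\<xi> - b2)) \<xi> = of_nat (Suc m) * \<alpha> ^ m * \<beta> * (cpow M m bump \<xi> :: complex)"
proof -
  define d where "d j = real j *\<^sub>R b1 + real (Suc m - j) *\<^sub>R b2" for j
  have b: "b1 \<in> space (dual_measure M)" "b2 \<in> space (dual_measure M)"
    using space_dual_axis[of i "int N" M] space_dual_axis[of i "- int (m * N)" M] by (simp_all add: b1_def b2_def)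
  have d_axis: "d j = axis i (real_of_int (int j * int N + int (Suc m - j) * (- int (m * N))))" for j
    by (simp add: d_def b1_def b2_def vec_eq_iff axis_def)
  have ds: "d j \<in> space (dual_measure M)" for j
    unfolding d_axis by (rule space_dual_axis)
  have dm: "d m = 0" by (simp add: d_axis vec_eq_iff axis_def)
  have zero: "cpow M m bump (\<xi> - d j) = (0::complex)" if "norm \<xi> \<le> real (Suc m)" "j \<le> Suc m" "j \<noteq> m" for \<xi> j
  proof (rule cpow_support[where a=1])
    have "int j * int N + int (Suc m - j) * (- int (m * N)) = int N * int (Suc m) * (int j - int m)"
      using that(2) by (simp add: of_nat_diff algebra_simps)
    then have dj: "d j = axis i (real N * real (Suc m) * (real j - real m))"
      unfolding d_axis by (simp only: of_int_mult of_int_of_nat_eq of_int_diff)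
    then have nd: "norm (d j) = real N * real (Suc m) * \<bar>real j - real m\<bar>"
      by (simp add: dj norm_axis abs_mult)
    have "1 \<le> \<bar>real j - real m\<bar>" using that(3) by linarith
    then have "3 * real (Suc m) * 1 \<le> norm (d j)"
      unfolding nd using N by (intro mult_mono) auto
    moreover have "norm (d j) \<le> norm (\<xi> - d j) + norm \<xi>"
      using norm_triangle_ineq4[of \<xi> "\<xi> - d j"] by simp
    ultimately show "real (Suc m) * 1 < norm (\<xi> - d j)" using that(1) by simp
  qed (auto simp: indicator_def)
  have "AE \<xi> in dual_measure M. cpow M m (\<lambda>\<xi>. \<alpha> * bump (\<xi> - b1) + \<beta> * bump (\<xi> - b2)) \<xi>
    = (\<Sum>j\<le>Suc m. (of_nat (Suc m choose j) * \<alpha> ^ j * \<beta> ^ (Suc m - j)) * cpow M m bump (\<xi> - d j))"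
    unfolding d_def by (rule cpow_two_translates[OF bdd_integrable_indicator_cball(2) b]) (fold d_def, rule ds)
  then show ?thesis
  proof eventually_elim
    case (elim \<xi>)
    show ?case
    proof
      assume xi: "norm \<xi> \<le> real (Suc m)"
      have "(\<Sum>j\<le>Suc m. (of_nat (Suc m choose j) * \<alpha> ^ j * \<beta> ^ (Suc m - j)) * cpow M m bump (\<xi> - d j))
        = (\<Sum>j\<in>{m}. (of_nat (Suc m choose j) * \<alpha> ^ j * \<beta> ^ (Suc m - j)) * cpow M m bump (\<xi> - d j))"
        by (rule sum.mono_neutral_right) (use zero[OF xi] in auto)
      then show "cpow M m (\<lambda>\<xi>. \<alpha> * bump (\<xi> - b1) + \<beta> * bump (\<xi> - b2)) \<xi> = of_nat (Suc m) * \<alpha> ^ m * \<beta> * (cpow M m bump \<xi> :: complex)"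
        unfolding elim by (simp add: dm)
    qed
  qed
qed

text \<open>For \<open>b \<noteq> 0\<close> an explicit antiderivative gives the value
  \<open>(1 - cos (b t)) / b^2\<close>. Nonnegativity for every \<open>b\<close> is what makes the
  oscillating parts of the time factor harmless uniformly in \<open>N\<close>.\<close>

lemma integral_linear_cos_nonneg:
  fixes b t :: real
  assumes t: "0 \<le> t"
  shows "set_integrable lborel {0..t} (\<lambda>t'. (t - t') * cos (b * t'))"
    and "0 \<le> (LINT t':{0..t}|lborel. (t - t') * cos (b * t'))"
    and "b = 0 \<Longrightarrow> (LINT t':{0..t}|lborel. (t - t') * cos (b * t')) = t\<^sup>2 / 2"
proof -
  show "set_integrable lborel {0..t} (\<lambda>t'. (t - t') * cos (b * t'))"
    unfolding set_integrable_def by (rule borel_integrable_compact) (auto intro!: continuous_intros)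
  show 0: "(LINT t':{0..t}|lborel. (t - t') * cos (b * t')) = t\<^sup>2 / 2" if "b = 0"
  proof -
    have "(\<integral>t'. indicator {0..t} t' *\<^sub>R (t - t') \<partial>lborel) = (t * t - t\<^sup>2 / 2) - (t * 0 - 0\<^sup>2 / 2)"
      by (rule integral_FTC_Icc[OF t])
         (auto intro!: derivative_eq_intros continuous_intros simp: has_real_derivative_iff_has_vector_derivative[symmetric])
    then show ?thesis using that by (simp add: set_lebesgue_integral_def power2_eq_square)
  qed
  show "0 \<le> (LINT t':{0..t}|lborel. (t - t') * cos (b * t'))"
  proof (cases "b = 0")
    case False
    let ?F = "\<lambda>t'. (t - t') * sin (b * t') / b - cos (b * t') / b\<^sup>2"
    have "(\<integral>t'. indicator {0..t} t' *\<^sub>R ((t - t') * cos (b * t')) \<partial>lborel) = ?F t - ?F 0"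
      by (rule integral_FTC_Icc[OF t])
         (auto intro!: derivative_eq_intros continuous_intros simp: has_real_derivative_iff_has_vector_derivative[symmetric] False field_simps power2_eq_square)
    also have "\<dots> = (1 - cos (b * t)) / b\<^sup>2" by (simp add: diff_divide_distrib)
    finally show ?thesis by (simp add: set_lebesgue_integral_def)
  next
    case True
    show ?thesis by (subst 0[OF True]) simp
  qed
qed

text \<open>Take the real part of \<open>(cis y * cos y)^m = ((cis (2 y) + 1) / 2)^m\<close> and
  expand the right side by the binomial theorem.\<close>

lemma cos_power_resonance:
  "cos y ^ m * cos (real m * y) = (\<Sum>j\<le>m. real (m choose j) * cos (2 * real j * y)) / 2 ^ m"
proof -
  have h: "cis y * of_real (cos y) = (cis (2 * y) + 1) / 2"
    by (simp add: complex_eq_iff cos_double_cos sin_double power2_eq_square)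
  have "complex_of_real (cos y ^ m) * cis (real m * y) = (cis y * of_real (cos y)) ^ m"
    by (simp add: power_mult_distrib Complex.DeMoivre)
  also have "\<dots> = (\<Sum>j\<le>m. of_nat (m choose j) * cis (2 * y) ^ j) / 2 ^ m"
    unfolding h power_divide by (subst binomial_ring) simp
  also have "\<dots> = (\<Sum>j\<le>m. of_nat (m choose j) * cis (2 * real j * y)) / 2 ^ m"
    by (simp add: Complex.DeMoivre mult_ac)
  finally have e: "complex_of_real (cos y ^ m) * cis (real m * y) = (\<Sum>j\<le>m. of_nat (m choose j) * cis (2 * real j * y)) / of_real (2 ^ m)"
    by simp
  have "cos y ^ m * cos (real m * y) = Re (complex_of_real (cos y ^ m) * cis (real m * y))"
    by (simp del: of_real_power)
  also have "\<dots> = (\<Sum>j\<le>m. real (m choose j) * cos (2 * real j * y)) / 2 ^ m"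
    unfolding e Re_divide_of_real by (simp add: Re_sum)
  finally show ?thesis .
qed

text \<open>The term \<open>j = 0\<close> of the cosine expansion is constant in time and
  contributes \<open>t^2 / 2\<close> with weight \<open>1 / 2^m\<close>; all others contribute
  nonnegatively and are dropped.\<close>

lemma resonant_time_integral:
  fixes t N :: real and m :: nat
  assumes t: "0 \<le> t"
  defines "\<alpha> \<equiv> \<lambda>t'. cos (t' * N) ^ m * cos (t' * (real m * N))"
  shows "t\<^sup>2 / 2 ^ Suc m \<le> (LINT t':{0..t}|lborel. (t - t') * \<alpha> t')"
    and "set_integrable lborel {0..t} (\<lambda>t'. (t - t') * \<alpha> t')"
proof -
  let ?g = "\<lambda>j t'. (t - t') * cos ((2 * real j * N) * t')"
  have a: "(t - t') * \<alpha> t' = (\<Sum>j\<le>m. (real (m choose j) / 2 ^ m) * ?g j t')" for t'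
  proof -
    have "\<alpha> t' = (\<Sum>j\<le>m. real (m choose j) * cos (2 * real j * (t' * N))) / 2 ^ m"
      using cos_power_resonance[of "t' * N" m] by (simp only: \<alpha>_def mult.left_commute[of t' "real m" N])
    then have "(t - t') * \<alpha> t' = (\<Sum>j\<le>m. (t - t') * (real (m choose j) * cos (2 * real j * (t' * N)) / 2 ^ m))"
      by (simp only: sum_divide_distrib sum_distrib_left)
    also have "\<dots> = (\<Sum>j\<le>m. (real (m choose j) / 2 ^ m) * ?g j t')"
    proof (intro sum.cong refl)
      fix j
      have "2 * real j * (t' * N) = 2 * real j * N * t'" by (simp only: mult_ac)
      then show "(t - t') * (real (m choose j) * cos (2 * real j * (t' * N)) / 2 ^ m) = (real (m choose j) / 2 ^ m) * ?g j t'"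
        by (simp only: times_divide_eq_right times_divide_eq_left mult_ac)
    qed
    finally show ?thesis .
  qed
  have i: "set_integrable lborel {0..t} (\<lambda>t'. (real (m choose j) / 2 ^ m) * ?g j t')" for j
    by (intro set_integrable_mult_right integral_linear_cos_nonneg t)
  show "set_integrable lborel {0..t} (\<lambda>t'. (t - t') * \<alpha> t')"
    unfolding a set_integrable_def scaleR_sum_right
    by (rule Bochner_Integration.integrable_sum) (rule i[unfolded set_integrable_def])
  have "(LINT t':{0..t}|lborel. (t - t') * \<alpha> t') = (\<Sum>j\<le>m. LINT t':{0..t}|lborel. (real (m choose j) / 2 ^ m) * ?g j t')"
    unfolding a using i unfolding set_lebesgue_integral_def set_integrable_def scaleR_sum_right
    by (subst Bochner_Integration.integral_sum) auto
  also have "\<dots> = (\<Sum>j\<le>m. (real (m choose j) / 2 ^ m) * (LINT t':{0..t}|lborel. ?g j t'))"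
    by (simp only: set_integral_mult_right)
  also have "\<dots> \<ge> (\<Sum>j\<in>{0}. (real (m choose j) / 2 ^ m) * (LINT t':{0..t}|lborel. ?g j t'))"
  proof (rule sum_mono2)
    show "0 \<le> (real (m choose j) / 2 ^ m) * (LINT t':{0..t}|lborel. ?g j t')" for j
      by (intro mult_nonneg_nonneg integral_linear_cos_nonneg(2) t) simp
  qed simp_all
  also have "(\<Sum>j\<in>{0}. (real (m choose j) / 2 ^ m) * (LINT t':{0..t}|lborel. ?g j t')) = t\<^sup>2 / 2 ^ Suc m"
    using integral_linear_cos_nonneg(3)[OF t refl] by (simp add: field_simps)
  finally show "t\<^sup>2 / 2 ^ Suc m \<le> (LINT t':{0..t}|lborel. (t - t') * \<alpha> t')" .
qed

text \<open>At bounded frequencies the propagator is nearly \<open>t\<close>: the mean value theorem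
  writes \<open>sin (t r)\<close> as \<open>t r cos z\<close> with \<open>0 < z < t r\<close>, and
  \<open>cos z\<close> differs from \<open>1\<close> by at most \<open>z\<close>.\<close>

lemma wave_symbol_approx:
  assumes "0 \<le> t" "0 \<le> r"
  shows "\<bar>wave_symbol t r - t\<bar> \<le> t\<^sup>2 * r"
proof (cases "r = 0 \<or> t = 0")
  case False
  have "\<exists>z. 0 < z \<and> z < t * r \<and> sin (t * r) - sin 0 = (t * r - 0) * cos z"
    by (rule MVT2) (use assms False in \<open>auto intro!: derivative_eq_intros\<close>)
  then obtain z where z: "0 < z" "z < t * r" "sin (t * r) = t * r * cos z" by auto
  then have "wave_symbol t r - t = t * (cos z - cos 0)"
    using False by (simp add: wave_symbol_def algebra_simps)
  then have "\<bar>wave_symbol t r - t\<bar> = t * \<bar>cos z - cos 0\<bar>" using assms by (simp only: abs_mult)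
  also have "\<dots> \<le> t * (t * r)"
    using abs_cos_diff_le[of z 0] z assms by (intro mult_left_mono) auto
  finally show ?thesis by (simp add: power2_eq_square mult_ac)
qed (auto simp: wave_symbol_def)

text \<open>Cutting in frequency and in height at once produces the bounded, compactly supported
  data on which the iteration runs; the original weighted square dominates the error, which vanishes
  pointwise as both cuts are released.\<close>

lemma truncation:
  fixes g :: "real^'n::finite \<Rightarrow> complex"
  assumes [measurable]: "g \<in> borel_measurable (dual_measure M)"
    and int: "integrable (dual_measure M) (\<lambda>\<xi>. (japanese \<xi> powr s * cmod (g \<xi>))\<^sup>2)" and "0 < \<eta>"
  obtains w R where "bdd_integrable M w" "\<And>\<xi>. R < norm \<xi> \<Longrightarrow> w \<xi> = 0"
    "integrable (dual_measure M) (\<lambda>\<xi>. (japanese \<xi> powr s * cmod (w \<xi> - g \<xi>))\<^sup>2)"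
    "(\<integral>\<xi>. (japanese \<xi> powr s * cmod (w \<xi> - g \<xi>))\<^sup>2 \<partial>dual_measure M) < \<eta>"
proof -
  let ?m = "dual_measure M :: (real^'n) measure"
  note [measurable] = japanese_powr_measurable
  define w where "w n \<xi> = (if norm \<xi> \<le> real n \<and> cmod (g \<xi>) \<le> real n then g \<xi> else 0)" for n \<xi>
  have [measurable]: "w n \<in> borel_measurable ?m" for n unfolding w_def by measurable
  have bw: "bdd_integrable M (w n)" for n
    by (rule bdd_integrable_dominated[OF bdd_integrable_cmult[OF bdd_integrable_indicator_cball(2)[of M "real n"], of "of_nat n"]])
       (auto simp: w_def indicator_def)
  have le: "(japanese \<xi> powr s * cmod (w n \<xi> - g \<xi>))\<^sup>2 \<le> (japanese \<xi> powr s * cmod (g \<xi>))\<^sup>2" for n \<xi>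
    by (intro power_mono mult_left_mono) (auto simp: w_def)
  have i: "integrable ?m (\<lambda>\<xi>. (japanese \<xi> powr s * cmod (w n \<xi> - g \<xi>))\<^sup>2)" for n
    by (rule Bochner_Integration.integrable_bound[OF int]) (use le in auto)
  have "(\<lambda>n. \<integral>\<xi>. (japanese \<xi> powr s * cmod (w n \<xi> - g \<xi>))\<^sup>2 \<partial>?m) \<longlonglongrightarrow> (\<integral>\<xi>. 0 \<partial>?m)"
  proof (rule integral_dominated_convergence[OF _ _ int])
    show "AE \<xi> in ?m. (\<lambda>n. (japanese \<xi> powr s * cmod (w n \<xi> - g \<xi>))\<^sup>2) \<longlonglongrightarrow> 0"
    proof (intro AE_I2 tendsto_eventually)
      fix \<xi> :: "real^'n"
      have "\<forall>\<^sub>F n in sequentially. norm \<xi> \<le> real n \<and> cmod (g \<xi>) \<le> real n"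
        by (intro eventually_conj) (auto intro!: eventually_compose_filterlim[OF eventually_ge_at_top filterlim_real_sequentially])
      then show "\<forall>\<^sub>F n in sequentially. (japanese \<xi> powr s * cmod (w n \<xi> - g \<xi>))\<^sup>2 = 0"
        by eventually_elim (simp add: w_def)
    qed
    show "AE \<xi> in ?m. norm ((japanese \<xi> powr s * cmod (w n \<xi> - g \<xi>))\<^sup>2) \<le> (japanese \<xi> powr s * cmod (g \<xi>))\<^sup>2" for n
      using le by simp
  qed auto
  then have "\<forall>\<^sub>F n in sequentially. (\<integral>\<xi>. (japanese \<xi> powr s * cmod (w n \<xi> - g \<xi>))\<^sup>2 \<partial>?m) < \<eta>"
    using \<open>0 < \<eta>\<close> by (intro order_tendstoD(2)[where y=0]) simp_all
  then obtain n where n: "(\<integral>\<xi>. (japanese \<xi> powr s * cmod (w n \<xi> - g \<xi>))\<^sup>2 \<partial>?m) < \<eta>"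
    by (auto dest: eventually_happens)
  show ?thesis
    by (rule that[OF bw[of n] _ i[of n] n, of "real n"]) (simp add: w_def)
qed

text \<open>The solution is compared with \<open>L\<close>, the bumps oscillating at the single
  frequencies \<open>N\<close> and \<open>m N\<close>. \<open>Q\<close> is the mass of the resonant
  convolution, \<open>\<Delta>\<close> bounds the \<open>L^1\<close> distance from \<open>V\<close>
  to \<open>L\<close>, and \<open>K\<close> is a Lipschitz constant of the convolution power on the
  \<open>L^1\<close> ball of radius \<open>2 * D * A\<close>, which contains both. Of the
  corrections, \<open>K * \<Delta>\<close> pays for replacing \<open>V\<close> by \<open>L\<close>,
  the next one for replacing the propagator by \<open>T - t\<close>, and the final \<open>W\<close>
  for the free evolution at low frequency.\<close>

lemma (in picard) low_frequency_growth:
  fixes i :: 'n and N :: nat and A D :: real and w :: "real^'n \<Rightarrow> complex"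
  defines "b1 \<equiv> axis i (real N)" and "b2 \<equiv> axis i (- real (m * N)) :: real^'n"
    and "\<kappa> \<equiv> \<integral>\<xi>. bump \<xi> \<partial>mu" and "W \<equiv> (\<integral>\<xi>. cmod (w \<xi>) \<partial>mu) + (\<integral>\<xi>. cmod (v1 \<xi>) \<partial>mu)"
  defines "K \<equiv> real (Suc m) * fourier_const TYPE('n) ^ m * (2 * D * A) ^ m"
    and "\<Delta> \<equiv> W + 2 * A * T * \<kappa> + T\<^sup>2 * (fourier_const TYPE('n) ^ m * (2 * D * A) ^ Suc m)"
    and "Q \<equiv> real (Suc m) * A ^ Suc m * (fourier_const TYPE('n) ^ m * \<kappa> ^ Suc m)"
  assumes N: "m + 3 \<le> N" and m: "1 \<le> m" and A: "0 \<le> A" and T1: "T \<le> 1" and w: "bdd_integrable M w"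
    and v0_eq: "\<And>\<xi>. v0 \<xi> = w \<xi> + of_real A * (bump (\<xi> - b1) + bump (\<xi> - b2))"
    and GD: "G \<le> D * A" and kD: "\<kappa> \<le> D"
  shows "T\<^sup>2 * (Q / 2 ^ Suc m - K * \<Delta> - T * (real (Suc m) * Q)) - W
    \<le> cmod (\<integral>\<xi>. indicator (cball 0 (real (Suc m))) \<xi> * V T \<xi> \<partial>mu)"
proof -
  let ?c = "fourier_const TYPE('n)"
  let ?R = "2 * D * A"
  define e :: "real^'n \<Rightarrow> complex" where "e = indicator (cball 0 (real (Suc m)))"
  have em: "e \<in> borel_measurable mu" and e1: "\<And>\<xi>. cmod (e \<xi>) \<le> 1"
    unfolding e_def by (intro borel_measurable_dual borel_measurable_indicator, simp) (simp add: indicator_def)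
  have T0: "0 \<le> T" using T by simp
  have TT: "T \<in> {0..T}" using T by simp
  have c0: "0 \<le> ?c" by (rule less_imp_le[OF fourier_const_pos])
  have k0: "0 \<le> \<kappa>" unfolding \<kappa>_def by simp
  have D0: "0 \<le> D" using k0 kD by simp
  have bs: "b1 \<in> space mu" "b2 \<in> space mu"
    using space_dual_axis[of i "int N" M] space_dual_axis[of i "- int (m * N)" M] by (simp_all add: b1_def b2_def)
  have nb: "norm b1 = real N" "norm b2 = real (m * N)" by (simp_all only: b1_def b2_def norm_axis abs_minus_cancel abs_of_nat)
  define q :: "real^'n \<Rightarrow> real" where "q \<xi> = bump (\<xi> - b1) + bump (\<xi> - b2)" for \<xi>
  have qi: "bdd_integrable M q" unfolding q_def
    by (intro bdd_integrable_add bdd_integrable_shift bdd_integrable_indicator_cball bs)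
  have q0: "0 \<le> q \<xi>" for \<xi> by (simp add: q_def)
  have qI: "(\<integral>\<xi>. q \<xi> \<partial>mu) = 2 * \<kappa>"
  proof -
    have sh: "integrable mu (\<lambda>\<xi>. bump (\<xi> - b) :: real)" "(\<integral>\<xi>. bump (\<xi> - b) \<partial>mu) = \<kappa>" if "b \<in> space mu" for b
      using dual_affine[OF space_dual_uminus[OF that] disjI1[OF refl] integrable_indicator_cball[of M 1]] by (simp_all add: \<kappa>_def)
    show ?thesis unfolding q_def using sh[OF bs(1)] sh[OF bs(2)] by simp
  qed
  define \<alpha> \<beta> where "\<alpha> t = A * cos (t * real N)" and "\<beta> t = A * cos (t * (real m * real N))" for t
  define L :: "real \<Rightarrow> real^'n \<Rightarrow> complex" where "L t \<xi> = of_real (\<alpha> t) * bump (\<xi> - b1) + of_real (\<beta> t) * bump (\<xi> - b2)" for t \<xi>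
  have Li: "bdd_integrable M (L t)" for t
    unfolding L_def by (intro bdd_integrable_add bdd_integrable_cmult bdd_integrable_shift bdd_integrable_indicator_cball bs)
  have ab: "\<bar>\<alpha> t\<bar> \<le> A" "\<bar>\<beta> t\<bar> \<le> A" for t
    using A mult_left_mono[OF abs_cos_le_one A] by (simp_all add: \<alpha>_def \<beta>_def abs_mult)
  have L_le: "cmod (L t \<xi>) \<le> A * q \<xi>" for t \<xi>
  proof -
    have "cmod (L t \<xi>) \<le> \<bar>\<alpha> t\<bar> * bump (\<xi> - b1) + \<bar>\<beta> t\<bar> * bump (\<xi> - b2)"
      unfolding L_def by (rule order_trans[OF norm_triangle_ineq]) (simp add: norm_mult indicator_def)
    also have "\<dots> \<le> A * bump (\<xi> - b1) + A * bump (\<xi> - b2)"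
      by (intro add_mono mult_right_mono ab) auto
    finally show ?thesis by (simp add: q_def distrib_left)
  qed
  have L_L1: "(\<integral>\<xi>. cmod (L t \<xi>) \<partial>mu) \<le> ?R" for t
  proof -
    have "(\<integral>\<xi>. cmod (L t \<xi>) \<partial>mu) \<le> (\<integral>\<xi>. A * q \<xi> \<partial>mu)"
      by (intro integral_mono integrable_norm bdd_integrableD(1)[OF Li] integrable_mult_right bdd_integrableD(1)[OF qi] L_le)
    also have "\<dots> = A * (2 * \<kappa>)" by (simp add: qI)
    also have "\<dots> \<le> ?R" using mult_left_mono[OF kD A] by simp
    finally show ?thesis .
  qed
  have V_R: "(\<integral>\<xi>. cmod (V t \<xi>) \<partial>mu) \<le> ?R" if "t \<in> {0..T}" for t
    using V_L1[OF that] GD by simp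
  have majR: "(\<integral>\<xi>. norm (majorant_lim \<xi>) \<partial>mu) \<le> ?R"
  proof -
    have "(\<integral>\<xi>. norm (majorant_lim \<xi>) \<partial>mu) = (\<integral>\<xi>. majorant_lim \<xi> \<partial>mu)"
      by (intro Bochner_Integration.integral_cong refl) (simp add: majorant_lim_nonneg)
    then show ?thesis using majorant_lim(2) GD by simp
  qed
  have freeL: "cmod (free t \<xi> - L t \<xi>) \<le> cmod (w \<xi>) + cmod (v1 \<xi>) + A * T * q \<xi>" if t: "t \<in> {0..T}" for t \<xi>
  proof -
    \<comment> \<open>On a unit bump around \<open>b\<close> the frequency \<open>norm \<xi>\<close>
      differs from \<open>norm b\<close> by at most \<open>1\<close>, so freezing it changes the
      phase by at most \<open>t \<le> T\<close>, with no dependence on \<open>N\<close>.\<close>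
    have osc: "\<bar>cos (t * norm \<xi>) - cos (t * n)\<bar> * bump (\<xi> - b) \<le> T * bump (\<xi> - b)" if "norm b = n" for b n
    proof (cases "\<xi> - b \<in> cball 0 1")
      case True
      have "\<bar>norm \<xi> - n\<bar> \<le> norm (\<xi> - b)" using norm_triangle_ineq3[of \<xi> b] that by simp
      then have r: "\<bar>norm \<xi> - n\<bar> \<le> 1" using True by simp
      have "\<bar>cos (t * norm \<xi>) - cos (t * n)\<bar> \<le> \<bar>t * norm \<xi> - t * n\<bar>" by (rule abs_cos_diff_le)
      also have "\<dots> = t * \<bar>norm \<xi> - n\<bar>" using t by (simp add: right_diff_distrib[symmetric] abs_mult)
      also have "\<dots> \<le> T * 1" using t r by (intro mult_mono) auto
      finally show ?thesis by (intro mult_right_mono) auto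
    qed simp
    let ?x = "of_real (cos (t * norm \<xi>)) * w \<xi>" and ?y = "of_real (wave_symbol t (norm \<xi>)) * v1 \<xi>"
    let ?z1 = "of_real (A * (cos (t * norm \<xi>) - cos (t * real N))) * bump (\<xi> - b1) :: complex"
    let ?z2 = "of_real (A * (cos (t * norm \<xi>) - cos (t * (real m * real N)))) * bump (\<xi> - b2) :: complex"
    have "free t \<xi> - L t \<xi> = ?x + ?y + (?z1 + ?z2)"
      by (simp add: free_def L_def v0_eq \<alpha>_def \<beta>_def algebra_simps)
    also have "cmod \<dots> \<le> cmod ?x + cmod ?y + (cmod ?z1 + cmod ?z2)"
      by (intro order_trans[OF norm_triangle_ineq] add_mono norm_triangle_ineq)
    also have "\<dots> \<le> cmod (w \<xi>) + cmod (v1 \<xi>) + (A * (T * bump (\<xi> - b1)) + A * (T * bump (\<xi> - b2)))"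
    proof (intro add_mono)
      show "cmod ?x \<le> cmod (w \<xi>)" by (simp add: norm_mult mult_left_le_one_le)
      have "\<bar>wave_symbol t (norm \<xi>)\<bar> \<le> 1" using abs_wave_symbol_le[of t "norm \<xi>"] t T1 by auto
      then show "cmod ?y \<le> cmod (v1 \<xi>)" by (simp add: norm_mult mult_left_le_one_le)
      have ni: "cmod (bump (\<xi> - b)) = bump (\<xi> - b)" for b by (simp add: indicator_def)
      have "cmod ?z1 = A * (\<bar>cos (t * norm \<xi>) - cos (t * real N)\<bar> * bump (\<xi> - b1))"
        unfolding norm_mult norm_of_real abs_mult ni abs_of_nonneg[OF A] by (rule mult.assoc)
      also have "\<dots> \<le> A * (T * bump (\<xi> - b1))" by (rule mult_left_mono[OF osc[OF nb(1)] A])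
      finally show "cmod ?z1 \<le> A * (T * bump (\<xi> - b1))" .
      have "cmod ?z2 = A * (\<bar>cos (t * norm \<xi>) - cos (t * (real m * real N))\<bar> * bump (\<xi> - b2))"
        unfolding norm_mult norm_of_real abs_mult ni abs_of_nonneg[OF A] by (rule mult.assoc)
      also have "\<dots> \<le> A * (T * bump (\<xi> - b2))" by (rule mult_left_mono[OF osc A]) (simp add: nb)
      finally show "cmod ?z2 \<le> A * (T * bump (\<xi> - b2))" .
    qed
    finally show ?thesis by (simp add: q_def algebra_simps)
  qed
  have iw: "integrable mu (\<lambda>\<xi>. cmod (w \<xi>))" and iv1: "integrable mu (\<lambda>\<xi>. cmod (v1 \<xi>))"
    and iq: "integrable mu q" and imaj: "integrable mu (cpow M m majorant_lim)"
    by (intro integrable_norm bdd_integrableD(1) bdd_integrable_cpow w v1 qi majorant_lim)+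
  \<comment> \<open>Three contributions: background and velocity give \<open>W\<close>, freezing the
    bump frequencies gives \<open>2 * A * T * \<kappa>\<close>, and the whole Duhamel term is
    estimated by the power of the limiting majorant.\<close>
  have VL: "(\<integral>\<xi>. cmod (V t \<xi> - L t \<xi>) \<partial>mu) \<le> \<Delta>" if t: "t \<in> {0..T}" for t
  proof -
    have pw: "cmod (V t \<xi> - L t \<xi>) \<le> cmod (w \<xi>) + cmod (v1 \<xi>) + A * T * q \<xi> + T\<^sup>2 * cpow M m majorant_lim \<xi>" if x: "\<xi> \<in> space mu" for \<xi>
    proof -
      have "cmod (duhamel V t \<xi>) \<le> t * (T * cpow M m majorant_lim \<xi>)"
        unfolding duhamel_def
        using t by (intro time_integral_bound duhamel_integrand_le bdd_integrable_V majorant_lim V_le x) auto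
      also have "\<dots> \<le> T * (T * cpow M m majorant_lim \<xi>)"
        using t T0 by (intro mult_right_mono mult_nonneg_nonneg cpow_nonneg majorant_lim majorant_lim_nonneg x) auto
      finally have d: "cmod (duhamel V t \<xi>) \<le> T\<^sup>2 * cpow M m majorant_lim \<xi>" by (simp add: power2_eq_square)
      have E: "V t \<xi> - L t \<xi> = (free t \<xi> - L t \<xi>) + of_real \<sigma> * duhamel V t \<xi>"
        unfolding V_eq[OF t x] by simp
      have "cmod (V t \<xi> - L t \<xi>) \<le> cmod (free t \<xi> - L t \<xi>) + cmod (duhamel V t \<xi>)"
        unfolding E using norm_triangle_ineq[of "free t \<xi> - L t \<xi>" "of_real \<sigma> * duhamel V t \<xi>"] sigma by (simp add: norm_mult)
      then show ?thesis using freeL[OF t, of \<xi>] d by linarith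
    qed
    have "(\<integral>\<xi>. cmod (V t \<xi> - L t \<xi>) \<partial>mu) \<le> (\<integral>\<xi>. cmod (w \<xi>) + cmod (v1 \<xi>) + A * T * q \<xi> + T\<^sup>2 * cpow M m majorant_lim \<xi> \<partial>mu)"
      by (intro integral_mono pw integrable_norm bdd_integrableD(1) bdd_integrable_diff bdd_integrable_V t Li
          Bochner_Integration.integrable_add integrable_mult_right iw iv1 iq imaj)
    also have "\<dots> = W + 2 * A * T * \<kappa> + T\<^sup>2 * (\<integral>\<xi>. cpow M m majorant_lim \<xi> \<partial>mu)"
      using iw iv1 iq imaj by (simp add: W_def qI)
    also have "(\<integral>\<xi>. cpow M m majorant_lim \<xi> \<partial>mu) \<le> (\<integral>\<xi>. norm (cpow M m majorant_lim \<xi>) \<partial>mu)"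
      using imaj by (intro integral_mono integrable_norm) auto
    also have "\<dots> \<le> ?c ^ m * ?R ^ Suc m" by (rule cpow_L1_bound[OF majorant_lim(1) majR])
    finally show ?thesis by (simp add: \<Delta>_def mult_left_mono)
  qed
  have pVL: "(\<integral>\<xi>. cmod (cpow M m (V t) \<xi> - cpow M m (L t) \<xi>) \<partial>mu) \<le> K * \<Delta>" if t: "t \<in> {0..T}" for t
  proof -
    have "(\<integral>\<xi>. cmod (cpow M m (V t) \<xi> - cpow M m (L t) \<xi>) \<partial>mu) \<le> K * (\<integral>\<xi>. cmod (V t \<xi> - L t \<xi>) \<partial>mu)"
      unfolding K_def by (rule cpow_diff_L1[OF bdd_integrable_V[OF t] Li V_R[OF t] L_L1])
    also have "\<dots> \<le> K * \<Delta>"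
      using c0 D0 A by (intro mult_left_mono VL t) (auto simp: K_def)
    finally show ?thesis .
  qed
  define p :: "real^'n \<Rightarrow> complex" where "p = cpow M m bump"
  define P where "P = ?c ^ m * \<kappa> ^ Suc m"
  have P0: "0 \<le> P" using c0 k0 by (simp add: P_def)
  have Q: "Q = real (Suc m) * A ^ Suc m * P" by (simp add: Q_def P_def)
  have pI: "bdd_integrable M p" unfolding p_def by (intro bdd_integrable_cpow bdd_integrable_indicator_cball)
  have bI: "(\<integral>\<xi>. bump \<xi> \<partial>mu) = complex_of_real \<kappa>"
  proof -
    have "(\<integral>\<xi>. complex_of_real (bump \<xi>) \<partial>mu) = complex_of_real \<kappa>"
      unfolding \<kappa>_def by (rule integral_complex_of_real)
    moreover have "complex_of_real (bump \<xi>) = bump \<xi>" for \<xi> :: "real^'n" by (simp add: indicator_def)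
    ultimately show ?thesis by (simp only:)
  qed
  have p_int: "(\<integral>\<xi>. p \<xi> \<partial>mu) = of_real P"
    unfolding p_def integral_cpow[OF bdd_integrable_indicator_cball(2)] bI by (simp add: P_def)
  have p_L1: "(\<integral>\<xi>. cmod (p \<xi>) \<partial>mu) \<le> P"
    unfolding p_def P_def
  proof (rule cpow_L1_bound[OF bdd_integrable_indicator_cball(2)])
    have "cmod (bump \<xi>) = bump \<xi>" for \<xi> :: "real^'n" by (simp add: indicator_def)
    then show "(\<integral>\<xi>. cmod (bump \<xi>) \<partial>mu) \<le> \<kappa>" by (simp only: \<kappa>_def order_refl)
  qed
  \<comment> \<open>An \<open>(m + 1)\<close>-fold convolution of unit bumps lives in the ball of
    radius \<open>m + 1\<close>, so the cutoff loses none of the resonant mass.\<close>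
  have ep: "e \<xi> * p \<xi> = p \<xi>" for \<xi>
  proof (cases "\<xi> \<in> cball 0 (real (Suc m))")
    case False
    then have "p \<xi> = 0" unfolding p_def by (intro cpow_support[where a=1]) (auto simp: indicator_def)
    then show ?thesis by simp
  qed (simp add: e_def)
  define \<rho> where "\<rho> t = cos (t * real N) ^ m * cos (t * (real m * real N))" for t
  define \<gamma> where "\<gamma> t = real (Suc m) * A ^ Suc m * \<rho> t" for t
  have gam: "of_nat (Suc m) * of_real (\<alpha> t) ^ m * of_real (\<beta> t) = complex_of_real (\<gamma> t)" for t
    by (simp add: \<gamma>_def \<rho>_def \<alpha>_def \<beta>_def power_mult_distrib mult_ac)
  have gam_le: "\<bar>\<gamma> t\<bar> \<le> real (Suc m) * A ^ Suc m" for t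
  proof -
    have "\<bar>\<rho> t\<bar> \<le> 1"
      unfolding \<rho>_def abs_mult power_abs by (intro mult_le_one power_le_one) auto
    then show ?thesis unfolding \<gamma>_def abs_mult using A mult_left_mono[of "\<bar>\<rho> t\<bar>" 1 "real (Suc m) * A ^ Suc m"]
      by (simp add: abs_mult)
  qed
  have low: "AE \<xi> in mu. norm \<xi> \<le> real (Suc m) \<longrightarrow> cpow M m (L t) \<xi> = of_real (\<gamma> t) * p \<xi>" for t
    using cpow_two_bumps_low_frequency[where N=N and M=M and m=m and i=i and \<alpha>="of_real (\<alpha> t)" and \<beta>="of_real (\<beta> t)"] N
    unfolding gam p_def L_def[abs_def] b1_def b2_def by simp
  define J where "J t = (\<integral>\<xi>. e \<xi> * (of_real (wave_symbol (T - t) (norm \<xi>)) * cpow M m (V t) \<xi>) \<partial>mu)" for t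
  \<comment> \<open>The error of the frequency integral at a single time: the first term stems from
    \<open>V\<close> versus \<open>L\<close>, the second from the propagator versus
    \<open>T - t\<close> on the cutoff ball, whose radius \<open>m + 1\<close> bounds the
    frequency.\<close>
  define B where "B = T * (K * \<Delta>) + T\<^sup>2 * real (Suc m) * Q"
  have J: "cmod (J t - of_real (P * (real (Suc m) * A ^ Suc m) * ((T - t) * \<rho> t))) \<le> B" if t: "t \<in> {0..T}" for t
  proof -
    let ?w = "\<lambda>\<xi>. complex_of_real (wave_symbol (T - t) (norm \<xi>))"
    let ?s = "complex_of_real (T - t)" and ?g = "complex_of_real (\<gamma> t)"
    let ?D = "\<lambda>\<xi>. cmod (cpow M m (V t) \<xi> - cpow M m (L t) \<xi>)"
    have tt: "0 \<le> T - t" "T - t \<le> T" using t by auto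
    have bV: "bdd_integrable M (cpow M m (V t))" by (intro bdd_integrable_cpow bdd_integrable_V t)
    have wV: "bdd_integrable M (\<lambda>\<xi>. ?w \<xi> * cpow M m (V t) \<xi>)"
    proof (rule bdd_integrable_mult[OF bV, where C=T])
      show "norm (?w \<xi>) \<le> T" for \<xi>
        using order_trans[OF abs_wave_symbol_le[of "T - t" "norm \<xi>"], of T] tt by simp
    qed (auto intro!: borel_measurable_of_real)
    have eV: "integrable mu (\<lambda>\<xi>. e \<xi> * (?w \<xi> * cpow M m (V t) \<xi>))"
      by (rule bdd_integrableD(1)[OF bdd_integrable_mult[OF wV em e1]])
    have e_p: "integrable mu (\<lambda>\<xi>. ?s * ?g * (e \<xi> * p \<xi>))"
      unfolding ep by (intro integrable_mult_right bdd_integrableD(1)[OF pI])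
    have main: "of_real (P * (real (Suc m) * A ^ Suc m) * ((T - t) * \<rho> t)) = (\<integral>\<xi>. ?s * ?g * (e \<xi> * p \<xi>) \<partial>mu)"
      unfolding ep by (simp add: p_int \<gamma>_def)
    have eq: "J t - of_real (P * (real (Suc m) * A ^ Suc m) * ((T - t) * \<rho> t)) = (\<integral>\<xi>. e \<xi> * (?w \<xi> * cpow M m (V t) \<xi>) - ?s * ?g * (e \<xi> * p \<xi>) \<partial>mu)"
      unfolding main J_def by (rule Bochner_Integration.integral_diff[OF eV e_p, symmetric])
    have "cmod (J t - of_real (P * (real (Suc m) * A ^ Suc m) * ((T - t) * \<rho> t))) \<le> (\<integral>\<xi>. cmod (e \<xi> * (?w \<xi> * cpow M m (V t) \<xi>) - ?s * ?g * (e \<xi> * p \<xi>)) \<partial>mu)"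
      unfolding eq by (rule integral_norm_bound)
    also have "\<dots> \<le> (\<integral>\<xi>. T * ?D \<xi> + T\<^sup>2 * real (Suc m) * (real (Suc m) * A ^ Suc m) * cmod (p \<xi>) \<partial>mu)"
    proof (rule integral_mono_AE)
      show "integrable mu (\<lambda>\<xi>. cmod (e \<xi> * (?w \<xi> * cpow M m (V t) \<xi>) - ?s * ?g * (e \<xi> * p \<xi>)))"
        by (intro integrable_norm Bochner_Integration.integrable_diff eV e_p)
      show "integrable mu (\<lambda>\<xi>. T * ?D \<xi> + T\<^sup>2 * real (Suc m) * (real (Suc m) * A ^ Suc m) * cmod (p \<xi>))"
        by (intro Bochner_Integration.integrable_add integrable_mult_right integrable_norm bdd_integrableD(1) bdd_integrable_diff bV bdd_integrable_cpow Li pI)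
      show "AE \<xi> in mu. cmod (e \<xi> * (?w \<xi> * cpow M m (V t) \<xi>) - ?s * ?g * (e \<xi> * p \<xi>)) \<le> T * ?D \<xi> + T\<^sup>2 * real (Suc m) * (real (Suc m) * A ^ Suc m) * cmod (p \<xi>)"
        using low[of t]
      proof eventually_elim
        case (elim \<xi>)
        show ?case
        proof (cases "norm \<xi> \<le> real (Suc m)")
          case False
          then show ?thesis using T0 A by (simp add: e_def indicator_def)
        next
          case True
          then have e: "e \<xi> = 1" by (simp add: e_def)
          have Lp: "cpow M m (L t) \<xi> = ?g * p \<xi>" using elim True by simp
          have "e \<xi> * (?w \<xi> * cpow M m (V t) \<xi>) - ?s * ?g * (e \<xi> * p \<xi>) = ?w \<xi> * (cpow M m (V t) \<xi> - cpow M m (L t) \<xi>) + (?w \<xi> - ?s) * ?g * p \<xi>"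
            unfolding e Lp by (simp add: algebra_simps)
          also have "cmod \<dots> \<le> \<bar>wave_symbol (T - t) (norm \<xi>)\<bar> * ?D \<xi> + \<bar>wave_symbol (T - t) (norm \<xi>) - (T - t)\<bar> * \<bar>\<gamma> t\<bar> * cmod (p \<xi>)"
            by (rule order_trans[OF norm_triangle_ineq])
               (simp only: norm_mult norm_of_real of_real_diff[symmetric] order_refl)
          also have "\<dots> \<le> T * ?D \<xi> + T\<^sup>2 * real (Suc m) * (real (Suc m) * A ^ Suc m) * cmod (p \<xi>)"
          proof (intro add_mono mult_right_mono mult_mono gam_le)
            show "\<bar>wave_symbol (T - t) (norm \<xi>)\<bar> \<le> T" using abs_wave_symbol_le[of "T - t" "norm \<xi>"] tt by simp
            have "\<bar>wave_symbol (T - t) (norm \<xi>) - (T - t)\<bar> \<le> (T - t)\<^sup>2 * norm \<xi>"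
              by (rule wave_symbol_approx[OF tt(1)]) simp
            also have "\<dots> \<le> T\<^sup>2 * real (Suc m)" using tt True by (intro mult_mono power_mono) auto
            finally show "\<bar>wave_symbol (T - t) (norm \<xi>) - (T - t)\<bar> \<le> T\<^sup>2 * real (Suc m)" .
          qed auto
          finally show ?thesis .
        qed
      qed
    qed
    also have "\<dots> = T * (\<integral>\<xi>. ?D \<xi> \<partial>mu) + T\<^sup>2 * real (Suc m) * (real (Suc m) * A ^ Suc m) * (\<integral>\<xi>. cmod (p \<xi>) \<partial>mu)"
    proof -
      have "integrable mu (\<lambda>\<xi>. ?D \<xi>)" "integrable mu (\<lambda>\<xi>. cmod (p \<xi>))"
        by (intro integrable_norm bdd_integrableD(1) bdd_integrable_diff bV bdd_integrable_cpow Li pI)+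
      then show ?thesis
        by (simp only: Bochner_Integration.integral_add integrable_mult_right Bochner_Integration.integral_mult_right_zero)
    qed
    also have "\<dots> \<le> T * (K * \<Delta>) + T\<^sup>2 * real (Suc m) * (real (Suc m) * A ^ Suc m) * P"
      using T0 A by (intro add_mono mult_left_mono pVL t p_L1 mult_nonneg_nonneg) auto
    finally show ?thesis by (simp only: B_def Q mult.assoc)
  qed
  define Z where "Z = (\<integral>\<xi>. e \<xi> * duhamel V T \<xi> \<partial>mu)"
  have Z: "Z = (LINT t:{0..T}|lborel. J t)" and Ji: "set_integrable lborel {0..T} J"
    using duhamel_pairing[OF em e1 TT] by (simp_all add: Z_def J_def[abs_def])
  let ?r = "\<lambda>t. P * (real (Suc m) * A ^ Suc m) * ((T - t) * \<rho> t)"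
  have \<rho>i: "T\<^sup>2 / 2 ^ Suc m \<le> (LINT t:{0..T}|lborel. (T - t) * \<rho> t)" "set_integrable lborel {0..T} (\<lambda>t. (T - t) * \<rho> t)"
    unfolding \<rho>_def by (rule resonant_time_integral[OF T0])+
  have ri: "set_integrable lborel {0..T} (\<lambda>t. complex_of_real (?r t))"
    using set_integrable_mult_right[OF \<rho>i(2), of "P * (real (Suc m) * A ^ Suc m)"]
    unfolding set_integrable_def by (simp only: scaleR_conv_of_real of_real_mult[symmetric] of_real_eq_id id_def integrable_of_real)
  \<comment> \<open>The resonant main term: a real time integral to which positivity applies and
    from which \<open>Z\<close> differs by at most \<open>T * B\<close>.\<close>
  define I where "I = (LINT t:{0..T}|lborel. ?r t)"
  have "cmod (Z - of_real I) \<le> T * B"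
  proof -
    have "Z - of_real I = (LINT t:{0..T}|lborel. J t - of_real (?r t))"
      unfolding Z I_def by (simp only: set_integral_diff(2)[OF Ji ri] set_integral_complex_of_real)
    also have "cmod \<dots> \<le> T * B" by (rule time_integral_bound[OF T0 J])
    finally show ?thesis .
  qed
  moreover have "Q * (T\<^sup>2 / 2 ^ Suc m) \<le> I"
  proof -
    have rQ: "I = Q * (LINT t:{0..T}|lborel. (T - t) * \<rho> t)"
      by (simp only: I_def set_integral_mult_right Q mult.commute[of P])
    have Q0: "0 \<le> Q" unfolding Q using A P0 by simp
    show ?thesis unfolding rQ by (rule mult_left_mono[OF \<rho>i(1) Q0])
  qed
  moreover have "I \<le> cmod (of_real I)" by simp
  moreover have "cmod (of_real I) \<le> cmod Z + cmod (Z - of_real I)"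
    using norm_triangle_ineq3[of "of_real I" Z] by (simp only: norm_minus_commute[of Z])
  ultimately have Zge: "Q * (T\<^sup>2 / 2 ^ Suc m) - T * B \<le> cmod Z" by linarith
  have ef: "integrable mu (\<lambda>\<xi>. e \<xi> * free T \<xi>)"
  proof (rule bdd_integrableD(1)[OF bdd_integrable_mult[OF _ em e1]])
    show "bdd_integrable M (free T)"
      by (rule bdd_integrable_section[OF free_measurable g]) (rule free_le[OF TT])
  qed
  have eV: "integrable mu (\<lambda>\<xi>. e \<xi> * V T \<xi>)"
    by (rule bdd_integrableD(1)[OF bdd_integrable_mult[OF bdd_integrable_V[OF TT] em e1]])
  \<comment> \<open>On the cutoff ball both bumps vanish, because \<open>m + 3 \<le> N\<close> keeps
    their centres at distance at least \<open>2\<close> from it; only \<open>w\<close> and the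
    velocity remain.\<close>
  have fW: "cmod (\<integral>\<xi>. e \<xi> * free T \<xi> \<partial>mu) \<le> W"
  proof -
    have "cmod (e \<xi> * free T \<xi>) \<le> cmod (w \<xi>) + cmod (v1 \<xi>)" for \<xi>
    proof (cases "norm \<xi> \<le> real (Suc m)")
      case True
      have off: "bump (\<xi> - b) = (0::complex)" if "real N \<le> norm b" for b
      proof -
        have "norm b \<le> norm (\<xi> - b) + norm \<xi>" using norm_triangle_ineq4[of \<xi> "\<xi> - b"] by simp
        then have "1 < norm (\<xi> - b)" using that True N by simp
        then show ?thesis by (simp add: indicator_def)
      qed
      have "real N \<le> real (m * N)" using mult_le_mono1[OF m, of N] by (simp only: of_nat_le_iff mult_1)
      then have "v0 \<xi> = w \<xi>" using off[of b1] off[of b2] by (simp add: v0_eq nb)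
      then have "cmod (free T \<xi>) \<le> \<bar>cos (T * norm \<xi>)\<bar> * cmod (w \<xi>) + \<bar>wave_symbol T (norm \<xi>)\<bar> * cmod (v1 \<xi>)"
        unfolding free_def by (intro order_trans[OF norm_triangle_ineq]) (simp add: norm_mult)
      also have "\<dots> \<le> 1 * cmod (w \<xi>) + 1 * cmod (v1 \<xi>)"
        using abs_wave_symbol_le[of T "norm \<xi>"] T T1 by (intro add_mono mult_right_mono) auto
      finally show ?thesis using True by (simp add: e_def)
    qed (simp add: e_def)
    then have "(\<integral>\<xi>. cmod (e \<xi> * free T \<xi>) \<partial>mu) \<le> (\<integral>\<xi>. cmod (w \<xi>) + cmod (v1 \<xi>) \<partial>mu)"
      by (intro integral_mono integrable_norm ef Bochner_Integration.integrable_add iw iv1)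
    also have "\<dots> = W" using iw iv1 by (simp add: W_def)
    finally show ?thesis by (rule order_trans[OF integral_norm_bound])
  qed
  have Z': "of_real \<sigma> * Z = (\<integral>\<xi>. e \<xi> * V T \<xi> \<partial>mu) - (\<integral>\<xi>. e \<xi> * free T \<xi> \<partial>mu)"
  proof -
    have "of_real \<sigma> * Z = (\<integral>\<xi>. of_real \<sigma> * (e \<xi> * duhamel V T \<xi>) \<partial>mu)"
      unfolding Z_def by (rule Bochner_Integration.integral_mult_right_zero[symmetric])
    also have "\<dots> = (\<integral>\<xi>. e \<xi> * V T \<xi> - e \<xi> * free T \<xi> \<partial>mu)"
      by (intro Bochner_Integration.integral_cong refl) (simp add: V_eq[OF TT] algebra_simps)
    also have "\<dots> = (\<integral>\<xi>. e \<xi> * V T \<xi> \<partial>mu) - (\<integral>\<xi>. e \<xi> * free T \<xi> \<partial>mu)"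
      by (rule Bochner_Integration.integral_diff[OF eV ef])
    finally show ?thesis .
  qed
  \<comment> \<open>The sign of the nonlinearity disappears in the modulus, so both equations are
    treated at once.\<close>
  have "cmod Z = cmod (of_real \<sigma> * Z)" by (simp add: norm_mult sigma)
  also have "\<dots> \<le> cmod (\<integral>\<xi>. e \<xi> * V T \<xi> \<partial>mu) + W"
    unfolding Z' using norm_triangle_ineq4[of "\<integral>\<xi>. e \<xi> * V T \<xi> \<partial>mu" "\<integral>\<xi>. e \<xi> * free T \<xi> \<partial>mu"] fW by linarith
  finally have "cmod Z - W \<le> cmod (\<integral>\<xi>. e \<xi> * V T \<xi> \<partial>mu)" by simp
  moreover have "T\<^sup>2 * (Q / 2 ^ Suc m - K * \<Delta> - T * (real (Suc m) * Q)) = Q * (T\<^sup>2 / 2 ^ Suc m) - T * B"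
    by (simp add: B_def power2_eq_square algebra_simps)
  ultimately show ?thesis using Zge by (simp only: e_def)
qed

section \<open>Norm inflation\<close>

lemma japanese_powr_le_1: "s \<le> 0 \<Longrightarrow> japanese \<xi> powr s \<le> 1"
  using powr_mono[of s 0 "japanese \<xi>"] japanese_ge_1[of \<xi>] japanese_pos[of \<xi>] by simp

text \<open>A bounded integrable function is square integrable, and for \<open>s \<le> 0\<close> the
  weight is at most \<open>1\<close>.\<close>

lemma bdd_integrable_Hs:
  fixes f :: "real^'n::finite \<Rightarrow> complex"
  assumes f: "bdd_integrable M f" and s: "s \<le> 0"
  shows "integrable (dual_measure M) (\<lambda>\<xi>. (japanese \<xi> powr s * cmod (f \<xi>))\<^sup>2)"
proof -
  note [measurable] = japanese_powr_measurable bdd_integrableD(2)[OF f]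
  obtain B where B: "0 \<le> B" "\<And>\<xi>. \<xi> \<in> space (dual_measure M) \<Longrightarrow> cmod (f \<xi>) \<le> B" using bdd_integrable_bound[OF f] by blast
  have "integrable (dual_measure M) (\<lambda>\<xi>. B * cmod (f \<xi>))"
    by (intro integrable_mult_right integrable_norm bdd_integrableD(1)[OF f])
  then show ?thesis
  proof (rule Bochner_Integration.integrable_bound)
    show "AE \<xi> in dual_measure M. norm ((japanese \<xi> powr s * cmod (f \<xi>))\<^sup>2) \<le> norm (B * cmod (f \<xi>))"
    proof (rule AE_I2)
      fix \<xi> :: "real^'n" assume x: "\<xi> \<in> space (dual_measure M)"
      have "japanese \<xi> powr s * cmod (f \<xi>) \<le> 1 * cmod (f \<xi>)"
        by (intro mult_right_mono japanese_powr_le_1 s) simp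
      then have "(japanese \<xi> powr s * cmod (f \<xi>))\<^sup>2 \<le> cmod (f \<xi>) * cmod (f \<xi>)"
        by (simp add: power2_eq_square[of "cmod (f \<xi>)", symmetric] power_mono)
      also have "\<dots> \<le> B * cmod (f \<xi>)" by (intro mult_right_mono B x) simp
      finally show "norm ((japanese \<xi> powr s * cmod (f \<xi>))\<^sup>2) \<le> norm (B * cmod (f \<xi>))"
        using B(1) by simp
    qed
  qed measurable
qed

text \<open>On the ball the weight is at least \<open>(1 + r) powr s\<close>. The elementary
  \<open>y \<le> y^2 + 1\<close> replaces Cauchy-Schwarz: a bound by the squared norm plus the
  measure of the ball is enough, since the left side will be made as large as desired.\<close>

lemma low_frequency_le_Hs:
  fixes f :: "real^'n::finite \<Rightarrow> complex" and r :: real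
  assumes f: "bdd_integrable M f" and s: "s \<le> 0"
  shows "cmod (\<integral>\<xi>. indicator (cball 0 r) \<xi> * f \<xi> \<partial>dual_measure M)
    \<le> (1 + r) powr (- s) * ((\<integral>\<xi>. (japanese \<xi> powr s * cmod (f \<xi>))\<^sup>2 \<partial>dual_measure M) + (\<integral>(\<xi>::real^'n). indicator (cball 0 r) \<xi> \<partial>dual_measure M))"
proof -
  let ?m = "dual_measure M :: (real^'n) measure"
  let ?y = "\<lambda>\<xi>. japanese \<xi> powr s * cmod (f \<xi>)"
  have i: "integrable ?m (\<lambda>\<xi>. (?y \<xi>)\<^sup>2)" by (rule bdd_integrable_Hs[OF f s])
  have "integrable ?m (\<lambda>\<xi>. indicator (cball 0 r) \<xi> * f \<xi>)"
  proof (rule bdd_integrableD(1)[OF bdd_integrable_mult[OF f, of _ 1]])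
    show "(indicator (cball 0 r) :: _ \<Rightarrow> complex) \<in> borel_measurable ?m"
      by (rule bdd_integrableD(2)[OF bdd_integrable_indicator_cball(2)])
  qed (simp add: indicator_def)
  then have i2: "integrable ?m (\<lambda>\<xi>. cmod (indicator (cball 0 r) \<xi> * f \<xi>))" by (rule integrable_norm)
  have pw: "cmod (indicator (cball 0 r) \<xi> * f \<xi>) \<le> (1 + r) powr (- s) * ((?y \<xi>)\<^sup>2 + indicator (cball 0 r) \<xi>)" for \<xi> :: "real^'n"
  proof (cases "norm \<xi> \<le> r")
    case True
    have "japanese \<xi> \<le> 1 + norm \<xi>"
      unfolding japanese_def by (rule real_le_lsqrt) (simp_all add: power2_sum)
    then have "japanese \<xi> \<le> 1 + r" using True by simp
    then have J: "japanese \<xi> powr (- s) \<le> (1 + r) powr (- s)"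
      using s japanese_pos[of \<xi>] by (intro powr_mono2) auto
    have "cmod (f \<xi>) = japanese \<xi> powr (- s) * ?y \<xi>"
      using japanese_pos[of \<xi>] by (simp add: mult.assoc[symmetric] powr_add[symmetric])
    also have "\<dots> \<le> (1 + r) powr (- s) * ?y \<xi>" by (rule mult_right_mono[OF J]) simp
    also have "?y \<xi> \<le> (?y \<xi>)\<^sup>2 + 1"
    proof -
      have "2 * ?y \<xi> \<le> (?y \<xi>)\<^sup>2 + 1"
        using zero_le_power2[of "?y \<xi> - 1"] unfolding power2_diff by simp
      moreover have "0 \<le> ?y \<xi>" by simp
      ultimately show ?thesis by linarith
    qed
    finally show ?thesis using True by (simp add: mult_left_mono)
  qed simp
  have "cmod (\<integral>\<xi>. indicator (cball 0 r) \<xi> * f \<xi> \<partial>?m) \<le> (\<integral>\<xi>. cmod (indicator (cball 0 r) \<xi> * f \<xi>) \<partial>?m)"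
    by (rule integral_norm_bound)
  also have "\<dots> \<le> (\<integral>\<xi>. (1 + r) powr (- s) * ((?y \<xi>)\<^sup>2 + indicator (cball 0 r) \<xi>) \<partial>?m)"
    by (intro integral_mono i2 pw integrable_mult_right Bochner_Integration.integrable_add i integrable_indicator_cball)
  also have "\<dots> = (1 + r) powr (- s) * ((\<integral>\<xi>. (?y \<xi>)\<^sup>2 \<partial>?m) + (\<integral>\<xi>. indicator (cball 0 r) \<xi> \<partial>?m))"
    by (simp only: Bochner_Integration.integral_mult_right_zero Bochner_Integration.integral_add[OF i integrable_indicator_cball])
  finally show ?thesis .
qed

lemma translated_bump:
  fixes b :: "real^'n::finite"
  assumes b: "b \<in> space (dual_measure M)"
  shows "bdd_integrable M (\<lambda>\<xi>. bump (\<xi> - b) :: complex)" "bdd_integrable M (\<lambda>\<xi>. bump (\<xi> - b) :: real)"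
    and "(\<integral>\<xi>. bump (\<xi> - b) \<partial>dual_measure M) = (\<integral>\<xi>. bump \<xi> \<partial>(dual_measure M :: (real^'n) measure) :: real)"
proof -
  show "bdd_integrable M (\<lambda>\<xi>. bump (\<xi> - b) :: complex)" "bdd_integrable M (\<lambda>\<xi>. bump (\<xi> - b) :: real)"
    by (intro bdd_integrable_shift bdd_integrable_indicator_cball b)+
  show "(\<integral>\<xi>. bump (\<xi> - b) \<partial>dual_measure M) = (\<integral>\<xi>. bump \<xi> \<partial>(dual_measure M :: (real^'n) measure) :: real)"
    using dual_affine(2)[OF space_dual_uminus[OF b] disjI1[OF refl] integrable_indicator_cball[of M 1]] by simp
qed

text \<open>Both bumps live where \<open>norm \<xi> \<ge> n - 1\<close>, so the weight there is at
  most \<open>(n - 1) powr s\<close>. Overlap of the bumps is allowed: their sum \<open>q\<close>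
  takes values in \<open>{0, 1, 2}\<close>, whence \<open>q^2 \<le> 2 * q\<close>.\<close>

lemma bumps_Hs_bound:
  fixes b1 b2 :: "real^'n::finite" and n A :: real
  assumes b: "b1 \<in> space (dual_measure M)" "b2 \<in> space (dual_measure M)"
    and n: "1 < n" "n \<le> norm b1" "n \<le> norm b2" and s: "s < 0"
  shows "(\<integral>\<xi>. (japanese \<xi> powr s * cmod (of_real A * (bump (\<xi> - b1) + bump (\<xi> - b2))))\<^sup>2 \<partial>dual_measure M)
    \<le> ((n - 1) powr s)\<^sup>2 * (4 * A\<^sup>2 * (\<integral>\<xi>. bump \<xi> \<partial>(dual_measure M :: (real^'n) measure)))"
proof -
  let ?m = "dual_measure M :: (real^'n) measure"
  let ?q = "\<lambda>\<xi>. bump (\<xi> - b1) + bump (\<xi> - b2) :: real"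
  have i: "bdd_integrable M (\<lambda>\<xi>. of_real A * (bump (\<xi> - b1) + bump (\<xi> - b2)) :: complex)"
    by (intro bdd_integrable_cmult bdd_integrable_add translated_bump b)
  have iq: "integrable ?m (\<lambda>\<xi>. bump (\<xi> - b1) :: real)" "integrable ?m (\<lambda>\<xi>. bump (\<xi> - b2) :: real)"
    using bdd_integrableD(1) translated_bump(2) b by blast+
  have pw: "(japanese \<xi> powr s * cmod (of_real A * (bump (\<xi> - b1) + bump (\<xi> - b2))))\<^sup>2 \<le> ((n - 1) powr s)\<^sup>2 * (2 * A\<^sup>2 * ?q \<xi>)" for \<xi>
  proof (cases "?q \<xi> = 0")
    case False
    have far: "n - 1 \<le> norm \<xi>" if "norm (\<xi> - b) \<le> 1" "n \<le> norm b" for b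
      using norm_triangle_ineq2[of b \<xi>] that by (simp add: norm_minus_commute)
    have "n - 1 \<le> norm \<xi>"
    proof (cases "norm (\<xi> - b1) \<le> 1")
      case F: False
      then have "norm (\<xi> - b2) \<le> 1" using False by (auto simp: indicator_def split: if_splits)
      then show ?thesis using far n by blast
    qed (use far n in blast)
    then have "n - 1 \<le> japanese \<xi>" using norm_le_japanese[of \<xi>] by linarith
    then have J: "japanese \<xi> powr s \<le> (n - 1) powr s" using n s by (intro powr_mono2') auto
    have c: "(cmod (of_real A * (bump (\<xi> - b1) + bump (\<xi> - b2))))\<^sup>2 \<le> 2 * A\<^sup>2 * ?q \<xi>"
      by (simp add: norm_mult power_mult_distrib indicator_def)
    have "(japanese \<xi> powr s * cmod (of_real A * (bump (\<xi> - b1) + bump (\<xi> - b2))))\<^sup>2 = (japanese \<xi> powr s)\<^sup>2 * (cmod (of_real A * (bump (\<xi> - b1) + bump (\<xi> - b2))))\<^sup>2"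
      by (rule power_mult_distrib)
    also have "\<dots> \<le> ((n - 1) powr s)\<^sup>2 * (2 * A\<^sup>2 * ?q \<xi>)"
      by (intro mult_mono c power_mono J) auto
    finally show ?thesis .
  next
    case True
    then have "bump (\<xi> - b1) = (0::complex)" "bump (\<xi> - b2) = (0::complex)"
      by (auto simp: indicator_def of_bool_def split: if_splits)
    then show ?thesis using True by simp
  qed
  have "(\<integral>\<xi>. (japanese \<xi> powr s * cmod (of_real A * (bump (\<xi> - b1) + bump (\<xi> - b2))))\<^sup>2 \<partial>?m) \<le> (\<integral>\<xi>. ((n - 1) powr s)\<^sup>2 * (2 * A\<^sup>2 * ?q \<xi>) \<partial>?m)"
    by (intro integral_mono pw bdd_integrable_Hs i integrable_mult_right Bochner_Integration.integrable_add iq) (use s in simp)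
  also have "\<dots> = ((n - 1) powr s)\<^sup>2 * (2 * A\<^sup>2 * (2 * (\<integral>\<xi>. bump \<xi> \<partial>?m)))"
    by (simp only: Bochner_Integration.integral_mult_right_zero Bochner_Integration.integral_add[OF iq] translated_bump(3)[OF b(1)] translated_bump(3)[OF b(2)] mult_2)
  finally show ?thesis by simp
qed

text \<open>The amplitude tends to infinity and the time to zero while \<open>T\<^sup>2 A\<^sup>m = \<theta>\<close> stays fixed, so that the
  iteration still converges but the resonant term, of size \<open>T\<^sup>2 A\<^sup>m\<^sup>+\<^sup>1\<close>, diverges.\<close>

lemma inflation_parameters:
  fixes c \<kappa> W H \<epsilon> :: real
  assumes m: "1 \<le> m" and c: "0 < c" and k: "0 < \<kappa>" and W: "0 \<le> W" and eps: "0 < \<epsilon>"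
  defines "D \<equiv> 1 + 2 * \<kappa>"
  obtains A T :: real where "0 < T" "T \<le> 1" "T < \<epsilon>" "0 \<le> A" "W \<le> A"
    "T\<^sup>2 * c ^ m * (2 * (D * A)) ^ m \<le> 1 / 2"
    "H < T\<^sup>2 * (real (Suc m) * A ^ Suc m * (c ^ m * \<kappa> ^ Suc m) / 2 ^ Suc m
      - real (Suc m) * c ^ m * (2 * D * A) ^ m * (W + 2 * A * T * \<kappa> + T\<^sup>2 * (c ^ m * (2 * D * A) ^ Suc m))
      - T * (real (Suc m) * (real (Suc m) * A ^ Suc m * (c ^ m * \<kappa> ^ Suc m)))) - W"
proof -
  define Q0 where "Q0 = real (Suc m) * (c ^ m * \<kappa> ^ Suc m)"
  define q where "q = Q0 / 2 ^ Suc m"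
  define K0 where "K0 = real (Suc m) * c ^ m * (2 * D) ^ m"
  define E where "E = c ^ m * (2 * D) ^ Suc m"
  define a where "a = c ^ m * (2 * D) ^ m"
  have D: "0 < D" using k by (simp add: D_def)
  have pos: "0 < Q0" "0 < q" "0 < K0" "0 < E" "0 < a"
    using c k D by (simp_all add: Q0_def q_def K0_def E_def a_def)
  \<comment> \<open>The bound \<open>1 / (2 * a)\<close> secures the Picard smallness condition;
    \<open>q / (4 * (K0 * E))\<close> keeps the part of the remainder quadratic in
    \<open>T^2 A^m\<close> below a quarter of the resonant coefficient \<open>q\<close>.\<close>
  define \<theta> where "\<theta> = min 1 (min (1 / (2 * a)) (q / (4 * (K0 * E))))"
  have th: "0 < \<theta>" "\<theta> \<le> 1" using pos by (simp_all add: \<theta>_def)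
  have th_a: "\<theta> * a \<le> 1 / 2"
  proof -
    have "\<theta> \<le> 1 / (2 * a)" by (simp add: \<theta>_def)
    then show ?thesis using pos by (simp add: field_simps)
  qed
  have th_q: "K0 * (\<theta> * E) \<le> q / 4"
  proof -
    have "\<theta> \<le> q / (4 * (K0 * E))" by (simp add: \<theta>_def)
    then show ?thesis using pos by (simp add: field_simps)
  qed
  define T where "T A = sqrt (\<theta> / A ^ m)" for A
  have T0: "(T \<longlongrightarrow> 0) at_top"
  proof -
    have "filterlim (\<lambda>A::real. A ^ m) at_top at_top"
      using m by (intro filterlim_pow_at_top filterlim_ident) simp
    then have "((\<lambda>A. \<theta> / A ^ m) \<longlongrightarrow> 0) at_top"
      by (intro tendsto_divide_0[OF tendsto_const] filterlim_at_top_imp_at_infinity)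
    from tendsto_real_sqrt[OF this] show ?thesis by (simp add: T_def[abs_def])
  qed
  have WA: "((\<lambda>A. W / A) \<longlongrightarrow> 0) at_top"
    by (intro tendsto_divide_0[OF tendsto_const] filterlim_at_top_imp_at_infinity filterlim_ident)
  define F where "F A = K0 * (W / A + 2 * T A * \<kappa>) + T A * (real (Suc m) * Q0)" for A
  have "(F \<longlongrightarrow> K0 * (0 + 2 * 0 * \<kappa>) + 0 * (real (Suc m) * Q0)) at_top"
    unfolding F_def by (intro tendsto_intros T0 WA)
  then have "eventually (\<lambda>A. F A < q / 4) at_top"
    using pos by (intro order_tendstoD(2)) auto
  moreover have "eventually (\<lambda>A. T A < min 1 \<epsilon>) at_top"
    using T0 eps by (intro order_tendstoD(2)) auto
  moreover have "eventually (\<lambda>A. max 1 (max W ((H + W + 1) / (\<theta> * (q / 2)))) \<le> A) at_top"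
    by (rule eventually_ge_at_top)
  ultimately have "eventually (\<lambda>A. F A < q / 4 \<and> T A < min 1 \<epsilon> \<and> max 1 (max W ((H + W + 1) / (\<theta> * (q / 2)))) \<le> A) at_top"
    by eventually_elim simp
  then obtain A where A: "F A < q / 4" "T A < min 1 \<epsilon>" "max 1 (max W ((H + W + 1) / (\<theta> * (q / 2)))) \<le> A"
    by (auto dest: eventually_happens)
  have A1: "1 \<le> A" "W \<le> A" "(H + W + 1) / (\<theta> * (q / 2)) \<le> A" using A(3) by auto
  have Ap: "0 < A" using A1 by simp
  have T2: "(T A)\<^sup>2 * A ^ m = \<theta>"
    using th Ap by (simp add: T_def)
  have Tp: "0 < T A" using th Ap by (simp add: T_def)
  show ?thesis
  proof (rule that[of "T A" A])
    show "0 < T A" "T A \<le> 1" "T A < \<epsilon>" "0 \<le> A" "W \<le> A" using Tp A A1 by auto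
    have "(T A)\<^sup>2 * c ^ m * (2 * (D * A)) ^ m = ((T A)\<^sup>2 * A ^ m) * a"
      by (simp add: a_def power_mult_distrib mult_ac)
    then show "(T A)\<^sup>2 * c ^ m * (2 * (D * A)) ^ m \<le> 1 / 2" using th_a by (simp only: T2)
    have "(T A)\<^sup>2 * (real (Suc m) * A ^ Suc m * (c ^ m * \<kappa> ^ Suc m) / 2 ^ Suc m
      - real (Suc m) * c ^ m * (2 * D * A) ^ m * (W + 2 * A * T A * \<kappa> + (T A)\<^sup>2 * (c ^ m * (2 * D * A) ^ Suc m))
      - T A * (real (Suc m) * (real (Suc m) * A ^ Suc m * (c ^ m * \<kappa> ^ Suc m))))
      = ((T A)\<^sup>2 * A ^ m) * (A * q - K0 * (W + 2 * A * T A * \<kappa> + ((T A)\<^sup>2 * A ^ m) * A * E) - A * (T A * (real (Suc m) * Q0)))"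
    proof -
      have 1: "real (Suc m) * A ^ Suc m * (c ^ m * \<kappa> ^ Suc m) = A ^ m * (A * Q0)" by (simp add: Q0_def mult_ac)
      have 2: "real (Suc m) * c ^ m * (2 * D * A) ^ m = A ^ m * K0" by (simp add: K0_def power_mult_distrib mult_ac)
      have 3: "c ^ m * (2 * D * A) ^ Suc m = A ^ m * (A * E)" by (simp add: E_def power_mult_distrib mult_ac)
      show ?thesis unfolding 1 2 3 q_def by (simp add: right_diff_distrib mult_ac)
    qed
    \<comment> \<open>With \<open>F A\<close> and the quadratic remainder each at most
      \<open>q / 4\<close>, at least \<open>q / 2\<close> survives, and the expression grows
      linearly in \<open>A\<close>.\<close>
    also have "\<dots> = \<theta> * A * (q - F A - K0 * (\<theta> * E))"
      unfolding T2 F_def using Ap by (simp add: field_simps)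
    also have "\<dots> \<ge> \<theta> * A * (q / 2)"
      using th Ap A(1) th_q by (intro mult_left_mono) auto
    finally have "\<theta> * A * (q / 2) \<le> (T A)\<^sup>2 * (real (Suc m) * A ^ Suc m * (c ^ m * \<kappa> ^ Suc m) / 2 ^ Suc m
      - real (Suc m) * c ^ m * (2 * D * A) ^ m * (W + 2 * A * T A * \<kappa> + (T A)\<^sup>2 * (c ^ m * (2 * D * A) ^ Suc m))
      - T A * (real (Suc m) * (real (Suc m) * A ^ Suc m * (c ^ m * \<kappa> ^ Suc m))))" .
    moreover have "H + W + 1 \<le> \<theta> * A * (q / 2)"
      using A1(3) th pos by (simp add: field_simps)
    ultimately show "H < (T A)\<^sup>2 * (real (Suc m) * A ^ Suc m * (c ^ m * \<kappa> ^ Suc m) / 2 ^ Suc m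
      - real (Suc m) * c ^ m * (2 * D * A) ^ m * (W + 2 * A * T A * \<kappa> + (T A)\<^sup>2 * (c ^ m * (2 * D * A) ^ Suc m))
      - T A * (real (Suc m) * (real (Suc m) * A ^ Suc m * (c ^ m * \<kappa> ^ Suc m)))) - W" by linarith
  qed
qed

lemma integral_sq_add_le:
  fixes f h :: "real^'n::finite \<Rightarrow> complex"
  assumes f: "integrable (dual_measure M) (\<lambda>\<xi>. (w \<xi> * cmod (f \<xi>))\<^sup>2)" and h: "integrable (dual_measure M) (\<lambda>\<xi>. (w \<xi> * cmod (h \<xi>))\<^sup>2)"
    and [measurable]: "w \<in> borel_measurable (dual_measure M)" "f \<in> borel_measurable (dual_measure M)" "h \<in> borel_measurable (dual_measure M)"
    and w: "\<And>\<xi>. 0 \<le> w \<xi>"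
  shows "integrable (dual_measure M) (\<lambda>\<xi>. (w \<xi> * cmod (f \<xi> + h \<xi>))\<^sup>2)"
    and "(\<integral>\<xi>. (w \<xi> * cmod (f \<xi> + h \<xi>))\<^sup>2 \<partial>dual_measure M)
      \<le> 2 * (\<integral>\<xi>. (w \<xi> * cmod (f \<xi>))\<^sup>2 \<partial>dual_measure M) + 2 * (\<integral>\<xi>. (w \<xi> * cmod (h \<xi>))\<^sup>2 \<partial>dual_measure M)"
proof -
  let ?r = "\<lambda>\<xi>. 2 * (w \<xi> * cmod (f \<xi>))\<^sup>2 + 2 * (w \<xi> * cmod (h \<xi>))\<^sup>2"
  have pw: "(w \<xi> * cmod (f \<xi> + h \<xi>))\<^sup>2 \<le> ?r \<xi>" for \<xi>
  proof -
    have "(w \<xi> * cmod (f \<xi> + h \<xi>))\<^sup>2 \<le> (w \<xi> * cmod (f \<xi>) + w \<xi> * cmod (h \<xi>))\<^sup>2"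
      using mult_left_mono[OF norm_triangle_ineq w] w by (intro power_mono) (auto simp: distrib_left)
    also have "\<dots> \<le> ?r \<xi>"
      using zero_le_power2[of "w \<xi> * cmod (f \<xi>) - w \<xi> * cmod (h \<xi>)"] unfolding power2_sum power2_diff by linarith
    finally show ?thesis .
  qed
  have r: "integrable (dual_measure M) ?r" by (intro Bochner_Integration.integrable_add integrable_mult_right f h)
  show i: "integrable (dual_measure M) (\<lambda>\<xi>. (w \<xi> * cmod (f \<xi> + h \<xi>))\<^sup>2)"
    by (rule Bochner_Integration.integrable_bound[OF r]) (use pw in \<open>auto intro!: AE_I2 intro: order_trans[OF _ abs_ge_self]\<close>)
  have "(\<integral>\<xi>. (w \<xi> * cmod (f \<xi> + h \<xi>))\<^sup>2 \<partial>dual_measure M) \<le> (\<integral>\<xi>. ?r \<xi> \<partial>dual_measure M)"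
    by (rule integral_mono[OF i r pw])
  then show "(\<integral>\<xi>. (w \<xi> * cmod (f \<xi> + h \<xi>))\<^sup>2 \<partial>dual_measure M)
      \<le> 2 * (\<integral>\<xi>. (w \<xi> * cmod (f \<xi>))\<^sup>2 \<partial>dual_measure M) + 2 * (\<integral>\<xi>. (w \<xi> * cmod (h \<xi>))\<^sup>2 \<partial>dual_measure M)"
    using f h by simp
qed

theorem theorem1p1:
  fixes M :: manifold and k :: nat and s \<sigma> \<epsilon> :: real
    and u0 u1 :: "'n::finite distr"
  assumes "k \<ge> 2" and "s < 0" and "\<sigma> \<in> {1, -1}"
    and "in_Hs M s u0" and "in_Hs M (s - 1) u1"
    and "\<epsilon> > 0"
  shows "\<exists>T u v1 t\<^sub>\<epsilon>. 0 < t\<^sub>\<epsilon> \<and> t\<^sub>\<epsilon> < \<epsilon> \<and> t\<^sub>\<epsilon> \<le> T \<and> nlw_solution M k \<sigma> T u v1 \<and>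
    in_Hs M s (\<lambda>\<phi>. regular_distr M (u 0) \<phi> - u0 \<phi>) \<and>
    in_Hs M (s - 1) (\<lambda>\<phi>. v1 \<phi> - u1 \<phi>) \<and>
    Hs_pair_norm M s (\<lambda>\<phi>. regular_distr M (u 0) \<phi> - u0 \<phi>) (\<lambda>\<phi>. v1 \<phi> - u1 \<phi>) < \<epsilon> \<and>
    in_Hs M s (regular_distr M (u t\<^sub>\<epsilon>)) \<and>
    Hs_norm M s (regular_distr M (u t\<^sub>\<epsilon>)) > inverse \<epsilon>"
proof -
  let ?mu = "dual_measure M :: (real^'n) measure"
  obtain m where k: "k = Suc m" and m: "1 \<le> m" using assms(1) by (cases k) auto
  define g0 where "g0 = fourier M u0"
  define g1 where "g1 = fourier M u1"
  have d0: "distribution M u0" "has_fourier M u0 g0" "integrable ?mu (\<lambda>\<xi>. (japanese \<xi> powr s * cmod (g0 \<xi>))\<^sup>2)"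
    and d1: "distribution M u1" "has_fourier M u1 g1" "integrable ?mu (\<lambda>\<xi>. (japanese \<xi> powr (s - 1) * cmod (g1 \<xi>))\<^sup>2)"
    using assms(4,5) by (simp_all add: in_Hs_def g0_def g1_def)
  note gm [measurable] = has_fourier_measurable[OF d0(2)] has_fourier_measurable[OF d1(2)]
  \<comment> \<open>The squared position error is at most twice the sum of two pieces, truncation
    and bumps; the velocity error is one piece. With \<open>\<epsilon>^2 / 8\<close> for each, the
    total stays below \<open>5 / 8 * \<epsilon>^2\<close>.\<close>
  have eta: "0 < \<epsilon>\<^sup>2 / 8" using assms(6) by simp
  obtain w0 R where w0: "bdd_integrable M w0" "\<And>\<xi>. R < norm \<xi> \<Longrightarrow> w0 \<xi> = 0"
    "integrable ?mu (\<lambda>\<xi>. (japanese \<xi> powr s * cmod (w0 \<xi> - g0 \<xi>))\<^sup>2)"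
    "(\<integral>\<xi>. (japanese \<xi> powr s * cmod (w0 \<xi> - g0 \<xi>))\<^sup>2 \<partial>?mu) < \<epsilon>\<^sup>2 / 8"
    using truncation[OF gm(1) d0(3) eta] by blast
  obtain w1 where w1: "bdd_integrable M w1"
    "integrable ?mu (\<lambda>\<xi>. (japanese \<xi> powr (s - 1) * cmod (w1 \<xi> - g1 \<xi>))\<^sup>2)"
    "(\<integral>\<xi>. (japanese \<xi> powr (s - 1) * cmod (w1 \<xi> - g1 \<xi>))\<^sup>2 \<partial>?mu) < \<epsilon>\<^sup>2 / 8"
    using truncation[OF gm(2) d1(3) eta] by blast
  define c where "c = fourier_const TYPE('n)"
  define \<kappa> where "\<kappa> = (\<integral>\<xi>. bump \<xi> \<partial>?mu :: real)"
  define W where "W = (\<integral>\<xi>. cmod (w0 \<xi>) \<partial>?mu) + (\<integral>\<xi>. cmod (w1 \<xi>) \<partial>?mu)"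
  define D where "D = 1 + 2 * \<kappa>"
  define r where "r = real (Suc m)"
  \<comment> \<open>The size of the low-frequency integral beyond which
    \<open>low_frequency_le_Hs\<close> forces the \<open>H^s\<close> norm above
    \<open>1 / \<epsilon>\<close>.\<close>
  define H where "H = (1 + r) powr (- s) * ((inverse \<epsilon>)\<^sup>2 + (\<integral>\<xi>. indicator (cball 0 r) \<xi> \<partial>?mu))"
  have c: "0 < c" unfolding c_def by (rule fourier_const_pos)
  have kp: "0 < \<kappa>" unfolding \<kappa>_def by (rule integral_indicator_cball_pos) simp
  have W0: "0 \<le> W" by (simp add: W_def)
  obtain A T where Tb: "0 < T" "T \<le> 1" "T < \<epsilon>" and A: "0 \<le> A" "W \<le> A"
    and small: "T\<^sup>2 * c ^ m * (2 * (D * A)) ^ m \<le> 1 / 2"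
    and big: "H < T\<^sup>2 * (real (Suc m) * A ^ Suc m * (c ^ m * \<kappa> ^ Suc m) / 2 ^ Suc m
      - real (Suc m) * c ^ m * (2 * D * A) ^ m * (W + 2 * A * T * \<kappa> + T\<^sup>2 * (c ^ m * (2 * D * A) ^ Suc m))
      - T * (real (Suc m) * (real (Suc m) * A ^ Suc m * (c ^ m * \<kappa> ^ Suc m)))) - W"
    using inflation_parameters[OF m c kp W0 assms(6), of H] unfolding D_def by blast
  \<comment> \<open>Only now is \<open>N\<close> chosen: \<open>A\<close> and \<open>T\<close> do
    not depend on it, so the \<open>H^s\<close> norm of the bumps can be made small for a fixed
    amplitude.\<close>
  obtain N :: nat where N: "m + 3 \<le> N" and Nsmall: "((real N - 1) powr s)\<^sup>2 * (4 * A\<^sup>2 * \<kappa>) < \<epsilon>\<^sup>2 / 8"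
  proof -
    have "filterlim (\<lambda>N. (-1) + real N) at_top sequentially"
      by (rule filterlim_tendsto_add_at_top[OF tendsto_const filterlim_real_sequentially])
    then have "(\<lambda>N. (real N - 1) powr s) \<longlonglongrightarrow> 0"
      by (intro tendsto_neg_powr assms(2)) simp
    then have "(\<lambda>N. ((real N - 1) powr s)\<^sup>2 * (4 * A\<^sup>2 * \<kappa>)) \<longlonglongrightarrow> 0\<^sup>2 * (4 * A\<^sup>2 * \<kappa>)"
      by (intro tendsto_intros)
    then have "\<forall>\<^sub>F N in sequentially. ((real N - 1) powr s)\<^sup>2 * (4 * A\<^sup>2 * \<kappa>) < \<epsilon>\<^sup>2 / 8"
      using eta by (intro order_tendstoD(2)) auto
    then have "\<forall>\<^sub>F N in sequentially. ((real N - 1) powr s)\<^sup>2 * (4 * A\<^sup>2 * \<kappa>) < \<epsilon>\<^sup>2 / 8 \<and> m + 3 \<le> N"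
      using eventually_ge_at_top[of "m + 3"] by eventually_elim simp
    then show ?thesis using that by (auto dest: eventually_happens)
  qed
  \<comment> \<open>Names an arbitrary coordinate direction to carry the bumps.\<close>
  obtain i :: 'n where True by simp
  define b1 b2 :: "real^'n" where "b1 = axis i (real N)" and "b2 = axis i (- real (m * N))"
  have bs: "b1 \<in> space ?mu" "b2 \<in> space ?mu"
    using space_dual_axis[of i "int N" M] space_dual_axis[of i "- int (m * N)" M] by (simp_all add: b1_def b2_def)
  have nb: "norm b1 = real N" "norm b2 = real (m * N)"
    by (simp_all only: b1_def b2_def norm_axis abs_minus_cancel abs_of_nat)
  have mN: "real N \<le> real (m * N)" using mult_le_mono1[OF m, of N] by (simp only: of_nat_le_iff mult_1)
  define \<phi> :: "real^'n \<Rightarrow> complex" where "\<phi> \<xi> = of_real A * (bump (\<xi> - b1) + bump (\<xi> - b2))" for \<xi>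
  have phi: "bdd_integrable M \<phi>" unfolding \<phi>_def
    by (intro bdd_integrable_cmult bdd_integrable_add translated_bump bs)
  have phi_Hs: "(\<integral>\<xi>. (japanese \<xi> powr s * cmod (\<phi> \<xi>))\<^sup>2 \<partial>?mu) < \<epsilon>\<^sup>2 / 8"
    unfolding \<phi>_def
    by (rule le_less_trans[OF bumps_Hs_bound[OF bs _ _ _ assms(2), of "real N"] Nsmall[unfolded \<kappa>_def]])
       (use N mN nb in auto)
  have phi_L1: "(\<integral>\<xi>. cmod (\<phi> \<xi>) \<partial>?mu) \<le> 2 * \<kappa> * A"
  proof -
    have ib: "integrable ?mu (\<lambda>\<xi>. bump (\<xi> - b) :: real)" if "b \<in> space ?mu" for b
      by (rule bdd_integrableD(1)[OF translated_bump(2)[OF that]])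
    have "(\<integral>\<xi>. cmod (\<phi> \<xi>) \<partial>?mu) \<le> (\<integral>\<xi>. A * (bump (\<xi> - b1) + bump (\<xi> - b2)) \<partial>?mu)"
    proof (intro integral_mono integrable_norm bdd_integrableD(1)[OF phi] integrable_mult_right Bochner_Integration.integrable_add ib bs)
      show "cmod (\<phi> \<xi>) \<le> A * (bump (\<xi> - b1) + bump (\<xi> - b2))" for \<xi>
        using A by (simp add: \<phi>_def norm_mult indicator_def)
    qed
    also have "\<dots> = A * (\<kappa> + \<kappa>)"
      by (simp only: Bochner_Integration.integral_mult_right_zero Bochner_Integration.integral_add[OF ib[OF bs(1)] ib[OF bs(2)]]
          translated_bump(3)[OF bs(1)] translated_bump(3)[OF bs(2)] \<kappa>_def)
    finally show ?thesis by (simp add: algebra_simps)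
  qed
  define v0 where "v0 \<xi> = w0 \<xi> + \<phi> \<xi>" for \<xi>
  have v0: "bdd_integrable M v0" unfolding v0_def by (intro bdd_integrable_add w0 phi)
  \<comment> \<open>Background and velocity together have mass \<open>W \<le> A\<close>, the two
    bumps at most \<open>2 * \<kappa> * A\<close>; this is the origin of
    \<open>D = 1 + 2 * \<kappa>\<close>.\<close>
  have GD: "(\<integral>\<xi>. cmod (v0 \<xi>) + T * cmod (w1 \<xi>) \<partial>?mu) \<le> D * A"
  proof -
    have ii: "integrable ?mu (\<lambda>\<xi>. cmod (w0 \<xi>))" "integrable ?mu (\<lambda>\<xi>. cmod (\<phi> \<xi>))" "integrable ?mu (\<lambda>\<xi>. cmod (w1 \<xi>))"
      by (intro integrable_norm bdd_integrableD(1) w0 phi w1)+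
    have "(\<integral>\<xi>. cmod (v0 \<xi>) + T * cmod (w1 \<xi>) \<partial>?mu) \<le> (\<integral>\<xi>. cmod (w0 \<xi>) + cmod (\<phi> \<xi>) + cmod (w1 \<xi>) \<partial>?mu)"
    proof (intro integral_mono Bochner_Integration.integrable_add integrable_mult_right integrable_norm bdd_integrableD(1) v0 w0 phi w1)
      show "cmod (v0 \<xi>) + T * cmod (w1 \<xi>) \<le> cmod (w0 \<xi>) + cmod (\<phi> \<xi>) + cmod (w1 \<xi>)" for \<xi>
        unfolding v0_def using Tb by (intro add_mono norm_triangle_ineq mult_left_le_one_le) auto
    qed
    also have "\<dots> = W + (\<integral>\<xi>. cmod (\<phi> \<xi>) \<partial>?mu)" using ii by (simp add: W_def)
    also have "\<dots> \<le> A + 2 * \<kappa> * A" by (intro add_mono A phi_L1)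
    finally show ?thesis by (simp add: D_def algebra_simps)
  qed
  have v0_supp: "v0 \<xi> = 0" if "max R (real (m * N) + 1) < norm \<xi>" for \<xi>
  proof -
    have "bump (\<xi> - b) = (0::complex)" if "norm b \<le> real (m * N)" for b
    proof -
      have "norm \<xi> \<le> norm (\<xi> - b) + norm b" using norm_triangle_ineq[of "\<xi> - b" b] by simp
      then have "1 < norm (\<xi> - b)" using that \<open>max R (real (m * N) + 1) < norm \<xi>\<close> by simp
      then show ?thesis by (simp add: indicator_def)
    qed
    from this[of b1] this[of b2] show ?thesis using that w0(2)[of \<xi>] mN by (simp add: v0_def \<phi>_def nb)
  qed
  \<comment> \<open>The support radius covers the truncated background and the outer bump, which
    reaches out to \<open>m * N + 1\<close>.\<close>
  interpret picard M m \<sigma> T v0 w1 "max R (real (m * N) + 1)"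
  proof
    show "\<bar>\<sigma>\<bar> = 1" using assms(3) by auto
    let ?G = "\<integral>\<xi>. cmod (v0 \<xi>) + T * cmod (w1 \<xi>) \<partial>?mu"
    have "T\<^sup>2 * fourier_const TYPE('n) ^ m * (2 * ?G) ^ m \<le> T\<^sup>2 * c ^ m * (2 * (D * A)) ^ m"
      unfolding c_def[symmetric] using c Tb GD by (intro mult_left_mono power_mono) auto
    then show "T\<^sup>2 * fourier_const TYPE('n) ^ m * (2 * ?G) ^ m \<le> 1 / 2" using small by simp
    show "v0 \<xi> = 0" if "max R (real (m * N) + 1) < norm \<xi>" for \<xi> by (rule v0_supp[OF that])
  qed (fact Tb(1) v0 w1)+
  define u where "u t = inv_fourier M (V t)" for t
  have u0: "u 0 = inv_fourier M v0" unfolding u_def by (rule inv_fourier_cong) (rule V_0)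
  have TT: "T \<in> {0..T}" using Tb by simp
  have F0: "has_fourier M (\<lambda>\<phi>. regular_distr M (u 0) \<phi> - u0 \<phi>) (\<lambda>\<xi>. v0 \<xi> - g0 \<xi>)"
    unfolding u0 by (rule has_fourier_diff[OF has_fourier_inv_fourier[OF bdd_integrableD(1)[OF v0]] d0(2)])
  have F1: "has_fourier M (\<lambda>\<phi>. regular_distr M (inv_fourier M w1) \<phi> - u1 \<phi>) (\<lambda>\<xi>. w1 \<xi> - g1 \<xi>)"
    by (rule has_fourier_diff[OF has_fourier_inv_fourier[OF bdd_integrableD(1)[OF w1(1)]] d1(2)])
  have FT: "has_fourier M (regular_distr M (u T)) (V T)"
    unfolding u_def by (rule has_fourier_inv_fourier[OF bdd_integrableD(1)[OF bdd_integrable_V[OF TT]]])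
  note [measurable] = bdd_integrableD(2)[OF w0(1)] bdd_integrableD(2)[OF phi]
  have split: "v0 \<xi> - g0 \<xi> = (w0 \<xi> - g0 \<xi>) + \<phi> \<xi>" for \<xi> by (simp add: v0_def)
  have wm: "(\<lambda>\<xi>. w0 \<xi> - g0 \<xi>) \<in> borel_measurable ?mu" by measurable
  note sq = integral_sq_add_le[OF w0(3) bdd_integrable_Hs[OF phi less_imp_le[OF assms(2)]] japanese_powr_measurable wm bdd_integrableD(2)[OF phi] powr_ge_zero]
  have I0: "integrable ?mu (\<lambda>\<xi>. (japanese \<xi> powr s * cmod (v0 \<xi> - g0 \<xi>))\<^sup>2)"
    and I0': "(\<integral>\<xi>. (japanese \<xi> powr s * cmod (v0 \<xi> - g0 \<xi>))\<^sup>2 \<partial>?mu)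
       \<le> 2 * (\<integral>\<xi>. (japanese \<xi> powr s * cmod (w0 \<xi> - g0 \<xi>))\<^sup>2 \<partial>?mu) + 2 * (\<integral>\<xi>. (japanese \<xi> powr s * cmod (\<phi> \<xi>))\<^sup>2 \<partial>?mu)"
    unfolding split by (rule sq)+
  have "Hs_pair_norm M s (\<lambda>\<phi>. regular_distr M (u 0) \<phi> - u0 \<phi>) (\<lambda>\<phi>. regular_distr M (inv_fourier M w1) \<phi> - u1 \<phi>) < \<epsilon>"
  proof -
    have "(\<integral>\<xi>. (japanese \<xi> powr s * cmod (v0 \<xi> - g0 \<xi>))\<^sup>2 \<partial>?mu) + (\<integral>\<xi>. (japanese \<xi> powr (s - 1) * cmod (w1 \<xi> - g1 \<xi>))\<^sup>2 \<partial>?mu) < \<epsilon>\<^sup>2"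
      using I0' w0(4) phi_Hs w1(3) zero_le_power2[of \<epsilon>] by linarith
    then show ?thesis
      unfolding Hs_pair_norm_def in_Hs_iff(2)[OF F0] in_Hs_iff(2)[OF F1]
      using assms(6) by (intro real_less_lsqrt) auto
  qed
  moreover have "in_Hs M s (\<lambda>\<phi>. regular_distr M (u 0) \<phi> - u0 \<phi>)"
    unfolding in_Hs_iff(1)[OF F0[unfolded u0]] u0
    by (rule conjI[OF distribution_diff[OF distribution_inv_fourier[OF bdd_integrableD(1)[OF v0]] d0(1)] I0])
  moreover have "in_Hs M (s - 1) (\<lambda>\<phi>. regular_distr M (inv_fourier M w1) \<phi> - u1 \<phi>)"
    unfolding in_Hs_iff(1)[OF F1]
    by (rule conjI[OF distribution_diff[OF distribution_inv_fourier[OF bdd_integrableD(1)[OF w1(1)]] d1(1)] w1(2)])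
  moreover have "in_Hs M s (regular_distr M (u T))"
    unfolding in_Hs_iff(1)[OF FT]
    unfolding u_def
    by (rule conjI[OF distribution_inv_fourier[OF bdd_integrableD(1)[OF bdd_integrable_V[OF TT]]] bdd_integrable_Hs[OF bdd_integrable_V[OF TT] less_imp_le[OF assms(2)]]])
  moreover have "inverse \<epsilon> < Hs_norm M s (regular_distr M (u T))"
  proof -
    let ?S = "\<integral>\<xi>. (japanese \<xi> powr s * cmod (V T \<xi>))\<^sup>2 \<partial>?mu"
    have "H < cmod (\<integral>\<xi>. indicator (cball 0 r) \<xi> * V T \<xi> \<partial>?mu)"
      unfolding r_def
    proof (rule less_le_trans[OF big], unfold c_def \<kappa>_def W_def, rule low_frequency_growth[OF N m A(1) Tb(2) w0(1)])
      show "v0 \<xi> = w0 \<xi> + of_real A * (bump (\<xi> - axis i (real N)) + bump (\<xi> - axis i (- real (m * N))))" for \<xi>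
        by (simp only: v0_def \<phi>_def b1_def b2_def)
      show "G \<le> D * A" using GD by (simp only: G_def g_def)
      show "(\<integral>\<xi>. bump \<xi> \<partial>?mu) \<le> D" using kp by (simp add: D_def \<kappa>_def)
    qed
    also have "\<dots> \<le> (1 + r) powr (- s) * (?S + (\<integral>\<xi>. indicator (cball 0 r) \<xi> \<partial>?mu))"
      by (rule low_frequency_le_Hs[OF bdd_integrable_V[OF TT] less_imp_le[OF assms(2)]])
    finally have "(inverse \<epsilon>)\<^sup>2 < ?S"
      unfolding H_def by (subst (asm) mult_less_cancel_left_pos) (auto simp: r_def)
    then show ?thesis unfolding in_Hs_iff(2)[OF FT] by (rule real_less_rsqrt)
  qed
  moreover have "nlw_solution M k \<sigma> T u (regular_distr M (inv_fourier M w1))"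
    using solution unfolding k u_def[abs_def] .
  \<comment> \<open>The inflation time is the endpoint \<open>T\<close> of the interval of
    existence.\<close>
  ultimately show ?thesis using Tb(1,3) by (intro exI[of _ T] exI[of _ u] exI[of _ "regular_distr M (inv_fourier M w1)"] conjI order_refl)
qed

end
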